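(* Let $\mathcal{P}=\mathcal{T}_1\times\cdots\times\mathcal{T}_n$ be a product of finitely many totally ordered sets, each with at least two elements, with the product order. Let $\mathfrak{H}$ be a grid covering of $\mathcal{P}$ and let $(\mathcal{X},\{\mathcal{X}_{\mathcal{Q}}\}_{\mathcal{Q}\in\mathfrak{H}})$ be an $(\mathfrak{H},\mathcal{P})$-extended projective class. Then the following are equivalent: 1. $\mathrm{proj}(\mathcal{F}_{\mathcal{X}})=\mathrm{add}(\mathcal{X})$ and $\mathrm{rep}\,\mathcal{P}$ has enough $\mathcal{F}_{\mathcal{X}}$-projectives. 2. For all $\mathcal{Q}\in\mathfrak{H}$, $\mathrm{proj}(\mathcal{F}_{\mathcal{X}_{\mathcal{Q}}})=\mathrm{add}(\mathcal{X}_{\mathcal{Q}})$ and $\mathrm{rep}\,\mathcal{Q}$ has enough $\mathcal{F}_{\mathcal{X}_{\mathcal{Q}}}$-projectives.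
   Context: Fix a field $\mathbb{K}$. A poset $\mathcal{P}$ is viewed as a category with a unique morphism $x\to y$ whenever $x\leq y$. A representation of $\mathcal{P}$ is a functor $M$ from $\mathcal{P}$ to $\mathbb{K}$-vector spaces, with spaces $M(x)$ and structure maps $M(x,y)$ for $x\leq y$; $\mathrm{Rep}\,\mathcal{P}$ is the category of all representations and $\mathrm{rep}\,\mathcal{P}$ the full subcategory of finitely presentable ones (cokernels of morphisms between finitely generated projective objects of $\mathrm{Rep}\,\mathcal{P}$); it is abelian and Krull-Remak-Schmidt for the posets considered here. For $x\in\mathcal{P}$ let $P_x$ be the indecomposable projective with $P_x(z)=\mathbb{K}$ for $z\geq x$, $0$ otherwise, and identity maps where possible; up to isomorphism these are all the indecomposable projectives. $\mathrm{add}(\mathcal{C})$ is the smallest full subcategory containing $\mathcal{C}$ closed under isomorphisms, finite direct sums and direct summands; $\mathrm{ind}(\mathcal{C})$ is the set of indecomposable objects of $\mathcal{C}$ (one representative per isomorphism class; isomorphic objects are identified); $\mathrm{proj}(\mathrm{rep}\,\mathcal{P})$ is the class of projective objects of $\mathrm{rep}\,\mathcal{P}$. Relative homological algebra. For a class $\mathcal{X}$ of objects of an abelian category $\mathcal{A}$, $\mathcal{F}_{\mathcal{X}}$ is the class of short exact sequences $0\to L\to M\xrightarrow{g}N\to0$ such that $\mathrm{Hom}(X,g)$ is surjective for all $X\in\mathcal{X}$; an epimorphism $g$ is $\mathcal{F}_{\mathcal{X}}$-admissible if $0\to\ker g\to M\xrightarrow{g}N\to 0$ is in $\mathcal{F}_{\mathcal{X}}$.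 $\mathrm{proj}(\mathcal{F}_{\mathcal{X}})$ is the class of objects $U$ such that $\mathrm{Hom}(U,g)$ is surjective for every $\mathcal{F}_{\mathcal{X}}$-admissible epimorphism $g$. An $\mathrm{add}(\mathcal{X})$-precover of $M$ is an $\mathcal{F}_{\mathcal{X}}$-admissible epimorphism $U\to M$ with $U\in\mathrm{add}(\mathcal{X})$. One says there are enough $\mathcal{F}_{\mathcal{X}}$-projectives if every object admits an $\mathrm{add}(\mathcal{X})$-precover and $\mathrm{add}(\mathcal{X})=\mathrm{proj}(\mathcal{F}_{\mathcal{X}})$. Grids. A finite aligned subgrid of $\mathcal{P}$ is a subset $\mathcal{Q}=\mathcal{T}_1'\times\cdots\times\mathcal{T}_n'$ with each $\mathcal{T}_i'\subseteq\mathcal{T}_i$ finite; $\mathfrak{G}(\mathcal{P})$ is the set of these. Put $\mathcal{Q}^+=\{x\in\mathcal{P}\mid\exists y\in\mathcal{Q}:y\leq x\}$; for $x\in\mathcal{Q}^+$, $\lfloor x\rfloor_{\mathcal{Q}}=\max\{y\in\mathcal{Q}\mid y\leq x\}$; for $y\in\mathcal{Q}$, $\lceil y\rceil_{\mathcal{Q}}=\{x\in\mathcal{Q}^+\mid\lfloor x\rfloor_{\mathcal{Q}}=y\}$. $\mathrm{rep}(\mathcal{P};\mathcal{Q}^+)$ is the full subcategory of $\mathrm{rep}\,\mathcal{P}$ of representations supported in $\mathcal{Q}^+$. For $M\in\mathrm{rep}\,\mathcal{P}$ with minimal projective presentation $P_1\to P_0\to M\to0$, $\mathcal{L}(M)$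 is the smallest finite aligned subgrid containing all $x$ such that $P_x$ is a direct summand of $P_1\oplus P_0$. Extension functor $\lceil-\rceil_{\mathcal{Q}}:\mathrm{rep}\,\mathcal{Q}\to\mathrm{rep}(\mathcal{P};\mathcal{Q}^+)$: $\lceil N\rceil_{\mathcal{Q}}(x)=N(\lfloor x\rfloor_{\mathcal{Q}})$ for $x\in\mathcal{Q}^+$ and $0$ otherwise; $\lceil N\rceil_{\mathcal{Q}}(x,x')=N(\lfloor x\rfloor_{\mathcal{Q}},\lfloor x'\rfloor_{\mathcal{Q}})$ if $x\leq x'$ are in $\mathcal{Q}^+$, and $0$ otherwise. Contraction functor $\lfloor-\rfloor_{\mathcal{Q}}:\mathrm{rep}(\mathcal{P};\mathcal{Q}^+)\to\mathrm{rep}\,\mathcal{Q}$: $\lfloor M\rfloor_{\mathcal{Q}}(y)=\mathrm{colim}_{x\in\lceil y\rceil_{\mathcal{Q}}}M(x)$ (filtered colimit over the directed subposet $\lceil y\rceil_{\mathcal{Q}}$), with $\lfloor M\rfloor_{\mathcal{Q}}(y,y')$ for $y\leq y'$ induced by the maps $M(x,y'\vee x)$, $x\in\lceil y\rceil_{\mathcal{Q}}$ (where $y'\vee x\in\lceil y'\rceil_{\mathcal{Q}}$). A grid covering of $\mathcal{P}$ is a subset $\mathfrak{H}\subseteq\mathfrak{G}(\mathcal{P})$ such that every $x\in\mathcal{P}$ lies in some $\mathcal{Q}\in\mathfrak{H}$. Given $\mathcal{X}\subseteq\mathrm{ind}(\mathrm{rep}\,\mathcal{P})$ and $\mathcal{X}_{\mathcal{Q}}\subseteq\mathrm{ind}(\mathrm{rep}\,\mathcal{Q})$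 for each $\mathcal{Q}\in\mathfrak{H}$, the pair $(\mathcal{X},\{\mathcal{X}_{\mathcal{Q}}\}_{\mathcal{Q}\in\mathfrak{H}})$ is an $(\mathfrak{H},\mathcal{P})$-extended projective class if: (1) $\mathrm{ind}(\mathrm{proj}(\mathrm{rep}\,\mathcal{P}))\subseteq\mathcal{X}$; (2) $\mathrm{ind}(\mathrm{proj}(\mathrm{rep}\,\mathcal{Q}))\subseteq\mathcal{X}_{\mathcal{Q}}$ for all $\mathcal{Q}\in\mathfrak{H}$; (3) $\mathrm{add}(\mathcal{X})=\mathrm{add}\left(\bigcup_{\mathcal{Q}\in\mathfrak{H}}\{\lceil Y\rceil_{\mathcal{Q}}\mid Y\in\mathcal{X}_{\mathcal{Q}}\}\right)$; (4) $\mathrm{add}(\mathcal{X}_{\mathcal{Q}})=\mathrm{add}\{\lfloor X\rfloor_{\mathcal{Q}}\mid X\in\mathcal{X}\cap\mathrm{rep}(\mathcal{P};\mathcal{Q}^+)\}$ for all $\mathcal{Q}\in\mathfrak{H}$; (5) $\mathrm{Hom}_{\mathcal{P}}(X,\lceil N\rceil_{\mathcal{Q}})=0$ for all $\mathcal{Q}\in\mathfrak{H}$, $N\in\mathrm{rep}\,\mathcal{Q}$ and $X\in\mathcal{X}\setminus\mathrm{rep}(\mathcal{P};\mathcal{Q}^+)$; (6) for all $M\in\mathrm{rep}\,\mathcal{P}$ there exists $\mathcal{Q}\in\mathfrak{H}$ with $\mathcal{L}(M)\subseteq\mathcal{Q}$. *)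

theory Defs
  imports Complex_Main "HOL-Library.FuncSet"
begin

text \<open>
  A poset is a subset \<open>P\<close> of a type of class \<^class>\<open>order\<close>, with the induced order. All vector
  spaces are linear subspaces of one ambient vector space over the field, which plays the role
  of the universe; up to isomorphism these are all vector spaces whose dimension is at most that of
  the ambient space. It is an arbitrary infinite-dimensional space (locale \<open>vec_universe\<close> below), so
  every finite-dimensional space occurs.

  Representations and morphisms are total functions whose values off \<open>P\<close> and off the spaces are
  irrelevant. Equality of morphisms is therefore always stated on the spaces.
\<close>

record ('p, 'v) prep =
  sp :: "'p \<Rightarrow> 'v set"
  mp :: "'p \<Rightarrow> 'p \<Rightarrow> 'v \<Rightarrow> 'v"

type_synonym ('p, 'v) mor = "'p \<Rightarrow> 'v \<Rightarrow> 'v"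

definition comp_mor :: "('p, 'v) mor \<Rightarrow> ('p, 'v) mor \<Rightarrow> ('p, 'v) mor" where
  "comp_mor g f = (\<lambda>x v. g x (f x v))"

definition id_mor :: "('p, 'v) mor" where
  "id_mor = (\<lambda>x v. v)"

definition zero_mor :: "('p, 'v::zero) mor" where
  "zero_mor = (\<lambda>x v. 0)"

definition mor_eq :: "'p set \<Rightarrow> ('p, 'v) prep \<Rightarrow> ('p, 'v) mor \<Rightarrow> ('p, 'v) mor \<Rightarrow> bool" where
  "mor_eq P M f g \<longleftrightarrow> (\<forall>x\<in>P. \<forall>v\<in>sp M x. f x v = g x v)"

definition is_zero :: "'p set \<Rightarrow> ('p, 'v::zero) prep \<Rightarrow> bool" where
  "is_zero P M \<longleftrightarrow> (\<forall>x\<in>P. sp M x = {0})"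


subsection \<open>Grids\<close>

definition grid_poset :: "nat \<Rightarrow> (nat \<Rightarrow> 't set) \<Rightarrow> (nat \<Rightarrow> 't) set" where
  "grid_poset n T = (\<Pi>\<^sub>E i\<in>{..<n}. T i)"

definition subgrids :: "nat \<Rightarrow> (nat \<Rightarrow> 't set) \<Rightarrow> (nat \<Rightarrow> 't) set set" where
  "subgrids n T = {grid_poset n T' | T'. \<forall>i<n. T' i \<subseteq> T i \<and> finite (T' i)}"

definition grid_covering :: "nat \<Rightarrow> (nat \<Rightarrow> 't set) \<Rightarrow> (nat \<Rightarrow> 't) set set \<Rightarrow> bool" where
  "grid_covering n T H \<longleftrightarrow> H \<subseteq> subgrids n T \<and> (\<forall>x\<in>grid_poset n T. \<exists>Q\<in>H. x \<in> Q)"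

definition upper :: "'p::order set \<Rightarrow> 'p set \<Rightarrow> 'p set" where
  "upper P Q = {x\<in>P. \<exists>y\<in>Q. y \<le> x}"

definition floor_in :: "'p::order set \<Rightarrow> 'p \<Rightarrow> 'p" where
  "floor_in Q x = (GREATEST y. y \<in> Q \<and> y \<le> x)"

definition ceil_in :: "'p::order set \<Rightarrow> 'p set \<Rightarrow> 'p \<Rightarrow> 'p set" where
  "ceil_in P Q y = {x\<in>upper P Q. floor_in Q x = y}"

definition join_in :: "'p::order set \<Rightarrow> 'p \<Rightarrow> 'p \<Rightarrow> 'p" where
  "join_in P x y = (LEAST z. z \<in> P \<and> x \<le> z \<and> y \<le> z)"

definition extension ::
    "'p::order set \<Rightarrow> 'p set \<Rightarrow> ('p, 'v::zero) prep \<Rightarrow> ('p, 'v) prep" where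
  "extension P Q N =
    \<lparr> sp = (\<lambda>x. if x \<in> upper P Q then sp N (floor_in Q x) else {0}),
      mp = (\<lambda>x x' v. if x \<in> upper P Q \<and> x' \<in> upper P Q \<and> x \<le> x'
                     then mp N (floor_in Q x) (floor_in Q x') v else 0) \<rparr>"


subsection \<open>Categories of representations\<close>

locale vec_universe = vector_space scale
  for scale :: "'a::field \<Rightarrow> 'b::ab_group_add \<Rightarrow> 'b" (infixr \<open>*s\<close> 75) +
  assumes infinite_dimensional: "\<not> (\<exists>B. finite B \<and> span B = UNIV)"
begin

definition lin_on :: "'b set \<Rightarrow> 'b set \<Rightarrow> ('b \<Rightarrow> 'b) \<Rightarrow> bool" where
  "lin_on V W f \<longleftrightarrow> f ` V \<subseteq> W \<and>
     (\<forall>u\<in>V. \<forall>v\<in>V. f (u + v) = f u + f v) \<and> (\<forall>c. \<forall>v\<in>V. f (c *s v) = c *s f v)"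

definition Rep :: "'p::order set \<Rightarrow> ('p, 'b) prep set" where
  "Rep P = {M.
     (\<forall>x\<in>P. subspace (sp M x)) \<and>
     (\<forall>x\<in>P. \<forall>y\<in>P. x \<le> y \<longrightarrow> lin_on (sp M x) (sp M y) (mp M x y)) \<and>
     (\<forall>x\<in>P. \<forall>v\<in>sp M x. mp M x x v = v) \<and>
     (\<forall>x\<in>P. \<forall>y\<in>P. \<forall>z\<in>P. x \<le> y \<longrightarrow> y \<le> z \<longrightarrow>
        (\<forall>v\<in>sp M x. mp M y z (mp M x y v) = mp M x z v))}"

definition Hom :: "'p::order set \<Rightarrow> ('p, 'b) prep \<Rightarrow> ('p, 'b) prep \<Rightarrow> ('p, 'b) mor set" where
  "Hom P M N = {f.
     (\<forall>x\<in>P. lin_on (sp M x) (sp N x) (f x)) \<and>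
     (\<forall>x\<in>P. \<forall>y\<in>P. x \<le> y \<longrightarrow> (\<forall>v\<in>sp M x. f y (mp M x y v) = mp N x y (f x v)))}"

definition isomorphic :: "'p::order set \<Rightarrow> ('p, 'b) prep \<Rightarrow> ('p, 'b) prep \<Rightarrow> bool" where
  "isomorphic P M N \<longleftrightarrow> (\<exists>f\<in>Hom P M N. \<exists>g\<in>Hom P N M.
     mor_eq P M (comp_mor g f) id_mor \<and> mor_eq P N (comp_mor f g) id_mor)"

text \<open>
  In the following, a class \<open>C\<close> of objects of \<open>Rep P\<close> stands for the full subcategory of
  \<open>Rep P\<close> on \<open>C\<close>.
\<close>

definition epi :: "'p::order set \<Rightarrow> ('p, 'b) prep set \<Rightarrow>
    ('p, 'b) prep \<Rightarrow> ('p, 'b) mor \<Rightarrow> ('p, 'b) prep \<Rightarrow> bool" where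
  "epi P C M g N \<longleftrightarrow> M \<in> C \<and> N \<in> C \<and> g \<in> Hom P M N \<and>
     (\<forall>Z\<in>C. \<forall>h\<in>Hom P N Z. \<forall>h'\<in>Hom P N Z.
        mor_eq P M (comp_mor h g) (comp_mor h' g) \<longrightarrow> mor_eq P N h h')"

definition is_kernel :: "'p::order set \<Rightarrow> ('p, 'b) prep set \<Rightarrow> ('p, 'b) prep \<Rightarrow> ('p, 'b) mor \<Rightarrow>
    ('p, 'b) prep \<Rightarrow> ('p, 'b) mor \<Rightarrow> ('p, 'b) prep \<Rightarrow> bool" where
  "is_kernel P C L f M g N \<longleftrightarrow> L \<in> C \<and> M \<in> C \<and> N \<in> C \<and> f \<in> Hom P L M \<and> g \<in> Hom P M N \<and>
     mor_eq P L (comp_mor g f) zero_mor \<and>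
     (\<forall>Z\<in>C. \<forall>h\<in>Hom P Z M. mor_eq P Z (comp_mor g h) zero_mor \<longrightarrow>
        (\<exists>k\<in>Hom P Z L. mor_eq P Z (comp_mor f k) h \<and>
           (\<forall>k'\<in>Hom P Z L. mor_eq P Z (comp_mor f k') h \<longrightarrow> mor_eq P Z k' k)))"

definition is_cokernel :: "'p::order set \<Rightarrow> ('p, 'b) prep set \<Rightarrow> ('p, 'b) prep \<Rightarrow> ('p, 'b) mor \<Rightarrow>
    ('p, 'b) prep \<Rightarrow> ('p, 'b) mor \<Rightarrow> ('p, 'b) prep \<Rightarrow> bool" where
  "is_cokernel P C L f M g N \<longleftrightarrow> L \<in> C \<and> M \<in> C \<and> N \<in> C \<and> f \<in> Hom P L M \<and> g \<in> Hom P M N \<and>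
     mor_eq P L (comp_mor g f) zero_mor \<and>
     (\<forall>Z\<in>C. \<forall>h\<in>Hom P M Z. mor_eq P L (comp_mor h f) zero_mor \<longrightarrow>
        (\<exists>k\<in>Hom P N Z. mor_eq P M (comp_mor k g) h \<and>
           (\<forall>k'\<in>Hom P N Z. mor_eq P M (comp_mor k' g) h \<longrightarrow> mor_eq P N k' k)))"

definition short_exact :: "'p::order set \<Rightarrow> ('p, 'b) prep set \<Rightarrow> ('p, 'b) prep \<Rightarrow> ('p, 'b) mor \<Rightarrow>
    ('p, 'b) prep \<Rightarrow> ('p, 'b) mor \<Rightarrow> ('p, 'b) prep \<Rightarrow> bool" where
  "short_exact P C L f M g N \<longleftrightarrow> is_kernel P C L f M g N \<and> is_cokernel P C L f M g N"

text \<open>Surjectivity of the map \<open>Hom(U, M) \<rightarrow> Hom(U, N)\<close> induced by \<open>g\<close>.\<close>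

definition Hom_surj :: "'p::order set \<Rightarrow> ('p, 'b) prep \<Rightarrow>
    ('p, 'b) prep \<Rightarrow> ('p, 'b) mor \<Rightarrow> ('p, 'b) prep \<Rightarrow> bool" where
  "Hom_surj P U M g N \<longleftrightarrow> (\<forall>h\<in>Hom P U N. \<exists>k\<in>Hom P U M. mor_eq P U (comp_mor g k) h)"

definition proj :: "'p::order set \<Rightarrow> ('p, 'b) prep set \<Rightarrow> ('p, 'b) prep set" where
  "proj P C = {U\<in>C. \<forall>M g N. epi P C M g N \<longrightarrow> Hom_surj P U M g N}"

definition fin_gen :: "'p::order set \<Rightarrow> ('p, 'b) prep \<Rightarrow> bool" where
  "fin_gen P M \<longleftrightarrow> (\<exists>G. finite G \<and> (\<forall>(x, v)\<in>G. x \<in> P \<and> v \<in> sp M x) \<and>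
     (\<forall>y\<in>P. sp M y = span {mp M x y v | x v. (x, v) \<in> G \<and> x \<le> y}))"

text \<open>The category of finitely presentable representations.\<close>

definition fp_rep :: "'p::order set \<Rightarrow> ('p, 'b) prep set" where
  "fp_rep P = {M. \<exists>P1 d P0 g.
     P1 \<in> proj P (Rep P) \<and> fin_gen P P1 \<and> P0 \<in> proj P (Rep P) \<and> fin_gen P P0 \<and>
     is_cokernel P (Rep P) P1 d P0 g M}"

definition direct_sum :: "'p::order set \<Rightarrow> ('p, 'b) prep list \<Rightarrow> ('p, 'b) prep \<Rightarrow> bool" where
  "direct_sum P Ms S \<longleftrightarrow> (\<exists>\<iota> \<pi>.
     (\<forall>j<length Ms. \<iota> j \<in> Hom P (Ms ! j) S \<and> \<pi> j \<in> Hom P S (Ms ! j)) \<and>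
     (\<forall>j<length Ms. \<forall>k<length Ms.
        mor_eq P (Ms ! j) (comp_mor (\<pi> k) (\<iota> j)) (if j = k then id_mor else zero_mor)) \<and>
     mor_eq P S (\<lambda>x v. \<Sum>j<length Ms. \<iota> j x (\<pi> j x v)) id_mor)"

definition direct_summand :: "'p::order set \<Rightarrow> ('p, 'b) prep set \<Rightarrow>
    ('p, 'b) prep \<Rightarrow> ('p, 'b) prep \<Rightarrow> bool" where
  "direct_summand P C M S \<longleftrightarrow> M \<in> C \<and> S \<in> C \<and> (\<exists>N\<in>C. direct_sum P [M, N] S)"

text \<open>The empty direct sum is allowed, so \<open>add\<close> always contains the zero objects.\<close>

inductive_set add :: "'p::order set \<Rightarrow> ('p, 'b) prep set \<Rightarrow> ('p, 'b) prep set \<Rightarrow> ('p, 'b) prep set"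
  for P :: "'p::order set" and C :: "('p, 'b) prep set" and X :: "('p, 'b) prep set" where
  base: "M \<in> X \<Longrightarrow> M \<in> C \<Longrightarrow> M \<in> add P C X"
| iso: "M \<in> add P C X \<Longrightarrow> N \<in> C \<Longrightarrow> isomorphic P M N \<Longrightarrow> N \<in> add P C X"
| sum: "(\<forall>M\<in>set Ms. M \<in> add P C X) \<Longrightarrow> S \<in> C \<Longrightarrow> direct_sum P Ms S \<Longrightarrow> S \<in> add P C X"
| summand: "S \<in> add P C X \<Longrightarrow> direct_summand P C M S \<Longrightarrow> M \<in> add P C X"

text \<open>
  A set of isomorphism classes is represented by an isomorphism-closed class of objects; in
  particular \<open>ind\<close> consists of all indecomposable objects, not of chosen representatives.
\<close>

definition ind :: "'p::order set \<Rightarrow> ('p, 'b) prep set \<Rightarrow> ('p, 'b) prep set" where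
  "ind P C = {M\<in>C. \<not> is_zero P M \<and>
     (\<forall>A\<in>C. \<forall>B\<in>C. direct_sum P [A, B] M \<longrightarrow> is_zero P A \<or> is_zero P B)}"

definition iso_closed :: "'p::order set \<Rightarrow> ('p, 'b) prep set \<Rightarrow> ('p, 'b) prep set \<Rightarrow> bool" where
  "iso_closed P C X \<longleftrightarrow> (\<forall>M\<in>X. \<forall>N\<in>C. isomorphic P M N \<longrightarrow> N \<in> X)"


subsection \<open>Relative homological algebra\<close>

definition rel_exact :: "'p::order set \<Rightarrow> ('p, 'b) prep set \<Rightarrow> ('p, 'b) prep set \<Rightarrow>
    (('p, 'b) prep \<times> ('p, 'b) mor \<times> ('p, 'b) prep \<times> ('p, 'b) mor \<times> ('p, 'b) prep) set" where
  "rel_exact P C X = {(L, f, M, g, N). short_exact P C L f M g N \<and> (\<forall>U\<in>X. Hom_surj P U M g N)}"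

definition admissible :: "'p::order set \<Rightarrow> ('p, 'b) prep set \<Rightarrow> ('p, 'b) prep set \<Rightarrow>
    ('p, 'b) prep \<Rightarrow> ('p, 'b) mor \<Rightarrow> ('p, 'b) prep \<Rightarrow> bool" where
  "admissible P C X M g N \<longleftrightarrow> epi P C M g N \<and>
     (\<exists>L f. is_kernel P C L f M g N \<and> (L, f, M, g, N) \<in> rel_exact P C X)"

definition rel_proj :: "'p::order set \<Rightarrow> ('p, 'b) prep set \<Rightarrow> ('p, 'b) prep set \<Rightarrow>
    ('p, 'b) prep set" where
  "rel_proj P C X = {U\<in>C. \<forall>M g N. admissible P C X M g N \<longrightarrow> Hom_surj P U M g N}"

definition precover :: "'p::order set \<Rightarrow> ('p, 'b) prep set \<Rightarrow> ('p, 'b) prep set \<Rightarrow>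
    ('p, 'b) prep \<Rightarrow> ('p, 'b) mor \<Rightarrow> ('p, 'b) prep \<Rightarrow> bool" where
  "precover P C X U g M \<longleftrightarrow> U \<in> add P C X \<and> admissible P C X U g M"

definition enough_rel_proj :: "'p::order set \<Rightarrow> ('p, 'b) prep set \<Rightarrow> ('p, 'b) prep set \<Rightarrow> bool"
  where
  "enough_rel_proj P C X \<longleftrightarrow>
     (\<forall>M\<in>C. \<exists>U g. precover P C X U g M) \<and> add P C X = rel_proj P C X"


subsection \<open>Minimal projective presentations\<close>

text \<open>The line spanned by a fixed nonzero vector plays the role of the one-dimensional space.\<close>

definition principal :: "'p::order \<Rightarrow> ('p, 'b) prep" where
  "principal x =
    \<lparr> sp = (\<lambda>z. if x \<le> z then span {SOME e. e \<noteq> 0} else {0}), mp = (\<lambda>y z v. v) \<rparr>"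

definition proj_cover :: "'p::order set \<Rightarrow> ('p, 'b) prep set \<Rightarrow>
    ('p, 'b) prep \<Rightarrow> ('p, 'b) mor \<Rightarrow> ('p, 'b) prep \<Rightarrow> bool" where
  "proj_cover P C U g M \<longleftrightarrow> U \<in> proj P C \<and> epi P C U g M \<and>
     (\<forall>Z\<in>C. \<forall>h\<in>Hom P Z U. epi P C Z (comp_mor g h) M \<longrightarrow> epi P C Z h U)"

definition min_proj_pres :: "'p::order set \<Rightarrow> ('p, 'b) prep set \<Rightarrow> ('p, 'b) prep \<Rightarrow>
    ('p, 'b) mor \<Rightarrow> ('p, 'b) prep \<Rightarrow> ('p, 'b) mor \<Rightarrow> ('p, 'b) prep \<Rightarrow> bool" where
  "min_proj_pres P C P1 d P0 g M \<longleftrightarrow> d \<in> Hom P P1 P0 \<and> proj_cover P C P0 g M \<and>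
     (\<exists>K k d'. is_kernel P C K k P0 g M \<and> proj_cover P C P1 d' K \<and>
        mor_eq P P1 d (comp_mor k d'))"

definition pres_points :: "'p::order set \<Rightarrow> ('p, 'b) prep \<Rightarrow> 'p set" where
  "pres_points P M = {x\<in>P. \<exists>P1 d P0 g S. min_proj_pres P (fp_rep P) P1 d P0 g M \<and>
     direct_sum P [P1, P0] S \<and> direct_summand P (fp_rep P) (principal x) S}"

definition pres_grid :: "nat \<Rightarrow> (nat \<Rightarrow> 't::linorder set) \<Rightarrow> (nat \<Rightarrow> 't, 'b) prep \<Rightarrow>
    (nat \<Rightarrow> 't) set" where
  "pres_grid n T M = (LEAST Q. Q \<in> subgrids n T \<and> pres_points (grid_poset n T) M \<subseteq> Q)"


subsection \<open>Contraction\<close>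

definition supp_rep :: "'p::order set \<Rightarrow> 'p set \<Rightarrow> ('p, 'b) prep set" where
  "supp_rep P Q = {M\<in>fp_rep P. \<forall>x\<in>P - upper P Q. sp M x = {0}}"

definition cocone :: "'p::order set \<Rightarrow> ('p, 'b) prep \<Rightarrow> 'b set \<Rightarrow> ('p, 'b) mor \<Rightarrow> bool" where
  "cocone D M W \<iota> \<longleftrightarrow> subspace W \<and> (\<forall>x\<in>D. lin_on (sp M x) W (\<iota> x)) \<and>
     (\<forall>x\<in>D. \<forall>x'\<in>D. x \<le> x' \<longrightarrow> (\<forall>v\<in>sp M x. \<iota> x' (mp M x x' v) = \<iota> x v))"

definition is_colimit :: "'p::order set \<Rightarrow> ('p, 'b) prep \<Rightarrow> 'b set \<Rightarrow> ('p, 'b) mor \<Rightarrow> bool" where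
  "is_colimit D M W \<iota> \<longleftrightarrow> cocone D M W \<iota> \<and>
     (\<forall>W' \<kappa>. cocone D M W' \<kappa> \<longrightarrow>
        (\<exists>h. lin_on W W' h \<and> (\<forall>x\<in>D. \<forall>v\<in>sp M x. h (\<iota> x v) = \<kappa> x v) \<and>
          (\<forall>h'. lin_on W W' h' \<and> (\<forall>x\<in>D. \<forall>v\<in>sp M x. h' (\<iota> x v) = \<kappa> x v) \<longrightarrow>
             (\<forall>w\<in>W. h' w = h w))))"

text \<open>
  Colimits being unique only up to isomorphism, the contraction is a relation: \<open>N\<close> is a value of
  the contraction functor at \<open>M\<close>. The map \<open>\<iota> x\<close> is the coprojection from \<open>M(x)\<close> to the
  colimit over the fibre containing \<open>x\<close>.
\<close>

definition is_contraction :: "'p::order set \<Rightarrow> 'p set \<Rightarrow> ('p, 'b) prep \<Rightarrow> ('p, 'b) prep \<Rightarrow> bool"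
  where
  "is_contraction P Q M N \<longleftrightarrow> N \<in> Rep Q \<and> (\<exists>\<iota>.
     (\<forall>y\<in>Q. is_colimit (ceil_in P Q y) M (sp N y) \<iota>) \<and>
     (\<forall>y\<in>Q. \<forall>y'\<in>Q. y \<le> y' \<longrightarrow> (\<forall>x\<in>ceil_in P Q y. \<forall>v\<in>sp M x.
        mp N y y' (\<iota> x v) = \<iota> (join_in P y' x) (mp M x (join_in P y' x) v))))"


subsection \<open>Extended projective classes\<close>

definition ext_proj_class :: "nat \<Rightarrow> (nat \<Rightarrow> 't::linorder set) \<Rightarrow> (nat \<Rightarrow> 't) set set \<Rightarrow>
    (nat \<Rightarrow> 't, 'b) prep set \<Rightarrow> ((nat \<Rightarrow> 't) set \<Rightarrow> (nat \<Rightarrow> 't, 'b) prep set) \<Rightarrow> bool" where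
  "ext_proj_class n T H X XQ \<longleftrightarrow> (let P = grid_poset n T in
     X \<subseteq> ind P (fp_rep P) \<and> iso_closed P (fp_rep P) X \<and>
     (\<forall>Q\<in>H. XQ Q \<subseteq> ind Q (fp_rep Q) \<and> iso_closed Q (fp_rep Q) (XQ Q)) \<and>
     ind P (fp_rep P) \<inter> proj P (fp_rep P) \<subseteq> X \<and>
     (\<forall>Q\<in>H. ind Q (fp_rep Q) \<inter> proj Q (fp_rep Q) \<subseteq> XQ Q) \<and>
     add P (fp_rep P) X = add P (fp_rep P) (\<Union>Q\<in>H. {extension P Q Y | Y. Y \<in> XQ Q}) \<and>
     (\<forall>Q\<in>H. add Q (fp_rep Q) (XQ Q) =
        add Q (fp_rep Q) {N. \<exists>M \<in> X \<inter> supp_rep P Q. is_contraction P Q M N}) \<and>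
     (\<forall>Q\<in>H. \<forall>N\<in>fp_rep Q. \<forall>M \<in> X - supp_rep P Q. \<forall>f\<in>Hom P M (extension P Q N).
        mor_eq P M f zero_mor) \<and>
     (\<forall>M\<in>fp_rep P. \<exists>Q\<in>H. pres_grid n T M \<subseteq> Q))"

end

end

theory Submission
  imports Defs
begin

text \<open>
  Both sides of the equivalence only say that precovers exist: a relative projective is a direct
  summand of any of its precovers. Up to isomorphism, a finitely presentable representation is the
  same as the extension of a pointwise finite-dimensional one from a finite subgrid, namely from any
  subgrid that contains the points of a minimal projective presentation. Extension is right adjoint
  to contraction. Hence the extension of a precover over \<open>Q\<close> of the restriction of \<open>M\<close> is a
  precover of \<open>M\<close>: maps from objects supported in \<open>upper P Q\<close> factor through the contraction, and
  all other maps vanish. Conversely, contracting those summands of a precover of the extension of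
  \<open>N\<close> that are supported in \<open>upper P Q\<close> gives a precover of \<open>N\<close>.
\<close>

text \<open>The language common to \<open>P\<close> and its subgrids is \<open>tame P Q M\<close>.
  It is stable under kernels, cokernels, retracts and enlargement of \<open>Q\<close>, so finitely
  many finitely presentable objects can be placed over one finite \<open>Q\<close>, where kernels
  and surjectivity are pointwise linear algebra. A finite poset falls under the same lemmas, with
  itself as \<open>Q\<close>. The obstacle is that \<open>X\<close> and the classes
  \<open>XQ Q\<close> determine each other only up to \<open>add\<close>: the extension of a member
  of \<open>XQ Q\<close> is merely a retract of a sum of members of \<open>X\<close>, and likewise
  for contractions. Approximations are therefore stored as finite families of morphisms through
  which all test morphisms factor after summation, a notion that passes freely through retracts.
  Precovers are surjective because \<open>X\<close> contains all principal representations, and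
  these detect the values at points. No abstract colimit is needed for the contraction: over a fibre
  it is attained at the greatest point of a finer finite subgrid on which the representation is
  tame.\<close>

context vec_universe
begin

subsection \<open>Linear algebra inside the universe\<close>

text \<open>Containment in a finite span is used rather than a finite basis, so that the property
  passes to arbitrary subsets and \<open>V\<close> need not be known to be a subspace.\<close>

definition fd :: "'b set \<Rightarrow> bool" where
  "fd V \<longleftrightarrow> (\<exists>B. finite B \<and> V \<subseteq> span B)"

lemma fd_subset: "fd V \<Longrightarrow> W \<subseteq> V \<Longrightarrow> fd W"
  unfolding fd_def by blast

lemma fd_span: "finite B \<Longrightarrow> fd (span B)"
  unfolding fd_def by blast

lemma fd_zero: "fd {0}"
  unfolding fd_def by (rule exI[of _ "{}"]) auto

lemma independent_spanning_subset:
  obtains B where "B \<subseteq> V" "independent B" "V \<subseteq> span B"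
  using maximal_independent_subset_extend[of "{}" V] independent_empty by (metis empty_subsetI)

lemma lin_on_mem: "lin_on V W f \<Longrightarrow> v \<in> V \<Longrightarrow> f v \<in> W"
  unfolding lin_on_def by blast

lemma lin_on_add: "lin_on V W f \<Longrightarrow> u \<in> V \<Longrightarrow> v \<in> V \<Longrightarrow> f (u + v) = f u + f v"
  unfolding lin_on_def by blast

lemma lin_on_scale: "lin_on V W f \<Longrightarrow> v \<in> V \<Longrightarrow> f (c *s v) = c *s f v"
  unfolding lin_on_def by blast

lemma lin_on_zero: "lin_on V W f \<Longrightarrow> subspace V \<Longrightarrow> f 0 = 0"
  using lin_on_scale[of V W f 0 0] subspace_0[of V] by simp

lemma lin_on_diff:
  assumes "lin_on V W f" "subspace V" "u \<in> V" "v \<in> V"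
  shows "f (u - v) = f u - f v"
  using lin_on_add[OF assms(1), of "u - v" v] subspace_diff[of V u v] assms by simp

lemma lin_on_sum:
  assumes "lin_on V W f" "subspace V" "\<And>j. j \<in> J \<Longrightarrow> g j \<in> V"
  shows "f (\<Sum>j\<in>J. g j) = (\<Sum>j\<in>J. f (g j))"
  using assms(3)
proof (induction J rule: infinite_finite_induct)
  case (insert j J)
  then have "(\<Sum>j\<in>J. g j) \<in> V"
    by (intro subspace_sum[OF assms(2)]) auto
  then show ?case
    using insert lin_on_add[OF assms(1)] by simp
qed (simp_all add: lin_on_zero[OF assms(1,2)])

lemma lin_on_comp: "lin_on U V f \<Longrightarrow> lin_on V W g \<Longrightarrow> lin_on U W (\<lambda>v. g (f v))"
  unfolding lin_on_def by (auto simp: image_subset_iff)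

lemma lin_on_id: "V \<subseteq> W \<Longrightarrow> lin_on V W (\<lambda>v. v)"
  unfolding lin_on_def by auto

lemma lin_on_const_zero: "subspace W \<Longrightarrow> lin_on V W (\<lambda>v. 0)"
  unfolding lin_on_def using subspace_0 by auto

lemma lin_on_cong:
  assumes "lin_on V W f" "subspace V" "\<And>v. v \<in> V \<Longrightarrow> f v = g v"
  shows "lin_on V W g"
  unfolding lin_on_def
  using assms(3) lin_on_mem[OF assms(1)] lin_on_add[OF assms(1)] lin_on_scale[OF assms(1)]
    subspace_add[OF assms(2)] subspace_scale[OF assms(2)]
  by (auto simp: image_subset_iff)

lemma lin_on_plus:
  assumes "lin_on V W f" "lin_on V W g" "subspace W"
  shows "lin_on V W (\<lambda>v. f v + g v)"
  using assms unfolding lin_on_def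
  by (auto simp: image_subset_iff subspace_add scale_right_distrib)

lemma lin_on_scaled:
  assumes "lin_on V W f" "subspace W"
  shows "lin_on V W (\<lambda>v. c *s f v)"
  using assms unfolding lin_on_def
  by (auto simp: image_subset_iff subspace_scale scale_right_distrib mult.commute)

lemma lin_on_vimage_subspace:
  assumes "lin_on V W f" "subspace V" "subspace S"
  shows "subspace {v \<in> V. f v \<in> S}"
  unfolding subspace_def
  using lin_on_zero[OF assms(1,2)] lin_on_add[OF assms(1)] lin_on_scale[OF assms(1)]
    subspace_0 subspace_add subspace_scale assms(2,3)
  by auto

lemma lin_on_image_span:
  assumes "lin_on V W f" "subspace V" "S \<subseteq> V" "v \<in> span S"
  shows "f v \<in> span (f ` S)"
proof -
  have "S \<subseteq> {v \<in> V. f v \<in> span (f ` S)}"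
    using assms(3) by (auto intro: span_base)
  then have "span S \<subseteq> {v \<in> V. f v \<in> span (f ` S)}"
    using lin_on_vimage_subspace[OF assms(1,2) subspace_span] by (rule span_minimal)
  then show ?thesis using assms(4) by blast
qed

lemma lin_on_image_subspace:
  assumes "lin_on V W f" "subspace V"
  shows "subspace (f ` V)"
proof (rule subspaceI)
  show "0 \<in> f ` V"
    using lin_on_zero[OF assms] subspace_0[OF assms(2)] by (metis imageI)
next
  fix x y assume "x \<in> f ` V" "y \<in> f ` V"
  then show "x + y \<in> f ` V"
    using lin_on_add[OF assms(1)] subspace_add[OF assms(2)] by (metis (no_types, lifting) image_iff)
next
  fix c x assume "x \<in> f ` V"
  then show "c *s x \<in> f ` V"
    using lin_on_scale[OF assms(1)] subspace_scale[OF assms(2)]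
    by (metis (no_types, lifting) image_iff)
qed

lemma lin_on_image_fd:
  assumes "lin_on V W f" "subspace V" "fd V"
  shows "fd (f ` V)"
proof -
  obtain B where B: "B \<subseteq> V" "independent B" "V \<subseteq> span B"
    using independent_spanning_subset[of V] by blast
  obtain C where "finite C" "V \<subseteq> span C"
    using assms(3) unfolding fd_def by blast
  then have "finite B"
    using B independent_span_bound[of C B] by blast
  moreover have "f ` V \<subseteq> span (f ` B)"
    using lin_on_image_span[OF assms(1,2) B(1)] B(3) by blast
  ultimately show ?thesis
    unfolding fd_def by blast
qed

lemma fd_sum:
  assumes "fd V" "fd W" "\<And>u. u \<in> U \<Longrightarrow> \<exists>v\<in>V. \<exists>w\<in>W. u = v + w"
  shows "fd U"
proof -
  obtain B C where "finite B" "V \<subseteq> span B" "finite C" "W \<subseteq> span C"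
    using assms(1,2) unfolding fd_def by blast
  moreover have "u \<in> span (B \<union> C)" if u: "u \<in> U" for u
  proof -
    obtain v w where "v \<in> V" "w \<in> W" "u = v + w" using assms(3)[OF u] by blast
    moreover have "v \<in> span (B \<union> C)" "w \<in> span (B \<union> C)"
      using calculation \<open>V \<subseteq> span B\<close> \<open>W \<subseteq> span C\<close> span_mono[of B "B \<union> C"] span_mono[of C "B \<union> C"]
      by auto
    ultimately show ?thesis by (simp add: span_add)
  qed
  ultimately show ?thesis
    unfolding fd_def by (intro exI[of _ "B \<union> C"]) auto
qed

lemma fd_basis:
  assumes "subspace V" "fd V"
  obtains B where "finite B" "independent B" "B \<subseteq> V" "span B = V"
proof -
  obtain B where B: "B \<subseteq> V" "independent B" "V \<subseteq> span B"
    using independent_spanning_subset[of V] by blast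
  moreover obtain C where "finite C" "V \<subseteq> span C"
    using assms(2) unfolding fd_def by blast
  ultimately have "finite B"
    using independent_span_bound[of C B] by blast
  moreover have "span B = V"
    using B span_minimal[OF B(1) assms(1)] by blast
  ultimately show ?thesis using that B by blast
qed

text \<open>The map obtained is linear on the whole universe, so \<open>lin_on V W f\<close> only
  requires that \<open>f\<close> map \<open>V\<close> into \<open>W\<close>; the first conclusion is
  phrased to exploit this.\<close>

lemma linear_extension:
  assumes "independent B"
  obtains f where "\<And>V W. f ` V \<subseteq> W \<Longrightarrow> lin_on V W f" "\<And>b. b \<in> B \<Longrightarrow> f b = g b"
proof -
  interpret vs: vector_space_pair scale scale
    by unfold_locales
  interpret f: Vector_Spaces.linear scale scale "vs.construct B g"
    by (rule vs.linear_construct[OF assms])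
  show ?thesis
    using that[of "vs.construct B g"] vs.construct_basis[OF assms]
    unfolding lin_on_def by (auto simp: f.add f.scale)
qed

text \<open>Quotients have to live inside the one ambient space. The image of a linear idempotent
  with kernel \<open>U\<close> is a model of the quotient of \<open>V\<close> by
  \<open>U\<close>.\<close>

lemma complement_projection:
  assumes "subspace V" "subspace U" "U \<subseteq> V"
  obtains p where "lin_on V V p" "\<And>v. v \<in> V \<Longrightarrow> v - p v \<in> U" "\<And>u. u \<in> U \<Longrightarrow> p u = 0"
    "\<And>v. v \<in> V \<Longrightarrow> p (p v) = p v"
proof -
  obtain A where A: "A \<subseteq> U" "independent A" "U \<subseteq> span A"
    using independent_spanning_subset[of U] by blast
  obtain B where B: "A \<subseteq> B" "B \<subseteq> V" "independent B" "V \<subseteq> span B"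
    using maximal_independent_subset_extend[of A V] A assms(3) by blast
  \<comment> \<open>The basis \<open>B\<close> of \<open>V\<close> extends the basis
    \<open>A\<close> of \<open>U\<close>; \<open>p\<close> kills \<open>A\<close> and fixes the
    remaining basis vectors, hence projects along \<open>U\<close>.\<close>
  obtain p where p: "\<And>V W. p ` V \<subseteq> W \<Longrightarrow> lin_on V W p"
      "\<And>b. b \<in> B \<Longrightarrow> p b = (if b \<in> A then 0 else b)"
    using linear_extension[OF B(3), of "\<lambda>b. if b \<in> A then 0 else b"] by blast
  have lin: "lin_on UNIV UNIV p"
    by (rule p(1)) simp
  have 1: "v - p v \<in> U" if "v \<in> V" for v
  proof -
    have "lin_on UNIV UNIV (\<lambda>v. v - p v)"
      using lin unfolding lin_on_def by (auto simp: scale_right_diff_distrib)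
    then have "subspace {v \<in> UNIV. v - p v \<in> U}"
      using lin_on_vimage_subspace[OF _ subspace_UNIV assms(2)] by blast
    moreover have "B \<subseteq> {v \<in> UNIV. v - p v \<in> U}"
      using p(2) A(1) subspace_0[OF assms(2)] by auto
    ultimately have "span B \<subseteq> {v \<in> UNIV. v - p v \<in> U}"
      by (rule span_minimal[rotated])
    then show ?thesis using that B(4) by auto
  qed
  have 2: "p u = 0" if "u \<in> U" for u
  proof -
    have "subspace {v \<in> UNIV. p v \<in> {0}}"
      using lin_on_vimage_subspace[OF lin subspace_UNIV] subspace_single_0 by blast
    moreover have "A \<subseteq> {v \<in> UNIV. p v \<in> {0}}"
      using p(2) B(1) by auto
    ultimately have "span A \<subseteq> {v \<in> UNIV. p v \<in> {0}}"
      by (rule span_minimal[rotated])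
    then show ?thesis using that A(3) by auto
  qed
  have 3: "p v \<in> V" if "v \<in> V" for v
  proof -
    have "v - p v \<in> V"
      using 1[OF that] assms(3) by blast
    then have "v - (v - p v) \<in> V"
      by (rule subspace_diff[OF assms(1) that])
    then show ?thesis by simp
  qed
  have 4: "p (p v) = p v" if "v \<in> V" for v
    using 2[OF 1[OF that]] lin_on_diff[OF lin subspace_UNIV, of v "p v"] by auto
  show ?thesis
    using that[of p] 1 2 3 4 p(1)[of V V] by auto
qed

text \<open>A finite sum of finite-dimensional spaces has finite dimension, so an
  infinite-dimensional universe has enough independent vectors to contain a copy of it.\<close>

lemma direct_sum_spaces:
  fixes k :: nat
  assumes "\<And>j. j < k \<Longrightarrow> subspace (V j) \<and> fd (V j)"
  shows "\<exists>S \<iota> \<pi>. subspace S \<and> (\<forall>j<k. lin_on (V j) S (\<iota> j) \<and> lin_on S (V j) (\<pi> j)) \<and>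
    (\<forall>j<k. \<forall>i<k. \<forall>v\<in>V j. \<pi> i (\<iota> j v) = (if i = j then v else 0)) \<and>
    (\<forall>s\<in>S. (\<Sum>j<k. \<iota> j (\<pi> j s)) = s)"
proof -
  have "\<forall>j\<in>{..<k}. \<exists>B. finite B \<and> independent B \<and> B \<subseteq> V j \<and> span B = V j"
    using assms fd_basis by (metis lessThan_iff)
  then obtain B where B: "\<And>j. j < k \<Longrightarrow> finite (B j) \<and> independent (B j) \<and> B j \<subseteq> V j \<and> span (B j) = V j"
    by (metis lessThan_iff)
  define I where "I = Sigma {..<k} B"
  obtain E where E: "independent E" "UNIV \<subseteq> span E"
    using independent_spanning_subset[of UNIV] by blast
  have "infinite E"
    using infinite_dimensional E(2) by (metis top.extremum_uniqueI)
  \<comment> \<open>\<open>F\<close> has as many independent vectors as the disjoint union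
    \<open>I\<close> of the bases; a bijection between the two makes \<open>span F\<close> the
    direct sum.\<close>
  then obtain F where F: "F \<subseteq> E" "finite F" "card F = card I"
    using infinite_arbitrarily_large by blast
  have "finite I"
    unfolding I_def using B by (intro finite_SigmaI) auto
  then obtain e where e: "bij_betw e I F"
    using F finite_same_card_bij by metis
  have indF: "independent F"
    using independent_mono E(1) F(1) by blast
  have "\<exists>f. (\<forall>V W. f ` V \<subseteq> W \<longrightarrow> lin_on V W f) \<and> (\<forall>b\<in>B j. f b = e (j, b))" if "j < k" for j
    using linear_extension[of "B j" "\<lambda>b. e (j, b)"] B that by metis
  then obtain \<iota> where \<iota>: "\<And>j V W. j < k \<Longrightarrow> \<iota> j ` V \<subseteq> W \<Longrightarrow> lin_on V W (\<iota> j)"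
      "\<And>j b. j < k \<Longrightarrow> b \<in> B j \<Longrightarrow> \<iota> j b = e (j, b)"
    by metis
  have "\<exists>f. (\<forall>V W. f ` V \<subseteq> W \<longrightarrow> lin_on V W f) \<and>
      (\<forall>u\<in>F. f u = (if fst (inv_into I e u) = i then snd (inv_into I e u) else 0))" for i
    using linear_extension[OF indF,
        of "\<lambda>u. (if fst (inv_into I e u) = i then snd (inv_into I e u) else 0)"] by metis
  then obtain \<pi> where \<pi>: "\<And>i V W. \<pi> i ` V \<subseteq> W \<Longrightarrow> lin_on V W (\<pi> i)"
      "\<And>i u. u \<in> F \<Longrightarrow> \<pi> i u = (if fst (inv_into I e u) = i then snd (inv_into I e u) else 0)"
    by metis
  have \<pi>e: "\<pi> i (e (j, b)) = (if j = i then b else 0)" if "j < k" "b \<in> B j" for i j b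
  proof -
    have "(j, b) \<in> I" using that unfolding I_def by auto
    then have "e (j, b) \<in> F" "inv_into I e (e (j, b)) = (j, b)"
      using e by (auto simp: bij_betw_def)
    then show ?thesis using \<pi>(2) by auto
  qed
  have eF: "e (j, b) \<in> F" if "j < k" "b \<in> B j" for j b
    using e that unfolding I_def bij_betw_def by auto
  have \<iota>S: "lin_on (V j) (span F) (\<iota> j)" if j: "j < k" for j
  proof -
    have "lin_on (V j) UNIV (\<iota> j)"
      using \<iota>(1)[OF j] by blast
    moreover have "\<iota> j v \<in> span F" if "v \<in> V j" for v
      using lin_on_image_span[OF calculation _ _, of "B j" v] B[OF j] assms[OF j] that
        span_mono[of "\<iota> j ` B j" F] \<iota>(2)[OF j] eF[OF j] by (auto simp: image_subset_iff)
    ultimately show ?thesis using \<iota>(1)[OF j] by (auto simp: image_subset_iff)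
  qed
  have \<pi>S: "lin_on (span F) (V i) (\<pi> i)" if i: "i < k" for i
  proof -
    have "\<pi> i u \<in> V i" if u: "u \<in> F" for u
    proof -
      obtain j b where jb: "u = e (j, b)" "j < k" "b \<in> B j"
        using e u unfolding I_def bij_betw_def by auto
      then show ?thesis
        using \<pi>e[OF jb(2,3)] B[OF jb(2)] assms i subspace_0 by (auto simp: subset_iff)
    qed
    then have "\<pi> i ` F \<subseteq> V i" by blast
    then have "span (\<pi> i ` F) \<subseteq> V i"
      using assms[OF i] span_minimal by blast
    moreover have "lin_on UNIV UNIV (\<pi> i)" using \<pi>(1) by blast
    ultimately have "\<pi> i ` span F \<subseteq> V i"
      using lin_on_image_span[OF _ subspace_UNIV, of UNIV "\<pi> i" F] by blast
    then show ?thesis using \<pi>(1) by blast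
  qed
  have "\<pi> i (\<iota> j v) = (if i = j then v else 0)" if "j < k" "i < k" "v \<in> V j" for i j v
  proof -
    have lin: "lin_on (V j) (V i) (\<lambda>v. \<pi> i (\<iota> j v))"
      using lin_on_comp[OF \<iota>S \<pi>S] that by blast
    show ?thesis
    proof (cases "i = j")
      case True
      \<comment> \<open>The set on which two linear maps agree is a subspace, so it is enough that
        they agree on the basis \<open>B j\<close>. The other identities below are reduced to bases
        in the same way.\<close>
      have "lin_on (V j) (V j) (\<lambda>v. \<pi> i (\<iota> j v) - v)"
        using lin assms[OF \<open>j < k\<close>] True unfolding lin_on_def
        by (auto simp: image_subset_iff subspace_diff scale_right_diff_distrib)
      then have "subspace {v \<in> V j. \<pi> i (\<iota> j v) - v \<in> {0}}"
        using lin_on_vimage_subspace[OF _ _ subspace_single_0] assms that by blast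
      moreover have "B j \<subseteq> {v \<in> V j. \<pi> i (\<iota> j v) - v \<in> {0}}"
        using B[OF \<open>j < k\<close>] \<iota>(2) \<pi>e that True by auto
      ultimately have "span (B j) \<subseteq> {v \<in> V j. \<pi> i (\<iota> j v) - v \<in> {0}}"
        by (rule span_minimal[rotated])
      then show ?thesis using B[OF \<open>j < k\<close>] that True by auto
    next
      case False
      have "subspace {v \<in> V j. \<pi> i (\<iota> j v) \<in> {0}}"
        using lin_on_vimage_subspace[OF lin _ subspace_single_0] assms that by blast
      moreover have "B j \<subseteq> {v \<in> V j. \<pi> i (\<iota> j v) \<in> {0}}"
        using B[OF \<open>j < k\<close>] \<iota>(2) \<pi>e that False by auto
      ultimately have "span (B j) \<subseteq> {v \<in> V j. \<pi> i (\<iota> j v) \<in> {0}}"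
        by (rule span_minimal[rotated])
      then show ?thesis using B[OF \<open>j < k\<close>] that False by auto
    qed
  qed
  moreover have "(\<Sum>j<k. \<iota> j (\<pi> j s)) = s" if s: "s \<in> span F" for s
  proof -
    have lin: "lin_on (span F) (span F) (\<lambda>s. \<iota> j (\<pi> j s))" if "j < k" for j
      using lin_on_comp[OF \<pi>S \<iota>S] that by blast
    have "lin_on (span F) (span F) (\<lambda>s. (\<Sum>j<k. \<iota> j (\<pi> j s)) - s)"
      unfolding lin_on_def
      using lin_on_mem[OF lin] lin_on_add[OF lin] lin_on_scale[OF lin]
      by (auto simp: image_subset_iff scale_right_diff_distrib sum.distrib scale_sum_right
          intro!: span_diff span_sum)
    then have "subspace {s \<in> span F. (\<Sum>j<k. \<iota> j (\<pi> j s)) - s \<in> {0}}"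
      by (rule lin_on_vimage_subspace[OF _ subspace_span subspace_single_0])
    moreover have "F \<subseteq> {s \<in> span F. (\<Sum>j<k. \<iota> j (\<pi> j s)) - s \<in> {0}}"
    proof
      fix u assume u: "u \<in> F"
      then obtain j b where jb: "u = e (j, b)" "j < k" "b \<in> B j"
        using e unfolding I_def bij_betw_def by auto
      have "(\<Sum>i<k. \<iota> i (\<pi> i u)) = (\<Sum>i<k. if i = j then e (j, b) else 0)"
      proof (rule sum.cong[OF refl])
        fix i assume "i \<in> {..<k}"
        then have "\<iota> i 0 = 0"
          using lin_on_zero[OF \<iota>S] assms by auto
        then show "\<iota> i (\<pi> i u) = (if i = j then e (j, b) else 0)"
          using \<pi>e[OF jb(2,3)] \<iota>(2)[OF jb(2,3)] jb(1) by auto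
      qed
      also have "\<dots> = u" using jb by simp
      finally show "u \<in> {s \<in> span F. (\<Sum>j<k. \<iota> j (\<pi> j s)) - s \<in> {0}}"
        using u by (simp add: span_base)
    qed
    ultimately have "span F \<subseteq> {s \<in> span F. (\<Sum>j<k. \<iota> j (\<pi> j s)) - s \<in> {0}}"
      by (rule span_minimal[rotated])
    then show ?thesis using s by auto
  qed
  ultimately show ?thesis
    using \<iota>S \<pi>S by (intro exI[of _ "span F"] exI[of _ \<iota>] exI[of _ \<pi>]) auto
qed


subsection \<open>Morphisms\<close>

lemma Rep_subspace: "M \<in> Rep P \<Longrightarrow> x \<in> P \<Longrightarrow> subspace (sp M x)"
  by (simp add: Rep_def)

lemma Rep_lin: "M \<in> Rep P \<Longrightarrow> x \<in> P \<Longrightarrow> y \<in> P \<Longrightarrow> x \<le> y \<Longrightarrow> lin_on (sp M x) (sp M y) (mp M x y)"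
  by (simp add: Rep_def)

lemma Rep_mem:
  "M \<in> Rep P \<Longrightarrow> x \<in> P \<Longrightarrow> y \<in> P \<Longrightarrow> x \<le> y \<Longrightarrow> v \<in> sp M x \<Longrightarrow> mp M x y v \<in> sp M y"
  by (rule lin_on_mem[OF Rep_lin])

lemma Rep_refl: "M \<in> Rep P \<Longrightarrow> x \<in> P \<Longrightarrow> v \<in> sp M x \<Longrightarrow> mp M x x v = v"
  by (simp add: Rep_def)

lemma Rep_trans:
  "M \<in> Rep P \<Longrightarrow> x \<in> P \<Longrightarrow> y \<in> P \<Longrightarrow> z \<in> P \<Longrightarrow> x \<le> y \<Longrightarrow> y \<le> z \<Longrightarrow> v \<in> sp M x \<Longrightarrow>
    mp M y z (mp M x y v) = mp M x z v"
  by (simp add: Rep_def)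

lemma Rep_mono:
  assumes "M \<in> Rep P" "Q \<subseteq> P"
  shows "M \<in> Rep Q"
proof -
  have *: "x \<in> Q \<Longrightarrow> x \<in> P" for x using assms(2) by blast
  show ?thesis
    unfolding Rep_def
    using Rep_subspace[OF assms(1)] Rep_lin[OF assms(1)] Rep_refl[OF assms(1)] Rep_trans[OF assms(1)]
    by (intro CollectI conjI ballI impI) (simp_all add: *)
qed

lemma Hom_lin: "f \<in> Hom P M N \<Longrightarrow> x \<in> P \<Longrightarrow> lin_on (sp M x) (sp N x) (f x)"
  by (simp add: Hom_def)

lemma Hom_mem: "f \<in> Hom P M N \<Longrightarrow> x \<in> P \<Longrightarrow> v \<in> sp M x \<Longrightarrow> f x v \<in> sp N x"
  by (rule lin_on_mem[OF Hom_lin])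

lemma Hom_nat:
  "f \<in> Hom P M N \<Longrightarrow> x \<in> P \<Longrightarrow> y \<in> P \<Longrightarrow> x \<le> y \<Longrightarrow> v \<in> sp M x \<Longrightarrow>
    f y (mp M x y v) = mp N x y (f x v)"
  by (simp add: Hom_def)

lemma Hom_vanish: "f \<in> Hom P M N \<Longrightarrow> M \<in> Rep P \<Longrightarrow> x \<in> P \<Longrightarrow> f x 0 = 0"
  by (rule lin_on_zero[OF Hom_lin Rep_subspace])

lemma HomI:
  assumes "\<And>x. x \<in> P \<Longrightarrow> lin_on (sp M x) (sp N x) (f x)"
    and "\<And>x y v. x \<in> P \<Longrightarrow> y \<in> P \<Longrightarrow> x \<le> y \<Longrightarrow> v \<in> sp M x \<Longrightarrow> f y (mp M x y v) = mp N x y (f x v)"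
  shows "f \<in> Hom P M N"
  using assms by (simp add: Hom_def)

lemma comp_mor_apply [simp]: "comp_mor g f x v = g x (f x v)"
  unfolding comp_mor_def ..

lemma id_mor_apply [simp]: "id_mor x v = v"
  unfolding id_mor_def ..

lemma zero_mor_apply [simp]: "zero_mor x v = 0"
  unfolding zero_mor_def ..

lemma mor_eqI: "(\<And>x v. x \<in> P \<Longrightarrow> v \<in> sp M x \<Longrightarrow> f x v = g x v) \<Longrightarrow> mor_eq P M f g"
  unfolding mor_eq_def by blast

lemma mor_eqD: "mor_eq P M f g \<Longrightarrow> x \<in> P \<Longrightarrow> v \<in> sp M x \<Longrightarrow> f x v = g x v"
  unfolding mor_eq_def by blast

lemma mor_eq_sym: "mor_eq P M f g \<Longrightarrow> mor_eq P M g f"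
  unfolding mor_eq_def by auto

lemma Hom_comp:
  assumes "f \<in> Hom P L M" "g \<in> Hom P M N"
  shows "comp_mor g f \<in> Hom P L N"
proof (rule HomI)
  fix x assume "x \<in> P"
  then show "lin_on (sp L x) (sp N x) (comp_mor g f x)"
    using lin_on_comp[OF Hom_lin[OF assms(1)] Hom_lin[OF assms(2)]] by (simp add: comp_mor_def)
next
  fix x y v assume "x \<in> P" "y \<in> P" "x \<le> y" "v \<in> sp L x"
  then show "comp_mor g f y (mp L x y v) = mp N x y (comp_mor g f x v)"
    using Hom_nat[OF assms(1)] Hom_nat[OF assms(2)] Hom_mem[OF assms(1)] by simp
qed

lemma Hom_id: "id_mor \<in> Hom P M M"
  by (rule HomI) (simp_all add: id_mor_def lin_on_id)

lemma Hom_zero: "N \<in> Rep P \<Longrightarrow> zero_mor \<in> Hom P M N"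
  using lin_on_const_zero[OF Rep_subspace] lin_on_zero[OF Rep_lin Rep_subspace]
  by (intro HomI) (auto simp: zero_mor_def)

lemma Hom_plus:
  assumes "f \<in> Hom P M N" "g \<in> Hom P M N" "N \<in> Rep P"
  shows "(\<lambda>x v. f x v + g x v) \<in> Hom P M N"
proof (rule HomI)
  fix x assume "x \<in> P"
  then show "lin_on (sp M x) (sp N x) (\<lambda>v. f x v + g x v)"
    using assms by (intro lin_on_plus Hom_lin Rep_subspace) auto
next
  fix x y v assume "x \<in> P" "y \<in> P" "x \<le> y" "v \<in> sp M x"
  then show "f y (mp M x y v) + g y (mp M x y v) = mp N x y (f x v + g x v)"
    using Hom_nat[OF assms(1)] Hom_nat[OF assms(2)] Hom_mem[OF assms(1)] Hom_mem[OF assms(2)]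
      lin_on_add[OF Rep_lin[OF assms(3)]] by simp
qed

lemma Hom_diff:
  assumes "f \<in> Hom P M N" "g \<in> Hom P M N" "N \<in> Rep P"
  shows "(\<lambda>x v. f x v - g x v) \<in> Hom P M N"
proof (rule HomI)
  fix x assume x: "x \<in> P"
  then have "lin_on (sp M x) (sp N x) (\<lambda>v. f x v + (- 1) *s g x v)"
    using assms by (intro lin_on_plus lin_on_scaled Hom_lin Rep_subspace) auto
  then show "lin_on (sp M x) (sp N x) (\<lambda>v. f x v - g x v)"
    by simp
next
  fix x y v assume "x \<in> P" "y \<in> P" "x \<le> y" "v \<in> sp M x"
  then show "f y (mp M x y v) - g y (mp M x y v) = mp N x y (f x v - g x v)"
    using Hom_nat[OF assms(1)] Hom_nat[OF assms(2)] Hom_mem[OF assms(1)] Hom_mem[OF assms(2)]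
      lin_on_diff[OF Rep_lin[OF assms(3)] Rep_subspace[OF assms(3)]] by simp
qed

lemma Hom_sum:
  assumes "\<And>j. j \<in> J \<Longrightarrow> f j \<in> Hom P M N" "N \<in> Rep P"
  shows "(\<lambda>x v. \<Sum>j\<in>J. f j x v) \<in> Hom P M N"
  using assms(1)
proof (induction J rule: infinite_finite_induct)
  case (insert j J)
  then show ?case
    using Hom_plus[OF _ _ assms(2), of "f j" M "\<lambda>x v. \<Sum>j\<in>J. f j x v"] by simp
qed (use Hom_zero[OF assms(2), of M] in \<open>simp_all add: zero_mor_def\<close>)

lemma Hom_cong:
  assumes "f \<in> Hom P M N" "mor_eq P M f g" "M \<in> Rep P"
  shows "g \<in> Hom P M N"
proof (rule HomI)
  fix x assume "x \<in> P"
  then show "lin_on (sp M x) (sp N x) (g x)"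
    using lin_on_cong[OF Hom_lin[OF assms(1)] Rep_subspace[OF assms(3)]] mor_eqD[OF assms(2)]
    by blast
next
  fix x y v assume "x \<in> P" "y \<in> P" "x \<le> y" "v \<in> sp M x"
  then show "g y (mp M x y v) = mp N x y (g x v)"
    using Hom_nat[OF assms(1)] mor_eqD[OF assms(2)] Rep_mem[OF assms(3)] by metis
qed

text \<open>Only one inclusion is recorded, the other comes with membership in \<open>Hom\<close>.
  The notion is kept apart from \<open>epi\<close>, which depends on the class of test
  objects.\<close>

definition surj_mor :: "'p::order set \<Rightarrow> ('p, 'b) prep \<Rightarrow> ('p, 'b) mor \<Rightarrow> ('p, 'b) prep \<Rightarrow> bool" where
  "surj_mor P M g N \<longleftrightarrow> (\<forall>x\<in>P. sp N x \<subseteq> g x ` sp M x)"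

lemma surj_morE:
  assumes "surj_mor P M g N" "x \<in> P" "w \<in> sp N x"
  obtains v where "v \<in> sp M x" "g x v = w"
  using assms unfolding surj_mor_def by blast

lemma surj_mor_epi:
  assumes "M \<in> C" "N \<in> C" "g \<in> Hom P M N" "surj_mor P M g N"
  shows "epi P C M g N"
  unfolding epi_def mor_eq_def
proof (intro conjI assms ballI impI allI)
  fix Z h h' x w
  assume *: "\<forall>x\<in>P. \<forall>v\<in>sp M x. comp_mor h g x v = comp_mor h' g x v" "x \<in> P" "w \<in> sp N x"
  then obtain v where "v \<in> sp M x" "g x v = w"
    using surj_morE[OF assms(4)] by blast
  then show "h x w = h' x w"
    using * by auto
qed


subsection \<open>Morphisms generated by a family\<close>

text \<open>
  \<open>gen P G U\<close> consists of the morphisms from \<open>U\<close> of the form \<open>\<Sum>\<^sub>i g\<^sub>i \<circ> a\<^sub>i\<close> with \<open>(A\<^sub>i, g\<^sub>i) \<in> G\<close> and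
  \<open>a\<^sub>i : U \<rightarrow> A\<^sub>i\<close>. Working with these sums instead of morphisms into a direct sum of the \<open>A\<^sub>i\<close>
  makes the Krull-Schmidt property dispensable.
\<close>

inductive_set gen :: "'p::order set \<Rightarrow> (('p, 'b) prep \<times> ('p, 'b) mor) set \<Rightarrow> ('p, 'b) prep \<Rightarrow>
    ('p, 'b) mor set"
  for P :: "'p::order set" and G :: "(('p, 'b) prep \<times> ('p, 'b) mor) set" and U :: "('p, 'b) prep" where
  zero: "zero_mor \<in> gen P G U"
| add: "f \<in> gen P G U \<Longrightarrow> (A, g) \<in> G \<Longrightarrow> a \<in> Hom P U A \<Longrightarrow> (\<lambda>x v. f x v + g x (a x v)) \<in> gen P G U"
| eq: "f \<in> gen P G U \<Longrightarrow> mor_eq P U f f' \<Longrightarrow> f' \<in> gen P G U"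

definition into :: "'p::order set \<Rightarrow> ('p, 'b) prep set \<Rightarrow> ('p, 'b) prep \<Rightarrow>
    (('p, 'b) prep \<times> ('p, 'b) mor) set" where
  "into P X M = {(A, g). A \<in> X \<and> g \<in> Hom P A M}"

lemma gen_Hom:
  assumes "f \<in> gen P G U" "G \<subseteq> into P UNIV M" "M \<in> Rep P" "U \<in> Rep P"
  shows "f \<in> Hom P U M"
  using assms(1)
proof induction
  case (add f A g a)
  then have "comp_mor g a \<in> Hom P U M"
    using assms(2) unfolding into_def by (intro Hom_comp[of a P U A]) auto
  then show ?case
    using Hom_plus[OF add.IH _ assms(3)] by (simp add: comp_mor_def)
qed (use Hom_zero Hom_cong assms in blast)+

lemma gen_plus:
  assumes "f \<in> gen P G U" "f' \<in> gen P G U"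
  shows "(\<lambda>x v. f x v + f' x v) \<in> gen P G U"
  using assms(2)
proof induction
  case zero
  show ?case using assms(1) by simp
next
  case (add f' A g a)
  show ?case
    using gen.add[OF add.IH add.hyps(2,3)] by (simp add: add.assoc)
next
  case (eq f' f'')
  show ?case
    by (rule gen.eq[OF eq.IH]) (use eq.hyps(2) in \<open>simp add: mor_eq_def\<close>)
qed

lemma gen_comp:
  assumes "f \<in> gen P G U" "k \<in> Hom P V U"
  shows "comp_mor f k \<in> gen P G V"
  using assms(1)
proof induction
  case zero
  show ?case using gen.zero by (rule gen.eq) (simp add: mor_eq_def)
next
  case (add f A g a)
  show ?case
    using gen.add[OF add.IH add.hyps(2) Hom_comp[OF assms(2) add.hyps(3)]]
    by (simp add: comp_mor_def)
next
  case (eq f f')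
  show ?case
    by (rule gen.eq[OF eq.IH]) (use eq.hyps(2) Hom_mem[OF assms(2)] in \<open>simp add: mor_eq_def\<close>)
qed

text \<open>Each generator in a sum is replaced by its own sum over \<open>G'\<close>; closure under
  precomposition and addition keeps the result in \<open>gen\<close>.\<close>

lemma gen_trans:
  assumes "f \<in> gen P G U" "\<And>A g. (A, g) \<in> G \<Longrightarrow> g \<in> gen P G' A"
  shows "f \<in> gen P G' U"
  using assms(1)
proof induction
  case (add f A g a)
  show ?case
    using gen_plus[OF add.IH gen_comp[OF assms(2)[OF add.hyps(2)] add.hyps(3)]] by simp
qed (use gen.zero gen.eq in blast)+

lemma gen_single:
  assumes "(A, g) \<in> G" "a \<in> Hom P U A"
  shows "comp_mor g a \<in> gen P G U"
  using gen.add[OF gen.zero assms] by (simp add: comp_mor_def)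

lemma gen_base: "(A, g) \<in> G \<Longrightarrow> g \<in> gen P G A"
  using gen_single[OF _ Hom_id] by (simp add: comp_mor_def)

lemma gen_mono: "f \<in> gen P G U \<Longrightarrow> G \<subseteq> G' \<Longrightarrow> f \<in> gen P G' U"
  by (erule gen_trans) (auto intro: gen_base)

lemma gen_sum:
  assumes "\<And>j. j \<in> J \<Longrightarrow> f j \<in> gen P G U"
  shows "(\<lambda>x v. \<Sum>j\<in>J. f j x v) \<in> gen P G U"
  using assms
proof (induction J rule: infinite_finite_induct)
  case (insert j J)
  then show ?case
    using gen_plus[of "f j" P G U "\<lambda>x v. \<Sum>j\<in>J. f j x v"] by simp
qed (use gen.zero[of P G U] in \<open>simp_all add: zero_mor_def\<close>)

text \<open>The morphisms of \<open>G\<close> are required to end in \<open>M\<close> because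
  \<open>r\<close> is additive only on the spaces of \<open>M\<close>.\<close>

lemma gen_left:
  assumes "f \<in> gen P G U" "G \<subseteq> into P UNIV M" "M \<in> Rep P" "U \<in> Rep P" "r \<in> Hom P M N"
  shows "comp_mor r f \<in> gen P ((\<lambda>(A, g). (A, comp_mor r g)) ` G) U"
  using assms(1)
proof induction
  case zero
  show ?case
    by (rule gen.eq[OF gen.zero]) (use Hom_vanish[OF assms(5,3)] in \<open>simp add: mor_eq_def\<close>)
next
  case (add f A g a)
  have g: "g \<in> Hom P A M" using add.hyps(2) assms(2) unfolding into_def by blast
  have f: "f \<in> Hom P U M" using gen_Hom[OF add.hyps(1) assms(2-4)] .
  have "(A, comp_mor r g) \<in> (\<lambda>(A, g). (A, comp_mor r g)) ` G"
    using add.hyps(2) by force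
  from gen.add[OF add.IH this add.hyps(3)] show ?case
    by (rule gen.eq)
      (use lin_on_add[OF Hom_lin[OF assms(5)]] Hom_mem[OF f] Hom_mem[OF g] Hom_mem[OF add.hyps(3)]
        in \<open>simp add: mor_eq_def\<close>)
next
  case (eq f f')
  show ?case
    by (rule gen.eq[OF eq.IH]) (use eq.hyps(2) in \<open>simp add: mor_eq_def\<close>)
qed

text \<open>A member is built in finitely many steps, each naming at most one generator. This turns
  a retract of members of an arbitrary class into a retract of finitely many of them.\<close>

lemma gen_finite:
  assumes "f \<in> gen P G U"
  obtains G' where "finite G'" "G' \<subseteq> G" "f \<in> gen P G' U"
proof -
  have "\<exists>G'. finite G' \<and> G' \<subseteq> G \<and> f \<in> gen P G' U"
    using assms
  proof induction
    case zero
    show ?case using gen.zero by blast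
  next
    case (add f A g a)
    then obtain G' where "finite G'" "G' \<subseteq> G" "f \<in> gen P G' U" by blast
    then have "(\<lambda>x v. f x v + g x (a x v)) \<in> gen P (insert (A, g) G') U"
      using gen.add[OF gen_mono _ add.hyps(3)] by blast
    then show ?case
      using \<open>finite G'\<close> \<open>G' \<subseteq> G\<close> add.hyps(2) by (intro exI[of _ "insert (A, g) G'"]) auto
  next
    case (eq f f')
    then obtain G' where "finite G'" "G' \<subseteq> G" "f \<in> gen P G' U" by blast
    then show ?case using gen.eq[OF _ eq.hyps(2)] by (intro exI[of _ G']) simp
  qed
  then show ?thesis using that by blast
qed

text \<open>Lifts of the generators, composed and added in the same pattern, form a lift of the sum;
  hence lifting properties need to be tested on generators only.\<close>

lemma gen_lift:
  assumes "f \<in> gen P G U" "g \<in> Hom P M N" "M \<in> Rep P"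
    and "\<And>A b. (A, b) \<in> G \<Longrightarrow> \<exists>k\<in>Hom P A M. mor_eq P A (comp_mor g k) b"
  shows "\<exists>k\<in>Hom P U M. mor_eq P U (comp_mor g k) f"
  using assms(1)
proof induction
  case zero
  show ?case
    using Hom_zero[OF assms(3)] Hom_vanish[OF assms(2,3)]
    by (intro bexI[of _ zero_mor]) (auto simp: mor_eq_def)
next
  case (add f A b a)
  obtain k where k: "k \<in> Hom P U M" "mor_eq P U (comp_mor g k) f" using add.IH by blast
  obtain l where l: "l \<in> Hom P A M" "mor_eq P A (comp_mor g l) b" using assms(4) add.hyps by blast
  have "(\<lambda>x v. k x v + l x (a x v)) \<in> Hom P U M"
    using Hom_plus[OF k(1) Hom_comp[OF add.hyps(3) l(1)] assms(3)] by (simp add: comp_mor_def)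
  moreover have "mor_eq P U (comp_mor g (\<lambda>x v. k x v + l x (a x v))) (\<lambda>x v. f x v + b x (a x v))"
    using lin_on_add[OF Hom_lin[OF assms(2)]] Hom_mem[OF k(1)] Hom_mem[OF l(1)]
      Hom_mem[OF add.hyps(3)] mor_eqD[OF k(2)] mor_eqD[OF l(2)]
    by (auto simp: mor_eq_def)
  ultimately show ?case by blast
next
  case (eq f f')
  then show ?case by (auto simp: mor_eq_def)
qed

text \<open>\<open>M\<close> is a retract of a finite direct sum of objects of \<open>X\<close>.\<close>

definition retract_of :: "'p::order set \<Rightarrow> ('p, 'b) prep set \<Rightarrow> ('p, 'b) prep \<Rightarrow> bool" where
  "retract_of P X M \<longleftrightarrow> id_mor \<in> gen P (into P X M) M"

text \<open>The identity of \<open>M\<close> is a sum of composites \<open>b \<circ> a\<close>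
  through members of \<open>X\<close>; composing with \<open>h\<close> writes every morphism out of
  \<open>M\<close> as such a sum.\<close>

lemma retract_of_gen:
  assumes "retract_of P X M" "h \<in> Hom P M N" "M \<in> Rep P"
  shows "h \<in> gen P {(A, comp_mor h b) | A b. (A, b) \<in> into P X M} M"
proof -
  have "comp_mor h id_mor \<in> gen P ((\<lambda>(A, g). (A, comp_mor h g)) ` into P X M) M"
    by (rule gen_left[OF _ _ assms(3,3,2)]) (use assms(1) in \<open>auto simp: retract_of_def into_def\<close>)
  moreover have "(\<lambda>(A, g). (A, comp_mor h g)) ` into P X M = {(A, comp_mor h b) | A b. (A, b) \<in> into P X M}"
    by auto
  ultimately show ?thesis by (simp add: comp_mor_def)
qed

text \<open>Reduces a question about morphisms out of a retract to morphisms out of members of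
  \<open>X\<close>. Combined with \<open>add_retract_of\<close>, it carries approximations for
  \<open>X\<close> over to \<open>add P C X\<close>.\<close>

lemma retract_of_gen_trans:
  assumes "retract_of P X M" "h \<in> Hom P M N" "M \<in> Rep P"
    and "\<And>A k. A \<in> X \<Longrightarrow> k \<in> Hom P A N \<Longrightarrow> k \<in> gen P G A"
  shows "h \<in> gen P G M"
proof (rule gen_trans[OF retract_of_gen[OF assms(1-3)]])
  fix A g assume "(A, g) \<in> {(A, comp_mor h b) | A b. (A, b) \<in> into P X M}"
  then show "g \<in> gen P G A"
    using assms(4) Hom_comp[OF _ assms(2)] unfolding into_def by blast
qed

lemma retract_of_trans:
  assumes "retract_of P Y M" "M \<in> Rep P" "\<And>A. A \<in> Y \<Longrightarrow> A \<in> Rep P \<and> retract_of P X A"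
  shows "retract_of P X M"
  unfolding retract_of_def
proof (rule retract_of_gen_trans[OF assms(1) Hom_id assms(2)])
  fix A k assume A: "A \<in> Y" and k: "k \<in> Hom P A M"
  show "k \<in> gen P (into P X M) A"
  proof (rule retract_of_gen_trans[OF _ k])
    fix B l assume "B \<in> X" "l \<in> Hom P B M"
    then show "l \<in> gen P (into P X M) B"
      by (intro gen_base) (simp add: into_def)
  qed (use assms(3)[OF A] in auto)
qed

lemma retract_ofI:
  assumes "A \<in> X" "a \<in> Hom P M A" "b \<in> Hom P A M" "mor_eq P M (comp_mor b a) id_mor"
  shows "retract_of P X M"
  unfolding retract_of_def
  by (rule gen.eq[OF gen_single[OF _ assms(2)] assms(4)]) (use assms in \<open>simp add: into_def\<close>)

lemma direct_sum_retract_of: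
  assumes "direct_sum P Ms S" "set Ms \<subseteq> X"
  shows "retract_of P X S"
proof -
  obtain \<iota> \<pi> where *: "\<forall>j<length Ms. \<iota> j \<in> Hom P (Ms ! j) S \<and> \<pi> j \<in> Hom P S (Ms ! j)"
      "mor_eq P S (\<lambda>x v. \<Sum>j<length Ms. \<iota> j x (\<pi> j x v)) id_mor"
    using assms(1) unfolding direct_sum_def by blast
  have "(Ms ! j, \<iota> j) \<in> into P X S" if "j < length Ms" for j
    using * assms(2) that unfolding into_def by auto
  then have "(\<lambda>x v. \<Sum>j<length Ms. comp_mor (\<iota> j) (\<pi> j) x v) \<in> gen P (into P X S) S"
    using * by (intro gen_sum gen_single) auto
  then show ?thesis
    unfolding retract_of_def using gen.eq *(2) by fastforce
qed

lemma direct_sum_pair: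
  assumes "direct_sum P [M, N] S"
  obtains i1 p1 i2 p2 where "i1 \<in> Hom P M S" "p1 \<in> Hom P S M" "i2 \<in> Hom P N S" "p2 \<in> Hom P S N"
    "mor_eq P M (comp_mor p1 i1) id_mor" "mor_eq P N (comp_mor p2 i2) id_mor"
    "mor_eq P M (comp_mor p2 i1) zero_mor" "mor_eq P N (comp_mor p1 i2) zero_mor"
    "mor_eq P S (\<lambda>x v. i1 x (p1 x v) + i2 x (p2 x v)) id_mor"
proof -
  obtain \<iota> \<pi> where *: "\<forall>j<2. \<iota> j \<in> Hom P ([M, N] ! j) S \<and> \<pi> j \<in> Hom P S ([M, N] ! j)"
      "\<forall>j<2. \<forall>k<2. mor_eq P ([M, N] ! j) (comp_mor (\<pi> k) (\<iota> j)) (if j = k then id_mor else zero_mor)"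
      "mor_eq P S (\<lambda>x v. \<Sum>j<2. \<iota> j x (\<pi> j x v)) id_mor"
    using assms unfolding direct_sum_def by (auto simp: numeral_2_eq_2)
  have s: "(\<Sum>j<2. f j) = f 0 + f 1" for f :: "nat \<Rightarrow> 'b"
    by (simp add: numeral_2_eq_2)
  show ?thesis
    using that[of "\<iota> 0" "\<pi> 0" "\<iota> 1" "\<pi> 1"] *(1)[rule_format, of 0] *(1)[rule_format, of 1]
      *(2)[rule_format, of 0 0] *(2)[rule_format, of 0 1] *(2)[rule_format, of 1 0]
      *(2)[rule_format, of 1 1] *(3) unfolding s by simp
qed

lemma direct_sum_pairI:
  assumes "i1 \<in> Hom P M S" "p1 \<in> Hom P S M" "i2 \<in> Hom P N S" "p2 \<in> Hom P S N"
    "mor_eq P M (comp_mor p1 i1) id_mor" "mor_eq P N (comp_mor p2 i2) id_mor"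
    "mor_eq P M (comp_mor p2 i1) zero_mor" "mor_eq P N (comp_mor p1 i2) zero_mor"
    "mor_eq P S (\<lambda>x v. i1 x (p1 x v) + i2 x (p2 x v)) id_mor"
  shows "direct_sum P [M, N] S"
  unfolding direct_sum_def
  using assms
  by (intro exI[of _ "\<lambda>j. if j = 0 then i1 else i2"] exI[of _ "\<lambda>j. if j = 0 then p1 else p2"])
    (auto simp: less_Suc_eq)

lemma add_subset: "M \<in> add P C X \<Longrightarrow> M \<in> C"
  by (induction rule: add.induct) (auto simp: direct_summand_def)

lemma add_Rep: "M \<in> add P C X \<Longrightarrow> C \<subseteq> Rep P \<Longrightarrow> M \<in> Rep P"
  by (drule add_subset) (rule subsetD)

text \<open>Every closure step of \<open>add\<close> exhibits the new object as a retract of a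
  finite sum of earlier ones, and retracts compose. Later arguments use this expression of the
  identity, never a decomposition into indecomposables.\<close>

lemma add_retract_of:
  assumes "M \<in> add P C X" "C \<subseteq> Rep P"
  shows "retract_of P X M"
  using assms(1)
proof induction
  case (base M)
  then show ?case
    using retract_ofI[OF _ Hom_id Hom_id] by (simp add: mor_eq_def)
next
  case (iso M N)
  then obtain f g where "f \<in> Hom P M N" "g \<in> Hom P N M" "mor_eq P N (comp_mor f g) id_mor"
    unfolding isomorphic_def by blast
  then have "retract_of P {M} N"
    using retract_ofI[of M "{M}" g P N f] by simp
  moreover have "N \<in> Rep P" "M \<in> Rep P"
    using iso.hyps assms(2) add_Rep by blast+
  ultimately show ?case
    using iso.IH by (intro retract_of_trans[of P "{M}" N X]) simp_all
next
  case (sum Ms S)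
  then have "retract_of P (set Ms) S"
    using direct_sum_retract_of by blast
  moreover have "S \<in> Rep P"
    using sum.hyps assms(2) by blast
  moreover have "A \<in> Rep P \<and> retract_of P X A" if "A \<in> set Ms" for A
    using sum that add_Rep[OF _ assms(2), of A X] by simp
  ultimately show ?case
    by (intro retract_of_trans[of P "set Ms" S X]) simp_all
next
  case (summand S M)
  then obtain N where N: "direct_sum P [M, N] S" "M \<in> C"
    unfolding direct_summand_def by blast
  obtain i p where "i \<in> Hom P M S" "p \<in> Hom P S M" "mor_eq P M (comp_mor p i) id_mor"
    by (rule direct_sum_pair[OF N(1)])
  then have "retract_of P {S} M"
    using retract_ofI[of S "{S}" i P M p] by simp
  moreover have "M \<in> Rep P" "S \<in> Rep P"
    using N(2) summand.hyps(1) assms(2) add_Rep by blast+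
  ultimately show ?case
    using summand.IH by (intro retract_of_trans[of P "{S}" M X]) simp_all
qed


subsection \<open>Kernels, cokernels and direct sums\<close>

text \<open>The structure maps stay those of \<open>M\<close>, so that the inclusion into
  \<open>M\<close> is literally \<open>id_mor\<close>.\<close>

definition kernel_rep :: "('p, 'b) prep \<Rightarrow> ('p, 'b) mor \<Rightarrow> ('p, 'b) prep" where
  "kernel_rep M g = \<lparr>sp = (\<lambda>x. {v \<in> sp M x. g x v = 0}), mp = mp M\<rparr>"

lemma kernel_rep_simps [simp]:
  "sp (kernel_rep M g) x = {v \<in> sp M x. g x v = 0}" "mp (kernel_rep M g) = mp M"
  unfolding kernel_rep_def by simp_all

lemma kernel_rep_Rep:
  assumes "M \<in> Rep P" "N \<in> Rep P" "g \<in> Hom P M N"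
  shows "kernel_rep M g \<in> Rep P"
proof -
  have mem: "mp M x y v \<in> sp M y \<and> g y (mp M x y v) = 0"
    if "x \<in> P" "y \<in> P" "x \<le> y" "v \<in> sp M x" "g x v = 0" for x y v
    using that Hom_nat[OF assms(3)] Rep_mem[OF assms(1)] lin_on_zero[OF Rep_lin Rep_subspace] assms(2)
    by metis
  have sub: "subspace {v \<in> sp M x. g x v = 0}" if "x \<in> P" for x
    using lin_on_vimage_subspace[OF Hom_lin[OF assms(3) that] Rep_subspace[OF assms(1) that] subspace_single_0]
    by simp
  have lin: "lin_on {v \<in> sp M x. g x v = 0} {v \<in> sp M y. g y v = 0} (mp M x y)"
    if "x \<in> P" "y \<in> P" "x \<le> y" for x y
    using Rep_lin[OF assms(1) that] mem[OF that] unfolding lin_on_def by auto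
  show ?thesis
    unfolding Rep_def using sub lin Rep_refl[OF assms(1)] Rep_trans[OF assms(1)] by auto
qed

lemma kernel_rep_incl: "id_mor \<in> Hom P (kernel_rep M g) M"
  by (rule HomI) (auto simp: id_mor_def lin_on_def)

lemma kernel_rep_lift:
  assumes "h \<in> Hom P Z M" "mor_eq P Z (comp_mor g h) zero_mor"
  shows "h \<in> Hom P Z (kernel_rep M g)"
proof (rule HomI)
  fix x assume "x \<in> P"
  then show "lin_on (sp Z x) (sp (kernel_rep M g) x) (h x)"
    using Hom_lin[OF assms(1)] mor_eqD[OF assms(2)] unfolding lin_on_def
    by (auto simp: image_subset_iff)
qed (use Hom_nat[OF assms(1)] in auto)

lemma kernel_rep_is_kernel:
  assumes "M \<in> C" "N \<in> C" "g \<in> Hom P M N" "kernel_rep M g \<in> C"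
  shows "is_kernel P C (kernel_rep M g) id_mor M g N"
  unfolding is_kernel_def
proof (intro conjI ballI impI)
  show "mor_eq P (kernel_rep M g) (comp_mor g id_mor) zero_mor"
    by (simp add: mor_eq_def)
  fix Z h assume "h \<in> Hom P Z M" "mor_eq P Z (comp_mor g h) zero_mor"
  then show "\<exists>k\<in>Hom P Z (kernel_rep M g). mor_eq P Z (comp_mor id_mor k) h \<and>
      (\<forall>k'\<in>Hom P Z (kernel_rep M g). mor_eq P Z (comp_mor id_mor k') h \<longrightarrow> mor_eq P Z k' k)"
    by (intro bexI[OF _ kernel_rep_lift]) (auto simp: mor_eq_def)
qed (use assms kernel_rep_incl in auto)

text \<open>A kernel known only by its universal property is compared with the pointwise one. The
  morphism \<open>s\<close> inverts \<open>f\<close>, because \<open>s \<circ> f\<close> and the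
  identity both factor \<open>f\<close> through itself and such factorizations are unique.\<close>

lemma is_kernel_inj:
  assumes "is_kernel P C L f M g N" "kernel_rep M g \<in> C" "C \<subseteq> Rep P" "x \<in> P" "v \<in> sp L x" "f x v = 0"
  shows "v = 0"
proof -
  have L: "L \<in> Rep P" "M \<in> Rep P" "f \<in> Hom P L M" "mor_eq P L (comp_mor g f) zero_mor" "L \<in> C"
    using assms(1,3) unfolding is_kernel_def by auto
  have "mor_eq P (kernel_rep M g) (comp_mor g id_mor) zero_mor"
    by (auto simp: mor_eq_def)
  then obtain s where s: "s \<in> Hom P (kernel_rep M g) L" "mor_eq P (kernel_rep M g) (comp_mor f s) id_mor"
    using assms(1,2) kernel_rep_incl unfolding is_kernel_def by metis
  have f: "f \<in> Hom P L (kernel_rep M g)"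
    using kernel_rep_lift L by blast
  then have sf: "comp_mor s f \<in> Hom P L L"
    using Hom_comp s(1) by blast
  have "mor_eq P L (comp_mor f (comp_mor s f)) f"
    using mor_eqD[OF s(2)] Hom_mem[OF f] by (auto simp: mor_eq_def)
  moreover obtain k where "\<forall>k'\<in>Hom P L L. mor_eq P L (comp_mor f k') f \<longrightarrow> mor_eq P L k' k"
    using assms(1) L unfolding is_kernel_def by metis
  moreover have "mor_eq P L (comp_mor f id_mor) f"
    by (auto simp: mor_eq_def)
  ultimately have "mor_eq P L (comp_mor s f) k" "mor_eq P L id_mor k"
    using sf Hom_id by metis+
  then have "s x (f x v) = v"
    using assms(4,5) by (auto simp: mor_eq_def)
  moreover have "kernel_rep M g \<in> Rep P"
    using assms(2,3) by (rule subsetD[rotated])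
  then have "s x 0 = 0"
    by (rule Hom_vanish[OF s(1) _ assms(4)])
  ultimately show ?thesis using assms(6) by simp
qed

text \<open>A morphism that kills the image of \<open>f\<close> is pushed down along
  \<open>g\<close> by choosing preimages; exactness at \<open>M\<close> makes the value independent
  of the choice.\<close>

lemma is_cokernelI:
  assumes "L \<in> C" "M \<in> C" "N \<in> C" "C \<subseteq> Rep P" "f \<in> Hom P L M" "g \<in> Hom P M N" "surj_mor P M g N"
    and im: "\<And>x v. x \<in> P \<Longrightarrow> v \<in> sp L x \<Longrightarrow> g x (f x v) = 0"
    and ker: "\<And>x v. x \<in> P \<Longrightarrow> v \<in> sp M x \<Longrightarrow> g x v = 0 \<Longrightarrow> v \<in> f x ` sp L x"
  shows "is_cokernel P C L f M g N"
proof -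
  have M: "M \<in> Rep P" and N: "N \<in> Rep P" using assms by auto
  have "\<exists>k\<in>Hom P N Z. mor_eq P M (comp_mor k g) h"
    if Z: "Z \<in> C" and h: "h \<in> Hom P M Z" and h0: "mor_eq P L (comp_mor h f) zero_mor" for Z h
  proof -
    define k where "k x w = h x (SOME v. v \<in> sp M x \<and> g x v = w)" for x w
    have eq: "h x v = h x v'" if asm: "x \<in> P" "v \<in> sp M x" "v' \<in> sp M x" "g x v = g x v'" for x v v'
    proof -
      have "g x (v - v') = 0" "v - v' \<in> sp M x"
        using lin_on_diff[OF Hom_lin[OF assms(6)] Rep_subspace[OF M]] that
          subspace_diff[OF Rep_subspace[OF M]] by auto
      then obtain u where "u \<in> sp L x" "v - v' = f x u"
        using ker[OF asm(1)] by blast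
      then have "h x (v - v') = 0"
        using mor_eqD[OF h0 that(1)] by auto
      then show ?thesis
        using lin_on_diff[OF Hom_lin[OF h] Rep_subspace[OF M]] that by auto
    qed
    have kg: "k x (g x v) = h x v" if "x \<in> P" "v \<in> sp M x" for x v
    proof -
      have "(SOME u. u \<in> sp M x \<and> g x u = g x v) \<in> sp M x \<and> g x (SOME u. u \<in> sp M x \<and> g x u = g x v) = g x v"
        using someI[of "\<lambda>u. u \<in> sp M x \<and> g x u = g x v" v] that by simp
      then show ?thesis
        unfolding k_def using eq that by blast
    qed
    have "k \<in> Hom P N Z"
    proof (rule HomI)
      fix x assume x: "x \<in> P"
      show "lin_on (sp N x) (sp Z x) (k x)"
        unfolding lin_on_def
      proof (intro conjI ballI allI)
        show "k x ` sp N x \<subseteq> sp Z x"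
          using surj_morE[OF assms(7) x] kg[OF x] Hom_mem[OF h x] by (metis image_subsetI)
        fix u assume "u \<in> sp N x"
        then obtain u' where u: "u' \<in> sp M x" "g x u' = u" using surj_morE[OF assms(7) x] by blast
        show "k x (c *s u) = c *s k x u" for c
          using u kg[OF x, of "c *s u'"] kg[OF x, of u'] lin_on_scale[OF Hom_lin[OF h x]]
            lin_on_scale[OF Hom_lin[OF assms(6) x]] subspace_scale[OF Rep_subspace[OF M x]] by metis
        fix v assume "v \<in> sp N x"
        then obtain v' where v: "v' \<in> sp M x" "g x v' = v" using surj_morE[OF assms(7) x] by blast
        show "k x (u + v) = k x u + k x v"
          using u v kg[OF x, of "u' + v'"] kg[OF x, of u'] kg[OF x, of v'] lin_on_add[OF Hom_lin[OF h x]]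
            lin_on_add[OF Hom_lin[OF assms(6) x]] subspace_add[OF Rep_subspace[OF M x]] by metis
      qed
    next
      fix x y v assume xy: "x \<in> P" "y \<in> P" "x \<le> y" "v \<in> sp N x"
      then obtain v' where v: "v' \<in> sp M x" "g x v' = v" using surj_morE[OF assms(7)] by blast
      then show "k y (mp N x y v) = mp Z x y (k x v)"
        using kg[OF xy(1), of v'] kg[OF xy(2), of "mp M x y v'"] Rep_mem[OF M xy(1-3)]
          Hom_nat[OF h xy(1-3)] Hom_nat[OF assms(6) xy(1-3)] by metis
    qed
    then show ?thesis using kg by (auto simp: mor_eq_def)
  qed
  moreover have uniq: "mor_eq P N k k'"
    if asm: "mor_eq P M (comp_mor k g) h" "mor_eq P M (comp_mor k' g) h" for k k' h
  proof (rule mor_eqI)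
    fix x w assume x: "x \<in> P" and w: "w \<in> sp N x"
    obtain v where "v \<in> sp M x" "g x v = w" using surj_morE[OF assms(7) x w] .
    then show "k x w = k' x w"
      using mor_eqD[OF asm(1) x, of v] mor_eqD[OF asm(2) x, of v] by simp
  qed
  moreover have "mor_eq P L (comp_mor g f) zero_mor"
    using im by (simp add: mor_eq_def)
  ultimately show ?thesis
    unfolding is_cokernel_def
  proof (intro conjI ballI impI, goal_cases)
    case (7 Z h)
    then obtain k where k: "k \<in> Hom P N Z" "mor_eq P M (comp_mor k g) h" by blast
    show ?case
      by (rule bexI[OF _ k(1)]) (use k(2) uniq in blast)
  qed (use assms(1-6) in auto)
qed

text \<open>The two induced morphisms compose to the identity of \<open>N\<close> by uniqueness.
  This half of the isomorphism is the form needed, since tameness is inherited by retracts.\<close>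

lemma is_cokernel_unique:
  assumes "is_cokernel P C L f M g N" "is_cokernel P C L f M g' N'"
  shows "retract_of P {N'} N"
proof -
  have *: "N \<in> C" "N' \<in> C" "g \<in> Hom P M N" "g' \<in> Hom P M N'" "mor_eq P L (comp_mor g f) zero_mor"
      "mor_eq P L (comp_mor g' f) zero_mor"
    using assms unfolding is_cokernel_def by auto
  obtain a where a: "a \<in> Hom P N N'" "mor_eq P M (comp_mor a g) g'"
    using assms(1) * unfolding is_cokernel_def by metis
  obtain b where b: "b \<in> Hom P N' N" "mor_eq P M (comp_mor b g') g"
    using assms(2) * unfolding is_cokernel_def by metis
  have ba: "comp_mor b a \<in> Hom P N N"
    using Hom_comp[OF a(1) b(1)] .
  have "mor_eq P M (comp_mor (comp_mor b a) g) g"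
    using mor_eqD[OF a(2)] mor_eqD[OF b(2)] by (auto simp: mor_eq_def)
  moreover obtain k where "\<forall>k'\<in>Hom P N N. mor_eq P M (comp_mor k' g) g \<longrightarrow> mor_eq P N k' k"
    using assms(1) * unfolding is_cokernel_def by metis
  moreover have "mor_eq P M (comp_mor id_mor g) g"
    by (auto simp: mor_eq_def)
  ultimately have "mor_eq P N (comp_mor b a) k" "mor_eq P N id_mor k"
    using ba Hom_id by metis+
  then have "mor_eq P N (comp_mor b a) id_mor"
    by (auto simp: mor_eq_def)
  then show ?thesis
    using retract_ofI[of N' "{N'}" a P N b] a b by simp
qed

text \<open>The quotient is modelled inside \<open>N\<close> by an idempotent at each point, chosen
  independently of the other points; the structure maps of \<open>N\<close> are then corrected by
  the idempotent at the target.\<close>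

lemma cokernel_exists:
  assumes "M \<in> Rep P" "N \<in> Rep P" "g \<in> Hom P M N"
  obtains Z q where "Z \<in> Rep P" "q \<in> Hom P N Z" "surj_mor P N q Z"
    "\<And>x v. x \<in> P \<Longrightarrow> v \<in> sp N x \<Longrightarrow> q x v = 0 \<longleftrightarrow> v \<in> g x ` sp M x"
proof -
  define R where "R x p \<longleftrightarrow> lin_on (sp N x) (sp N x) p \<and> (\<forall>v\<in>sp N x. v - p v \<in> g x ` sp M x) \<and>
      (\<forall>u\<in>g x ` sp M x. p u = 0) \<and> (\<forall>v\<in>sp N x. p (p v) = p v)" for x p
  have "\<exists>p. R x p" if x: "x \<in> P" for x
  proof -
    have "subspace (g x ` sp M x)"
      using lin_on_image_subspace[OF Hom_lin[OF assms(3) x] Rep_subspace[OF assms(1) x]] .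
    moreover have "g x ` sp M x \<subseteq> sp N x"
      using Hom_mem[OF assms(3) x] by blast
    ultimately show ?thesis
      using complement_projection[OF Rep_subspace[OF assms(2) x], of "g x ` sp M x"]
      unfolding R_def by metis
  qed
  then obtain q where "\<And>x. x \<in> P \<Longrightarrow> R x (q x)"
    by metis
  then have q: "\<And>x. x \<in> P \<Longrightarrow> lin_on (sp N x) (sp N x) (q x)"
      "\<And>x v. x \<in> P \<Longrightarrow> v \<in> sp N x \<Longrightarrow> v - q x v \<in> g x ` sp M x"
      "\<And>x u. x \<in> P \<Longrightarrow> u \<in> g x ` sp M x \<Longrightarrow> q x u = 0"
      "\<And>x v. x \<in> P \<Longrightarrow> v \<in> sp N x \<Longrightarrow> q x (q x v) = q x v"
    unfolding R_def by blast+
  define Z where "Z = \<lparr>sp = (\<lambda>x. q x ` sp N x), mp = (\<lambda>x y v. q y (mp N x y v))\<rparr>"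
  have Zs: "sp Z x = q x ` sp N x" "mp Z x y v = q y (mp N x y v)" for x y v
    unfolding Z_def by simp_all
  have sub: "sp Z x \<subseteq> sp N x" if "x \<in> P" for x
    using lin_on_mem[OF q(1)[OF that]] Zs by auto
  \<comment> \<open>The difference \<open>v - q x v\<close> lies in the image of \<open>g\<close>,
    which the structure maps of \<open>N\<close> preserve and \<open>q y\<close> kills. Both
    naturality of \<open>q\<close> and functoriality of \<open>Z\<close> rest on this.\<close>
  have qq: "q y (mp N x y (q x v)) = q y (mp N x y v)" if asm: "x \<in> P" "y \<in> P" "x \<le> y" "v \<in> sp N x" for x y v
  proof -
    obtain u where u: "u \<in> sp M x" "v - q x v = g x u" using q(2)[OF asm(1,4)] by blast
    have qv: "q x v \<in> sp N x" using lin_on_mem[OF q(1)] that by blast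
    have "mp N x y v - mp N x y (q x v) = g y (mp M x y u)"
      using u lin_on_diff[OF Rep_lin[OF assms(2) that(1-3)] Rep_subspace[OF assms(2) that(1)] that(4) qv]
        Hom_nat[OF assms(3) that(1-3)] by metis
    then have "q y (mp N x y v - mp N x y (q x v)) = 0"
      using q(3)[OF that(2)] Rep_mem[OF assms(1) that(1-3) u(1)] by auto
    then show ?thesis
      using lin_on_diff[OF q(1)[OF that(2)] Rep_subspace[OF assms(2) that(2)]
          Rep_mem[OF assms(2) that(1-3) that(4)] Rep_mem[OF assms(2) that(1-3) qv]] by simp
  qed
  have "Z \<in> Rep P"
    unfolding Rep_def
  proof (intro CollectI conjI ballI impI)
    fix x assume x: "x \<in> P"
    show "subspace (sp Z x)"
      using lin_on_image_subspace[OF q(1)[OF x] Rep_subspace[OF assms(2) x]] Zs by simp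
    {
      fix y assume y: "y \<in> P" "x \<le> y"
      have "lin_on (sp N x) (sp Z y) (\<lambda>v. q y (mp N x y v))"
        using lin_on_comp[OF Rep_lin[OF assms(2) x y] q(1)[OF y(1)]] Rep_mem[OF assms(2) x y]
        unfolding lin_on_def Zs by auto
      then show "lin_on (sp Z x) (sp Z y) (mp Z x y)"
        using sub[OF x] unfolding lin_on_def by (auto simp: Zs(2) subset_iff image_subset_iff)
      fix z v assume z: "z \<in> P" "y \<le> z" "v \<in> sp Z x"
      then have v: "v \<in> sp N x" using sub[OF x] by auto
      show "mp Z y z (mp Z x y v) = mp Z x z v"
        using qq[OF y(1) z(1,2)] Rep_mem[OF assms(2) x y v] Rep_trans[OF assms(2) x y(1) z(1) y(2) z(2) v]
        by (simp add: Zs(2))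
    }
    fix v assume "v \<in> sp Z x"
    then obtain u where u: "u \<in> sp N x" "v = q x u" unfolding Zs(1) by blast
    then show "mp Z x x v = v"
      using q(4)[OF x u(1)] Rep_refl[OF assms(2) x] lin_on_mem[OF q(1)[OF x] u(1)] by (simp add: Zs)
  qed
  moreover have "q \<in> Hom P N Z"
  proof (rule HomI)
    fix x assume "x \<in> P"
    then show "lin_on (sp N x) (sp Z x) (q x)"
      using q(1) unfolding lin_on_def Zs(1) by auto
  qed (use qq in \<open>simp add: Zs\<close>)
  moreover have "surj_mor P N q Z"
    unfolding surj_mor_def Zs by blast
  moreover have "q x v = 0 \<longleftrightarrow> v \<in> g x ` sp M x" if "x \<in> P" "v \<in> sp N x" for x v
    using q(2,3)[OF that(1)] that by (metis diff_zero)
  ultimately show ?thesis using that by blast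
qed

text \<open>The cokernel map \<open>q\<close> and the zero morphism agree after \<open>g\<close>, so
  an epimorphism forces \<open>q\<close> to vanish. The object \<open>Z\<close> is a parameter
  because the test object must be known to lie in \<open>C\<close>.\<close>

lemma epi_surj_mor:
  assumes "epi P C M g N" "C \<subseteq> Rep P" "Z \<in> C" "q \<in> Hom P N Z"
    "\<And>x v. x \<in> P \<Longrightarrow> v \<in> sp N x \<Longrightarrow> q x v = 0 \<longleftrightarrow> v \<in> g x ` sp M x"
  shows "surj_mor P M g N"
proof -
  have g: "g \<in> Hom P M N" "Z \<in> Rep P" using assms unfolding epi_def by auto
  have "mor_eq P M (comp_mor q g) (comp_mor zero_mor g)"
    using assms(5) Hom_mem[OF g(1)] by (simp add: mor_eq_def)
  then have "mor_eq P N q zero_mor"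
    using assms(1,3,4) Hom_zero[OF g(2)] unfolding epi_def by blast
  then show ?thesis
    using assms(5) unfolding surj_mor_def mor_eq_def by auto
qed

lemma epi_Rep_surj_mor:
  assumes "epi P (Rep P) M g N"
  shows "surj_mor P M g N"
proof -
  have *: "M \<in> Rep P" "N \<in> Rep P" "g \<in> Hom P M N"
    using assms unfolding epi_def by auto
  show ?thesis
  proof (rule cokernel_exists[OF *])
    fix Z q
    assume Z: "Z \<in> Rep P" "q \<in> Hom P N Z"
      and q: "\<And>x v. x \<in> P \<Longrightarrow> v \<in> sp N x \<Longrightarrow> q x v = 0 \<longleftrightarrow> v \<in> g x ` sp M x"
    show ?thesis
      by (rule epi_surj_mor[OF assms subset_refl Z q])
  qed
qed

text \<open>The sums at different points are chosen independently, so a structure map has to project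
  to each summand, apply the map there, and include again.\<close>

lemma direct_sum_exists:
  assumes "set Ms \<subseteq> Rep P" "\<And>M x. M \<in> set Ms \<Longrightarrow> x \<in> P \<Longrightarrow> fd (sp M x)"
  obtains S where "S \<in> Rep P" "direct_sum P Ms S"
proof -
  let ?k = "length Ms"
  have M: "Ms ! j \<in> Rep P" if "j < ?k" for j using assms(1) that by auto
  define R where "R x S \<iota> \<pi> \<longleftrightarrow>
      subspace S \<and> (\<forall>j<?k. lin_on (sp (Ms ! j) x) S (\<iota> j) \<and> lin_on S (sp (Ms ! j) x) (\<pi> j)) \<and>
      (\<forall>j<?k. \<forall>i<?k. \<forall>v\<in>sp (Ms ! j) x. \<pi> i (\<iota> j v) = (if i = j then v else 0)) \<and>
      (\<forall>s\<in>S. (\<Sum>j<?k. \<iota> j (\<pi> j s)) = s)" for x S \<iota> \<pi>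
  have "\<exists>S \<iota> \<pi>. R x S \<iota> \<pi>" if "x \<in> P" for x
    unfolding R_def
    by (rule direct_sum_spaces) (use M Rep_subspace assms(2) that in auto)
  then obtain S0 \<iota> \<pi> where "\<And>x. x \<in> P \<Longrightarrow> R x (S0 x) (\<iota> x) (\<pi> x)"
    by metis
  then have S0: "\<And>x. x \<in> P \<Longrightarrow> subspace (S0 x)"
      and i: "\<And>x j. x \<in> P \<Longrightarrow> j < ?k \<Longrightarrow> lin_on (sp (Ms ! j) x) (S0 x) (\<iota> x j)"
      and p: "\<And>x j. x \<in> P \<Longrightarrow> j < ?k \<Longrightarrow> lin_on (S0 x) (sp (Ms ! j) x) (\<pi> x j)"
      and pi: "\<And>x j i v. x \<in> P \<Longrightarrow> j < ?k \<Longrightarrow> i < ?k \<Longrightarrow> v \<in> sp (Ms ! j) x \<Longrightarrow>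
        \<pi> x i (\<iota> x j v) = (if i = j then v else 0)"
      and ip: "\<And>x s. x \<in> P \<Longrightarrow> s \<in> S0 x \<Longrightarrow> (\<Sum>j<?k. \<iota> x j (\<pi> x j s)) = s"
    unfolding R_def by simp_all
  define S where "S = \<lparr>sp = S0, mp = (\<lambda>x y v. \<Sum>j<?k. \<iota> y j (mp (Ms ! j) x y (\<pi> x j v)))\<rparr>"
  have Ss: "sp S x = S0 x" "mp S x y v = (\<Sum>j<?k. \<iota> y j (mp (Ms ! j) x y (\<pi> x j v)))" for x y v
    unfolding S_def by simp_all
  have comp: "lin_on (S0 x) (S0 y) (\<lambda>v. \<iota> y j (mp (Ms ! j) x y (\<pi> x j v)))"
    if "x \<in> P" "y \<in> P" "x \<le> y" "j < ?k" for x y j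
    by (rule lin_on_comp[OF lin_on_comp[OF p Rep_lin[OF M]] i]) (use that in auto)
  \<comment> \<open>The projections commute with the structure maps of \<open>S\<close>;
    functoriality of \<open>S\<close> is checked one summand at a time through this
    identity.\<close>
  have pS: "\<pi> y i (mp S x y v) = mp (Ms ! i) x y (\<pi> x i v)"
    if "x \<in> P" "y \<in> P" "x \<le> y" "i < ?k" "v \<in> S0 x" for x y i v
  proof -
    have "\<pi> y i (mp S x y v) = (\<Sum>j<?k. \<pi> y i (\<iota> y j (mp (Ms ! j) x y (\<pi> x j v))))"
      unfolding Ss
      by (rule lin_on_sum[OF p S0]) (use that comp lin_on_mem in blast)+
    also have "\<dots> = (\<Sum>j<?k. if j = i then mp (Ms ! i) x y (\<pi> x i v) else 0)"
    proof (rule sum.cong[OF refl])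
      fix j assume "j \<in> {..<?k}"
      then have "mp (Ms ! j) x y (\<pi> x j v) \<in> sp (Ms ! j) y"
        using Rep_mem[OF M that(1-3)] lin_on_mem[OF p] that by auto
      then show "\<pi> y i (\<iota> y j (mp (Ms ! j) x y (\<pi> x j v))) =
          (if j = i then mp (Ms ! i) x y (\<pi> x i v) else 0)"
        using pi[OF that(2)] that(4) \<open>j \<in> {..<?k}\<close> by auto
    qed
    finally show ?thesis using that(4) by simp
  qed
  have "S \<in> Rep P"
    unfolding Rep_def
  proof (intro CollectI conjI ballI impI)
    fix x assume x: "x \<in> P"
    show "subspace (sp S x)" using S0[OF x] Ss by simp
    {
      fix y assume y: "y \<in> P" "x \<le> y"
      show lin: "lin_on (sp S x) (sp S y) (mp S x y)"
        unfolding lin_on_def Ss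
        using lin_on_mem[OF comp[OF x y]] lin_on_add[OF comp[OF x y]] lin_on_scale[OF comp[OF x y]] S0[OF y(1)]
        by (auto simp: image_subset_iff sum.distrib scale_sum_right intro!: subspace_sum)
      fix z v assume z: "z \<in> P" "y \<le> z" "v \<in> sp S x"
      have "mp S y z (mp S x y v) = (\<Sum>j<?k. \<iota> z j (mp (Ms ! j) y z (\<pi> y j (mp S x y v))))"
        by (rule Ss(2))
      also have "\<dots> = (\<Sum>j<?k. \<iota> z j (mp (Ms ! j) x z (\<pi> x j v)))"
      proof (rule sum.cong[OF refl])
        fix j assume j: "j \<in> {..<?k}"
        then have "\<pi> x j v \<in> sp (Ms ! j) x" using lin_on_mem[OF p[OF x]] z(3) Ss by auto
        then show "\<iota> z j (mp (Ms ! j) y z (\<pi> y j (mp S x y v))) = \<iota> z j (mp (Ms ! j) x z (\<pi> x j v))"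
          using pS[OF x y, of j v] j z Rep_trans[OF M x y(1) z(1) y(2) z(2)] Ss by auto
      qed
      finally show "mp S y z (mp S x y v) = mp S x z v" by (simp add: Ss)
    }
    fix v assume v: "v \<in> sp S x"
    have "mp S x x v = (\<Sum>j<?k. \<iota> x j (\<pi> x j v))"
      unfolding Ss
    proof (rule sum.cong[OF refl])
      fix j assume "j \<in> {..<?k}"
      then show "\<iota> x j (mp (Ms ! j) x x (\<pi> x j v)) = \<iota> x j (\<pi> x j v)"
        using Rep_refl[OF M x] lin_on_mem[OF p[OF x]] v Ss by auto
    qed
    then show "mp S x x v = v" using ip[OF x] v Ss by simp
  qed
  moreover have "direct_sum P Ms S"
    unfolding direct_sum_def
  proof (rule exI[of _ "\<lambda>j x. \<iota> x j"], rule exI[of _ "\<lambda>j x. \<pi> x j"], intro conjI allI impI)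
    fix j assume j: "j < ?k"
    show "(\<lambda>x. \<iota> x j) \<in> Hom P (Ms ! j) S"
    proof (rule HomI)
      fix x y v assume xy: "x \<in> P" "y \<in> P" "x \<le> y" and v: "v \<in> sp (Ms ! j) x"
      have "mp S x y (\<iota> x j v) = (\<Sum>i<?k. if i = j then \<iota> y j (mp (Ms ! j) x y v) else 0)"
        unfolding Ss
      proof (rule sum.cong[OF refl])
        fix i assume "i \<in> {..<?k}"
        then have "i < ?k" by simp
        then have "\<iota> y i (mp (Ms ! i) x y 0) = 0"
          using lin_on_zero[OF Rep_lin[OF M xy] Rep_subspace[OF M xy(1)]]
            lin_on_zero[OF i[OF xy(2)] Rep_subspace[OF M xy(2)]] by simp
        then show "\<iota> y i (mp (Ms ! i) x y (\<pi> x i (\<iota> x j v))) =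
            (if i = j then \<iota> y j (mp (Ms ! j) x y v) else 0)"
          using pi[OF xy(1) j \<open>i < ?k\<close> v] by auto
      qed
      then show "\<iota> y j (mp (Ms ! j) x y v) = mp S x y (\<iota> x j v)"
        using j by simp
    qed (use i j Ss in auto)
    show "(\<lambda>x. \<pi> x j) \<in> Hom P S (Ms ! j)"
      by (rule HomI) (use p j Ss(1) pS in auto)
    fix i assume "i < ?k"
    then show "mor_eq P (Ms ! j) (comp_mor (\<lambda>x. \<pi> x i) (\<lambda>x. \<iota> x j)) (if j = i then id_mor else zero_mor)"
      using pi j by (auto simp: mor_eq_def)
  next
    show "mor_eq P S (\<lambda>x v. \<Sum>j<?k. \<iota> x j (\<pi> x j v)) id_mor"
      using ip Ss by (auto simp: mor_eq_def)
  qed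
  ultimately show ?thesis using that by blast
qed

text \<open>The complement is the kernel of \<open>a\<close>, with projection
  \<open>id - b \<circ> a\<close>; hence the requirement that this kernel belong to
  \<open>C\<close>.\<close>

lemma retract_direct_summand:
  assumes "C \<subseteq> Rep P" "A \<in> C" "S \<in> C" "b \<in> Hom P A S" "a \<in> Hom P S A"
    "mor_eq P A (comp_mor a b) id_mor" "kernel_rep S a \<in> C"
  shows "direct_summand P C A S"
proof -
  have S: "S \<in> Rep P" "A \<in> Rep P" using assms by auto
  define r where "r = (\<lambda>x v. v - b x (a x v))"
  have "r \<in> Hom P S S"
    using Hom_diff[OF Hom_id Hom_comp[OF assms(5,4)] S(1)] by (simp add: r_def id_mor_def comp_mor_def)
  moreover have ar: "a x (r x v) = 0" if "x \<in> P" "v \<in> sp S x" for x v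
    unfolding r_def
    using lin_on_diff[OF Hom_lin[OF assms(5)] Rep_subspace[OF S(1)]] that mor_eqD[OF assms(6)]
      Hom_mem[OF assms(5)] Hom_mem[OF assms(4)] by auto
  ultimately have r: "r \<in> Hom P S (kernel_rep S a)"
    by (intro kernel_rep_lift) (auto simp: mor_eq_def)
  have b0: "b x 0 = 0" if "x \<in> P" for x
    using Hom_vanish[OF assms(4) S(2) that] .
  have "direct_sum P [A, kernel_rep S a] S"
    by (rule direct_sum_pairI[OF assms(4,5) kernel_rep_incl r assms(6)])
      (use mor_eqD[OF assms(6)] b0 in \<open>auto simp: mor_eq_def r_def\<close>)
  then show ?thesis
    unfolding direct_summand_def using assms by blast
qed


subsection \<open>Principal representations\<close>

text \<open>This has to be the same choice term as in \<open>principal\<close>, so that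
  \<open>e0\<close> spans the nonzero spaces there.\<close>

abbreviation e0 :: 'b where
  "e0 \<equiv> (SOME e. e \<noteq> 0)"

lemma e0_nonzero: "e0 \<noteq> 0"
proof -
  have "\<exists>e::'b. e \<noteq> 0"
  proof (rule ccontr)
    assume "\<not> (\<exists>e::'b. e \<noteq> 0)"
    then have "span {} = (UNIV :: 'b set)" by auto
    then show False using infinite_dimensional by blast
  qed
  then show ?thesis by (rule someI_ex)
qed

lemma principal_sp: "sp (principal x) y = (if x \<le> y then span {e0} else {0})"
  unfolding principal_def by simp

lemma principal_mp [simp]: "mp (principal x) y z v = v"
  unfolding principal_def by simp

lemma principal_cases:
  assumes "u \<in> sp (principal x) y"
  obtains c where "x \<le> y" "u = c *s e0" | "u = 0"
  using assms unfolding principal_sp span_singleton by (auto split: if_splits)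

lemma e0_principal: "x \<le> y \<Longrightarrow> e0 \<in> sp (principal x) y"
  by (simp add: principal_sp span_base)

lemma principal_Rep: "principal x \<in> Rep P"
  unfolding Rep_def
proof (intro CollectI conjI ballI impI)
  fix y
  show "subspace (sp (principal x) y)"
    by (simp add: principal_sp subspace_single_0)
  fix z assume "y \<le> z"
  then have "sp (principal x) y \<subseteq> sp (principal x) z"
    using order_trans[of x y z] by (auto simp: principal_sp span_zero)
  then show "lin_on (sp (principal x) y) (sp (principal x) z) (mp (principal x) y z)"
    unfolding lin_on_def by auto
qed auto

lemma principal_fd: "fd (sp (principal x) y)"
  by (auto simp: principal_sp fd_zero fd_span)

lemma principal_hom_val:
  assumes "f \<in> Hom P (principal x) M" "x \<in> P" "y \<in> P" "x \<le> y"
  shows "f y (c *s e0) = c *s mp M x y (f x e0)"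
  using lin_on_scale[OF Hom_lin[OF assms(1,3)] e0_principal[OF assms(4)], of c]
    Hom_nat[OF assms(1-4) e0_principal[OF order_refl]] by simp

lemma principal_hom_eq:
  assumes "f \<in> Hom P (principal x) M" "g \<in> Hom P (principal x) M" "x \<in> P" "f x e0 = g x e0"
  shows "mor_eq P (principal x) f g"
proof (rule mor_eqI)
  fix y u assume y: "y \<in> P" and "u \<in> sp (principal x) y"
  from this(2) show "f y u = g y u"
    using principal_hom_val[OF assms(1,3) y] principal_hom_val[OF assms(2,3) y] assms(4)
      Hom_vanish[OF assms(1) principal_Rep y] Hom_vanish[OF assms(2) principal_Rep y]
    by (cases rule: principal_cases) auto
qed

text \<open>The existence half of the Yoneda lemma; the uniqueness half is
  \<open>principal_hom_eq\<close>.\<close>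

lemma principal_hom:
  assumes "M \<in> Rep P" "x \<in> P" "v \<in> sp M x"
  obtains f where "f \<in> Hom P (principal x) M" "f x e0 = v"
proof -
  \<comment> \<open>\<open>c u\<close> is the coordinate of \<open>u\<close> along
    \<open>e0\<close>, well defined on multiples of \<open>e0\<close> because \<open>e0\<close> is
    nonzero.\<close>
  define c where "c u = (THE k. u = k *s e0)" for u
  have c: "c (k *s e0) = k" for k
    unfolding c_def using e0_nonzero by (intro the_equality) auto
  define f where "f y u = (if x \<le> y then c u *s mp M x y v else 0)" for y u
  have "f \<in> Hom P (principal x) M"
  proof (rule HomI)
    fix y assume y: "y \<in> P"
    show "lin_on (sp (principal x) y) (sp M y) (f y)"
    proof (cases "x \<le> y")
      case True
      have "f y (k *s e0) = k *s mp M x y v" for k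
        using True c unfolding f_def by simp
      then show ?thesis
        using True Rep_mem[OF assms(1,2) y True assms(3)] subspace_scale[OF Rep_subspace[OF assms(1) y]]
        unfolding lin_on_def principal_sp span_singleton
        by (auto simp flip: scale_left_distrib)
    next
      case False
      then show ?thesis
        using subspace_0[OF Rep_subspace[OF assms(1) y]] unfolding lin_on_def principal_sp f_def by auto
    qed
  next
    fix y z u assume yz: "y \<in> P" "z \<in> P" "y \<le> z" and u: "u \<in> sp (principal x) y"
    show "f z (mp (principal x) y z u) = mp M y z (f y u)"
    proof (cases "x \<le> y")
      case True
      then show ?thesis
        using order_trans[OF True yz(3)] Rep_trans[OF assms(1,2) yz(1,2) True yz(3) assms(3)]
          lin_on_scale[OF Rep_lin[OF assms(1) yz] Rep_mem[OF assms(1,2) yz(1) True assms(3)]]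
        by (simp add: f_def)
    next
      case False
      then have "u = 0" using u by (simp add: principal_sp)
      moreover have "c 0 = 0" using c[of 0] by simp
      ultimately show ?thesis
        using False lin_on_zero[OF Rep_lin[OF assms(1) yz] Rep_subspace[OF assms(1) yz(1)]]
        by (simp add: f_def)
    qed
  qed
  moreover have "f x e0 = v"
    using c[of 1] Rep_refl[OF assms] by (simp add: f_def)
  ultimately show ?thesis using that by blast
qed

lemma principal_lift:
  assumes "g \<in> Hom P M N" "M \<in> Rep P" "surj_mor P M g N" "x \<in> P"
  shows "Hom_surj P (principal x) M g N"
  unfolding Hom_surj_def
proof
  fix h assume h: "h \<in> Hom P (principal x) N"
  obtain v where v: "v \<in> sp M x" "g x v = h x e0"
    using surj_morE[OF assms(3,4) Hom_mem[OF h assms(4) e0_principal]] by blast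
  obtain k where k: "k \<in> Hom P (principal x) M" "k x e0 = v"
    using principal_hom[OF assms(2,4) v(1)] .
  have "mor_eq P (principal x) (comp_mor g k) h"
    by (rule principal_hom_eq[OF Hom_comp[OF k(1) assms(1)] h assms(4)]) (simp add: k v)
  then show "\<exists>k\<in>Hom P (principal x) M. mor_eq P (principal x) (comp_mor g k) h"
    using k(1) by blast
qed

text \<open>By Yoneda, lifting a morphism from \<open>principal x\<close> amounts to lifting an
  element at \<open>x\<close>. A class containing all principal representations therefore turns
  relative lifting into surjectivity.\<close>

lemma surj_mor_principal:
  assumes "g \<in> Hom P M N" "N \<in> Rep P" "\<And>x. x \<in> P \<Longrightarrow> Hom_surj P (principal x) M g N"
  shows "surj_mor P M g N"
  unfolding surj_mor_def
proof (intro ballI subsetI)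
  fix x w assume x: "x \<in> P" and w: "w \<in> sp N x"
  obtain f where f: "f \<in> Hom P (principal x) N" "f x e0 = w"
    using principal_hom[OF assms(2) x w] .
  then obtain k where k: "k \<in> Hom P (principal x) M" "mor_eq P (principal x) (comp_mor g k) f"
    using assms(3)[OF x] unfolding Hom_surj_def by blast
  then have "g x (k x e0) = w"
    using mor_eqD[OF k(2) x e0_principal[OF order_refl]] f by simp
  then show "w \<in> g x ` sp M x"
    using Hom_mem[OF k(1) x e0_principal[OF order_refl]] by blast
qed

lemma Hom_surj_retract:
  assumes "retract_of P X U" "U \<in> Rep P" "M \<in> Rep P" "g \<in> Hom P M N"
    and "\<And>A. A \<in> X \<Longrightarrow> Hom_surj P A M g N"
  shows "Hom_surj P U M g N"
  unfolding Hom_surj_def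
proof
  fix h assume h: "h \<in> Hom P U N"
  show "\<exists>k\<in>Hom P U M. mor_eq P U (comp_mor g k) h"
  proof (rule gen_lift[OF retract_of_gen[OF assms(1) h assms(2)] assms(4,3)])
    fix A b assume "(A, b) \<in> {(A, comp_mor h b) | A b. (A, b) \<in> into P X U}"
    then have "A \<in> X" "b \<in> Hom P A N"
      using Hom_comp[OF _ h] unfolding into_def by auto
    then show "\<exists>k\<in>Hom P A M. mor_eq P A (comp_mor g k) b"
      using assms(5) unfolding Hom_surj_def by blast
  qed
qed

text \<open>Surjectivity of epimorphisms is a hypothesis so that the lemma serves both
  \<open>Rep P\<close> and \<open>fp_rep P\<close>.\<close>

lemma proj_principals:
  assumes "retract_of P (principal ` D) U" "D \<subseteq> P" "U \<in> C" "C \<subseteq> Rep P"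
    and "\<And>M g N. epi P C M g N \<Longrightarrow> surj_mor P M g N"
  shows "U \<in> proj P C"
  unfolding proj_def
proof (intro CollectI conjI allI impI assms(3))
  fix M g N assume epi: "epi P C M g N"
  then have *: "M \<in> Rep P" "g \<in> Hom P M N"
    using assms(4) unfolding epi_def by auto
  show "Hom_surj P U M g N"
  proof (rule Hom_surj_retract[OF assms(1) _ *])
    show "U \<in> Rep P" using assms(3,4) by blast
    show "Hom_surj P A M g N" if "A \<in> principal ` D" for A
      using that principal_lift[OF *(2,1) assms(5)[OF epi]] assms(2) by blast
  qed
qed


subsection \<open>Generators and covers\<close>

definition generates :: "'p::order set \<Rightarrow> ('p, 'b) prep \<Rightarrow> ('p \<times> 'b) set \<Rightarrow> bool" where
  "generates P M G \<longleftrightarrow> (\<forall>(x, v)\<in>G. x \<in> P \<and> v \<in> sp M x) \<and>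
     (\<forall>y\<in>P. sp M y = span {mp M x y v | x v. (x, v) \<in> G \<and> x \<le> y})"

lemma fin_gen_generates: "fin_gen P M \<longleftrightarrow> (\<exists>G. finite G \<and> generates P M G)"
  unfolding fin_gen_def generates_def ..

lemma generates_mem: "generates P M G \<Longrightarrow> (x, v) \<in> G \<Longrightarrow> x \<in> P \<and> v \<in> sp M x"
  unfolding generates_def by blast

lemma generates_span:
  "generates P M G \<Longrightarrow> y \<in> P \<Longrightarrow> sp M y = span {mp M x y v | x v. (x, v) \<in> G \<and> x \<le> y}"
  unfolding generates_def by blast

lemma generatesI:
  assumes "M \<in> Rep P" "\<And>x v. (x, v) \<in> G \<Longrightarrow> x \<in> P \<and> v \<in> sp M x"
    and "\<And>y v. y \<in> P \<Longrightarrow> v \<in> sp M y \<Longrightarrow> v \<in> span {mp M x y v | x v. (x, v) \<in> G \<and> x \<le> y}"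
  shows "generates P M G"
proof -
  have "span {mp M x y v | x v. (x, v) \<in> G \<and> x \<le> y} \<subseteq> sp M y" if y: "y \<in> P" for y
    using assms(2) Rep_mem[OF assms(1) _ y] by (intro span_minimal Rep_subspace[OF assms(1) y]) auto
  then show ?thesis
    unfolding generates_def using assms(2,3) by auto
qed

text \<open>Fixes the inclusions and projections of a finite sum of principal representations. The
  points form a list because one point may occur several times.\<close>

definition psum_data :: "'p::order set \<Rightarrow> 'p list \<Rightarrow> ('p, 'b) prep \<Rightarrow>
    (nat \<Rightarrow> ('p, 'b) mor) \<Rightarrow> (nat \<Rightarrow> ('p, 'b) mor) \<Rightarrow> bool" where
  "psum_data P xs U \<iota> \<pi> \<longleftrightarrow> U \<in> Rep P \<and> set xs \<subseteq> P \<and>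
     (\<forall>j<length xs. \<iota> j \<in> Hom P (principal (xs ! j)) U \<and> \<pi> j \<in> Hom P U (principal (xs ! j))) \<and>
     (\<forall>j<length xs. \<forall>k<length xs. mor_eq P (principal (xs ! j)) (comp_mor (\<pi> k) (\<iota> j))
       (if j = k then id_mor else zero_mor)) \<and>
     mor_eq P U (\<lambda>x v. \<Sum>j<length xs. \<iota> j x (\<pi> j x v)) id_mor"

lemma psum_exists:
  assumes "set xs \<subseteq> P"
  obtains U \<iota> \<pi> where "psum_data P xs U \<iota> \<pi>"
proof -
  obtain U where U: "U \<in> Rep P" "direct_sum P (map principal xs) U"
    by (rule direct_sum_exists[of "map principal xs" P]) (auto simp: principal_Rep principal_fd)
  then obtain \<iota> \<pi> where
    "\<forall>j<length xs. \<iota> j \<in> Hom P (map principal xs ! j) U \<and> \<pi> j \<in> Hom P U (map principal xs ! j)"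
    "\<forall>j<length xs. \<forall>k<length xs. mor_eq P (map principal xs ! j) (comp_mor (\<pi> k) (\<iota> j))
       (if j = k then id_mor else zero_mor)"
    "mor_eq P U (\<lambda>x v. \<Sum>j<length xs. \<iota> j x (\<pi> j x v)) id_mor"
    unfolding direct_sum_def by auto
  then have "psum_data P xs U \<iota> \<pi>"
    unfolding psum_data_def using U(1) assms by simp
  then show ?thesis using that by blast
qed

lemma psum_direct_sum: "psum_data P xs U \<iota> \<pi> \<Longrightarrow> direct_sum P (map principal xs) U"
  unfolding psum_data_def direct_sum_def by (intro exI[of _ \<iota>] exI[of _ \<pi>]) simp

lemma psum_retract: "psum_data P xs U \<iota> \<pi> \<Longrightarrow> retract_of P (principal ` set xs) U"
  by (rule direct_sum_retract_of[OF psum_direct_sum]) auto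

text \<open>The elements \<open>\<iota> j (xs ! j) e0\<close> act as free generators of the sum;
  only those located at or below \<open>y\<close> contribute at \<open>y\<close>.\<close>

lemma psum_expand:
  assumes "psum_data P xs U \<iota> \<pi>" "y \<in> P" "u \<in> sp U y"
  obtains c where
    "u = (\<Sum>j | j < length xs \<and> xs ! j \<le> y. c j *s mp U (xs ! j) y (\<iota> j (xs ! j) e0))"
proof -
  have U: "U \<in> Rep P" "set xs \<subseteq> P"
    and \<iota>: "\<And>j. j < length xs \<Longrightarrow> \<iota> j \<in> Hom P (principal (xs ! j)) U"
    and \<pi>: "\<And>j. j < length xs \<Longrightarrow> \<pi> j \<in> Hom P U (principal (xs ! j))"
    and s: "mor_eq P U (\<lambda>x v. \<Sum>j<length xs. \<iota> j x (\<pi> j x v)) id_mor"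
    using assms(1) unfolding psum_data_def by auto
  have "\<exists>c. \<iota> j y (\<pi> j y u) = (if xs ! j \<le> y then c *s mp U (xs ! j) y (\<iota> j (xs ! j) e0) else 0)"
    if j: "j < length xs" for j
  proof -
    have x: "xs ! j \<in> P" using U(2) j by auto
    from Hom_mem[OF \<pi>[OF j] assms(2,3)] show ?thesis
    proof (cases rule: principal_cases)
      case (1 c)
      then show ?thesis
        using principal_hom_val[OF \<iota>[OF j] x assms(2) 1(1), of c] by auto
    next
      case 2
      then show ?thesis
        using Hom_vanish[OF \<iota>[OF j] principal_Rep assms(2)] by (intro exI[of _ 0]) auto
    qed
  qed
  then obtain c where c: "\<And>j. j < length xs \<Longrightarrow> \<iota> j y (\<pi> j y u) =
      (if xs ! j \<le> y then c j *s mp U (xs ! j) y (\<iota> j (xs ! j) e0) else 0)"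
    by metis
  have "u = (\<Sum>j<length xs. \<iota> j y (\<pi> j y u))"
    using mor_eqD[OF s assms(2,3)] by simp
  also have "\<dots> = (\<Sum>j<length xs. if xs ! j \<le> y then c j *s mp U (xs ! j) y (\<iota> j (xs ! j) e0) else 0)"
    using c by (intro sum.cong) auto
  also have "\<dots> = (\<Sum>j | j < length xs \<and> xs ! j \<le> y. c j *s mp U (xs ! j) y (\<iota> j (xs ! j) e0))"
    by (subst sum.inter_filter[symmetric]) (auto intro!: sum.cong simp: lessThan_def)
  finally show ?thesis using that by blast
qed

lemma psum_mem:
  assumes "psum_data P xs U \<iota> \<pi>" "j < length xs"
  shows "xs ! j \<in> P" "\<iota> j (xs ! j) e0 \<in> sp U (xs ! j)"
proof -
  show x: "xs ! j \<in> P" using assms unfolding psum_data_def by auto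
  show "\<iota> j (xs ! j) e0 \<in> sp U (xs ! j)"
    using Hom_mem[OF _ x e0_principal[OF order_refl]] assms unfolding psum_data_def by blast
qed

lemma psum_fin_gen:
  assumes "psum_data P xs U \<iota> \<pi>"
  shows "fin_gen P U"
  unfolding fin_gen_generates
proof (intro exI conjI)
  let ?G = "(\<lambda>j. (xs ! j, \<iota> j (xs ! j) e0)) ` {..<length xs}"
  show "finite ?G" by simp
  show "generates P U ?G"
  proof (rule generatesI)
    show "U \<in> Rep P" using assms unfolding psum_data_def by blast
    show "x \<in> P \<and> v \<in> sp U x" if "(x, v) \<in> ?G" for x v
      using that psum_mem[OF assms] by auto
    fix y u assume "y \<in> P" "u \<in> sp U y"
    then obtain c where
      u: "u = (\<Sum>j | j < length xs \<and> xs ! j \<le> y. c j *s mp U (xs ! j) y (\<iota> j (xs ! j) e0))"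
      using psum_expand[OF assms] by blast
    show "u \<in> span {mp U x y v | x v. (x, v) \<in> ?G \<and> x \<le> y}"
      unfolding u by (intro span_sum span_scale span_base) auto
  qed
qed

lemma psum_hom:
  assumes "psum_data P xs U \<iota> \<pi>" "M \<in> Rep P"
    and "\<And>j. j < length xs \<Longrightarrow> v j \<in> sp M (xs ! j)"
  obtains g where "g \<in> Hom P U M" "\<And>j. j < length xs \<Longrightarrow> g (xs ! j) (\<iota> j (xs ! j) e0) = v j"
proof -
  have \<pi>: "\<And>j. j < length xs \<Longrightarrow> \<pi> j \<in> Hom P U (principal (xs ! j))"
    and pi: "\<And>j k. j < length xs \<Longrightarrow> k < length xs \<Longrightarrow>
      mor_eq P (principal (xs ! j)) (comp_mor (\<pi> k) (\<iota> j)) (if j = k then id_mor else zero_mor)"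
    using assms(1) unfolding psum_data_def by auto
  have "\<exists>f. f \<in> Hom P (principal (xs ! j)) M \<and> f (xs ! j) e0 = v j" if "j < length xs" for j
    using principal_hom[OF assms(2) psum_mem(1)[OF assms(1) that] assms(3)[OF that]] by metis
  then obtain f where f: "\<And>j. j < length xs \<Longrightarrow> f j \<in> Hom P (principal (xs ! j)) M"
      "\<And>j. j < length xs \<Longrightarrow> f j (xs ! j) e0 = v j"
    by metis
  define g where "g = (\<lambda>x u. \<Sum>j<length xs. comp_mor (f j) (\<pi> j) x u)"
  have "g \<in> Hom P U M"
    unfolding g_def by (rule Hom_sum[OF Hom_comp[OF \<pi> f(1)] assms(2)]) simp_all
  moreover have "g (xs ! i) (\<iota> i (xs ! i) e0) = v i" if i: "i < length xs" for i
  proof -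
    have "g (xs ! i) (\<iota> i (xs ! i) e0) = (\<Sum>j<length xs. if j = i then v i else 0)"
      unfolding g_def
    proof (rule sum.cong[OF refl])
      fix j assume j: "j \<in> {..<length xs}"
      have "\<pi> j (xs ! i) (\<iota> i (xs ! i) e0) = (if i = j then e0 else 0)"
        using mor_eqD[OF pi[OF i, of j] psum_mem(1)[OF assms(1) i] e0_principal[OF order_refl]] j by auto
      then show "comp_mor (f j) (\<pi> j) (xs ! i) (\<iota> i (xs ! i) e0) = (if j = i then v i else 0)"
        using f(2)[OF i] Hom_vanish[OF f(1) principal_Rep psum_mem(1)[OF assms(1) i]] j by auto
    qed
    then show ?thesis using i by simp
  qed
  ultimately show ?thesis using that by blast
qed

text \<open>The values on the generators are kept in the conclusion because minimality of the cover
  is judged by them.\<close>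

lemma psum_cover:
  assumes "M \<in> Rep P" "generates P M (set gs)"
    and "psum_data P (map fst gs) U \<iota> \<pi>"
  obtains g where "g \<in> Hom P U M" "surj_mor P U g M"
    "\<And>j. j < length gs \<Longrightarrow> g (fst (gs ! j)) (\<iota> j (fst (gs ! j)) e0) = snd (gs ! j)"
proof -
  have gs: "fst (gs ! j) \<in> P \<and> snd (gs ! j) \<in> sp M (fst (gs ! j))" if "j < length gs" for j
    using generates_mem[OF assms(2), of "fst (gs ! j)" "snd (gs ! j)"] nth_mem[OF that] by simp
  obtain g where "g \<in> Hom P U M"
      "\<And>j. j < length (map fst gs) \<Longrightarrow> g (map fst gs ! j) (\<iota> j (map fst gs ! j) e0) = snd (gs ! j)"
    by (rule psum_hom[OF assms(3,1), of "\<lambda>j. snd (gs ! j)"]) (use gs in auto)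
  then have g: "g \<in> Hom P U M"
      "\<And>j. j < length gs \<Longrightarrow> g (fst (gs ! j)) (\<iota> j (fst (gs ! j)) e0) = snd (gs ! j)"
    by auto
  have U: "U \<in> Rep P" using assms(3) unfolding psum_data_def by blast
  have "surj_mor P U g M"
    unfolding surj_mor_def
  proof
    fix y assume y: "y \<in> P"
    have "mp M x y v \<in> g y ` sp U y" if xv: "(x, v) \<in> set gs" "x \<le> y" for x v
    proof -
      obtain j where j: "j < length gs" "gs ! j = (x, v)" using xv(1) by (auto simp: in_set_conv_nth)
      have x: "x \<in> P" using gs[OF j(1)] j(2) by auto
      have \<iota>: "\<iota> j x e0 \<in> sp U x" using psum_mem(2)[OF assms(3), of j] j by auto
      have "g y (mp U x y (\<iota> j x e0)) = mp M x y v"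
        using Hom_nat[OF g(1) x y xv(2) \<iota>] g(2)[OF j(1)] j(2) by simp
      then show ?thesis using Rep_mem[OF U x y xv(2) \<iota>] by (metis imageI)
    qed
    then have "span {mp M x y v | x v. (x, v) \<in> set gs \<and> x \<le> y} \<subseteq> g y ` sp U y"
      by (intro span_minimal lin_on_image_subspace[OF Hom_lin[OF g(1) y] Rep_subspace[OF U y]]) auto
    then show "sp M y \<subseteq> g y ` sp U y"
      using generates_span[OF assms(2) y] by simp
  qed
  then show ?thesis using that g by blast
qed

lemma cover_exists:
  assumes "M \<in> Rep P" "generates P M G" "finite G"
  obtains xs U \<iota> \<pi> g where "set xs = fst ` G" "psum_data P xs U \<iota> \<pi>" "g \<in> Hom P U M" "surj_mor P U g M"
proof -
  obtain gs where gs: "set gs = G" using finite_list[OF assms(3)] by blast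
  have "set (map fst gs) \<subseteq> P" using assms(2) gs unfolding generates_def by auto
  then obtain U \<iota> \<pi> where U: "psum_data P (map fst gs) U \<iota> \<pi>" using psum_exists by blast
  have g: "generates P M (set gs)" using assms(2) gs by simp
  show ?thesis
    by (rule psum_cover[OF assms(1) g U]) (use that[OF _ U] gs in auto)
qed

text \<open>A finite sum of principal representations covers \<open>U\<close>, and projectivity
  splits this cover.\<close>

lemma proj_fin_gen_retract:
  assumes "U \<in> proj P (Rep P)" "fin_gen P U"
  obtains D where "finite D" "D \<subseteq> P" "retract_of P (principal ` D) U"
proof -
  have U: "U \<in> Rep P" using assms(1) unfolding proj_def by blast
  obtain G where G: "finite G" "generates P U G" using assms(2) unfolding fin_gen_generates by blast
  obtain xs V \<iota> \<pi> g where V: "psum_data P xs V \<iota> \<pi>" "g \<in> Hom P V U" "surj_mor P V g U"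
    by (rule cover_exists[OF U G(2,1)])
  have VR: "V \<in> Rep P" "set xs \<subseteq> P" using V(1) unfolding psum_data_def by auto
  then obtain s where s: "s \<in> Hom P U V" "mor_eq P U (comp_mor g s) id_mor"
    using assms(1) surj_mor_epi[OF _ U V(2,3)] Hom_id[of P U] unfolding proj_def Hom_surj_def by blast
  then have "retract_of P {V} U" using retract_ofI[of V "{V}" s P U g] V(2) by simp
  then have "retract_of P (principal ` set xs) U"
    by (rule retract_of_trans[OF _ U]) (use VR(1) psum_retract[OF V(1)] in auto)
  then show ?thesis using that VR(2) by blast
qed


subsection \<open>Birth points\<close>

text \<open>\<open>nonbirth P M x\<close> says that the top of \<open>M\<close> vanishes at \<open>x\<close>.\<close>

definition nonbirth :: "'p::order set \<Rightarrow> ('p, 'b) prep \<Rightarrow> 'p \<Rightarrow> bool" where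
  "nonbirth P M x \<longleftrightarrow> sp M x \<subseteq> span (\<Union>y\<in>{y\<in>P. y < x}. mp M y x ` sp M y)"

text \<open>By naturality, morphisms carry whatever is generated strictly below \<open>x\<close> to
  elements generated strictly below \<open>x\<close> in the target.\<close>

lemma nonbirth_image:
  assumes "M \<in> Rep P" "g \<in> Hom P M N" "x \<in> P" "nonbirth P M x" "v \<in> sp M x"
  shows "g x v \<in> span (\<Union>y\<in>{y\<in>P. y < x}. mp N y x ` sp N y)"
proof -
  let ?S = "\<Union>y\<in>{y\<in>P. y < x}. mp M y x ` sp M y"
  have "?S \<subseteq> sp M x"
    using Rep_mem[OF assms(1) _ assms(3)] by auto
  then have "g x v \<in> span (g x ` ?S)"
    using lin_on_image_span[OF Hom_lin[OF assms(2,3)] Rep_subspace[OF assms(1,3)]] assms(4,5)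
    unfolding nonbirth_def by blast
  also have "g x ` ?S \<subseteq> (\<Union>y\<in>{y\<in>P. y < x}. mp N y x ` sp N y)"
    using Hom_nat[OF assms(2) _ assms(3)] Hom_mem[OF assms(2)] by fastforce
  then have "span (g x ` ?S) \<subseteq> span (\<Union>y\<in>{y\<in>P. y < x}. mp N y x ` sp N y)"
    by (rule span_mono)
  finally show ?thesis .
qed

lemma nonbirth_surj:
  assumes "M \<in> Rep P" "g \<in> Hom P M N" "surj_mor P M g N" "x \<in> P" "nonbirth P M x"
  shows "nonbirth P N x"
  unfolding nonbirth_def
proof
  fix w assume "w \<in> sp N x"
  then obtain v where "v \<in> sp M x" "g x v = w" using surj_morE[OF assms(3,4)] by blast
  then show "w \<in> span (\<Union>y\<in>{y\<in>P. y < x}. mp N y x ` sp N y)"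
    using nonbirth_image[OF assms(1,2,4,5)] by blast
qed

lemma nonbirth_retract:
  assumes "retract_of P X M" "x \<in> P" "\<And>A. A \<in> X \<Longrightarrow> A \<in> Rep P \<and> nonbirth P A x"
  shows "nonbirth P M x"
proof -
  let ?S = "span (\<Union>y\<in>{y\<in>P. y < x}. mp M y x ` sp M y)"
  \<comment> \<open>The claim is made for every sum in \<open>gen\<close>, since the identity alone
    admits no induction.\<close>
  have "\<forall>u\<in>sp M x. f x u \<in> ?S" if "f \<in> gen P (into P X M) M" for f
    using that
  proof induction
    case zero
    show ?case by (simp add: span_zero)
  next
    case (add f A b a)
    have "b x (a x u) \<in> ?S" if "u \<in> sp M x" for u
      using nonbirth_image[of A P b M x "a x u"] add.hyps(2) assms(2,3) Hom_mem[OF add.hyps(3) assms(2) that]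
      unfolding into_def by blast
    then show ?case using add.IH by (auto intro: span_add)
  next
    case (eq f f')
    then show ?case using assms(2) by (auto simp: mor_eq_def)
  qed
  then show ?thesis
    using assms(1) unfolding retract_of_def nonbirth_def by fastforce
qed

text \<open>Strictly above \<open>y\<close> everything is the image of the value at
  \<open>y\<close>; at points not above \<open>y\<close> the representation is zero.\<close>

lemma nonbirth_principal:
  assumes "x \<noteq> y" "y \<in> P"
  shows "nonbirth P (principal y) x"
proof (cases "y \<le> x")
  case True
  then have "y \<in> {z \<in> P. z < x}" using assms by auto
  moreover have "sp (principal y) x = mp (principal y) y x ` sp (principal y) y"
    using True by (simp add: principal_sp)
  ultimately have "sp (principal y) x \<subseteq> (\<Union>z\<in>{z\<in>P. z < x}. mp (principal y) z x ` sp (principal y) z)"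
    by blast
  then show ?thesis unfolding nonbirth_def using span_superset by blast
next
  case False
  then show ?thesis unfolding nonbirth_def by (simp add: principal_sp span_zero)
qed

lemma birth_principal: "\<not> nonbirth P (principal x) x"
proof
  assume n: "nonbirth P (principal x) x"
  have "(\<Union>y\<in>{y\<in>P. y < x}. mp (principal x) y x ` sp (principal x) y) \<subseteq> {0}"
    by (auto simp: principal_sp)
  then have "span (\<Union>y\<in>{y\<in>P. y < x}. mp (principal x) y x ` sp (principal x) y) \<subseteq> {0}"
    by (rule span_minimal[OF _ subspace_single_0])
  then have "e0 = 0"
    using n e0_principal[of x x] unfolding nonbirth_def by blast
  then show False using e0_nonzero by blast
qed

end


subsection \<open>Floors\<close>

text \<open>The property of an aligned subgrid on which tameness rests; every poset also has it as a
  subset of itself.\<close>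

definition has_floors :: "'p::order set \<Rightarrow> 'p set \<Rightarrow> bool" where
  "has_floors P Q \<longleftrightarrow> Q \<subseteq> P \<and> (\<forall>x\<in>upper P Q. \<exists>z\<in>Q. z \<le> x \<and> (\<forall>y\<in>Q. y \<le> x \<longrightarrow> y \<le> z))"

text \<open>Holds for the grid, by taking hulls, and for finite posets, which serve as their own
  \<open>Q\<close>. Thus \<open>P\<close> and its subgrids share one set of lemmas on
  \<open>fp_rep\<close>.\<close>

definition floor_cofinal :: "'p::order set \<Rightarrow> bool" where
  "floor_cofinal P \<longleftrightarrow> (\<forall>D. finite D \<longrightarrow> D \<subseteq> P \<longrightarrow> (\<exists>Q. finite Q \<and> has_floors P Q \<and> D \<subseteq> Q))"

lemma floor_cofinalE:
  assumes "floor_cofinal P" "finite D" "D \<subseteq> P"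
  obtains Q where "finite Q" "has_floors P Q" "D \<subseteq> Q"
proof -
  have "\<exists>Q. finite Q \<and> has_floors P Q \<and> D \<subseteq> Q"
    using assms by (simp add: floor_cofinal_def)
  then show ?thesis using that by (elim exE conjE)
qed

lemma has_floors_subset: "has_floors P Q \<Longrightarrow> Q \<subseteq> P"
  unfolding has_floors_def by (rule conjunct1)

lemma upper_mem: "x \<in> upper P Q \<Longrightarrow> x \<in> P"
  unfolding upper_def by blast

lemma upperI: "x \<in> P \<Longrightarrow> y \<in> Q \<Longrightarrow> y \<le> x \<Longrightarrow> x \<in> upper P Q"
  unfolding upper_def by blast

lemma upper_up: "x \<in> upper P Q \<Longrightarrow> x \<le> y \<Longrightarrow> y \<in> P \<Longrightarrow> y \<in> upper P Q"
  unfolding upper_def using order_trans by blast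

lemma floor_in_props:
  assumes "has_floors P Q" "x \<in> upper P Q"
  shows "floor_in Q x \<in> Q" "floor_in Q x \<le> x" "\<And>y. y \<in> Q \<Longrightarrow> y \<le> x \<Longrightarrow> y \<le> floor_in Q x"
    "floor_in Q x \<in> P" "floor_in Q x \<in> upper P Q"
proof -
  obtain z where z: "z \<in> Q" "z \<le> x" "\<And>y. y \<in> Q \<Longrightarrow> y \<le> x \<Longrightarrow> y \<le> z"
    using assms unfolding has_floors_def by blast
  then have "floor_in Q x = z"
    unfolding floor_in_def by (intro Greatest_equality) auto
  with z show "floor_in Q x \<in> Q" "floor_in Q x \<le> x" "\<And>y. y \<in> Q \<Longrightarrow> y \<le> x \<Longrightarrow> y \<le> floor_in Q x"
    by auto
  then show "floor_in Q x \<in> P" "floor_in Q x \<in> upper P Q"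
    using assms(1) upperI[of "floor_in Q x" P "floor_in Q x" Q] unfolding has_floors_def by auto
qed

lemma floor_in_eqI:
  assumes "z \<in> Q" "z \<le> x" "\<And>y. y \<in> Q \<Longrightarrow> y \<le> x \<Longrightarrow> y \<le> z"
  shows "floor_in Q x = z"
  unfolding floor_in_def using assms by (intro Greatest_equality) auto

lemma floor_in_self: "y \<in> Q \<Longrightarrow> floor_in Q y = y"
  by (rule floor_in_eqI) auto

lemma floor_in_mono:
  assumes "has_floors P Q" "x \<in> upper P Q" "x \<le> y" "y \<in> P"
  shows "floor_in Q x \<le> floor_in Q y"
  using floor_in_props[OF assms(1,2)] floor_in_props(3)[OF assms(1) upper_up[OF assms(2-4)]] assms(3)
    order_trans by blast

lemma floor_in_between:
  assumes "has_floors P Q" "x \<in> upper P Q" "floor_in Q x \<le> y" "y \<le> x"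
  shows "floor_in Q y = floor_in Q x"
  using floor_in_props[OF assms(1,2)] assms(3,4) order_trans by (intro floor_in_eqI) blast+

context vec_universe
begin

subsection \<open>Representations extended from a finite set with floors\<close>

text \<open>For finite \<open>Q\<close> with floors these are, up to isomorphism, the extensions of
  pointwise finite-dimensional representations of \<open>Q\<close>. The condition speaks of
  \<open>M\<close> alone, so no comparison isomorphism has to be carried along.\<close>

definition tame :: "'p::order set \<Rightarrow> 'p set \<Rightarrow> ('p, 'b) prep \<Rightarrow> bool" where
  "tame P Q M \<longleftrightarrow> (\<forall>x\<in>P. fd (sp M x)) \<and> (\<forall>x\<in>P - upper P Q. sp M x = {0}) \<and>
     (\<forall>x\<in>upper P Q. bij_betw (mp M (floor_in Q x) x) (sp M (floor_in Q x)) (sp M x))"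

lemma tame_fd: "tame P Q M \<Longrightarrow> x \<in> P \<Longrightarrow> fd (sp M x)"
  unfolding tame_def by blast

lemma tame_zero: "tame P Q M \<Longrightarrow> x \<in> P \<Longrightarrow> x \<notin> upper P Q \<Longrightarrow> sp M x = {0}"
  unfolding tame_def by blast

lemma tame_surj:
  assumes "tame P Q M" "x \<in> upper P Q" "v \<in> sp M x"
  obtains u where "u \<in> sp M (floor_in Q x)" "mp M (floor_in Q x) x u = v"
proof -
  have "mp M (floor_in Q x) x ` sp M (floor_in Q x) = sp M x"
    using assms(1,2) by (simp add: tame_def bij_betw_def)
  then show ?thesis using assms(3) that by (metis imageE)
qed

lemma tame_inj:
  assumes "tame P Q M" "M \<in> Rep P" "has_floors P Q" "x \<in> upper P Q"
    and "u \<in> sp M (floor_in Q x)" "mp M (floor_in Q x) x u = 0"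
  shows "u = 0"
proof -
  have z: "floor_in Q x \<in> P" "floor_in Q x \<le> x" using floor_in_props[OF assms(3,4)] by auto
  have "mp M (floor_in Q x) x 0 = 0"
    using lin_on_zero[OF Rep_lin[OF assms(2) z(1) upper_mem[OF assms(4)] z(2)] Rep_subspace[OF assms(2) z(1)]] .
  moreover have "inj_on (mp M (floor_in Q x) x) (sp M (floor_in Q x))"
    using assms(1,4) by (simp add: tame_def bij_betw_def)
  ultimately show ?thesis
    using assms(5,6) subspace_0[OF Rep_subspace[OF assms(2) z(1)]] by (metis inj_onD)
qed

lemma tameI:
  assumes "M \<in> Rep P" "has_floors P Q" "\<And>x. x \<in> P \<Longrightarrow> fd (sp M x)"
    and "\<And>x v. x \<in> P \<Longrightarrow> x \<notin> upper P Q \<Longrightarrow> v \<in> sp M x \<Longrightarrow> v = 0"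
    and inj: "\<And>x u. x \<in> upper P Q \<Longrightarrow> u \<in> sp M (floor_in Q x) \<Longrightarrow> mp M (floor_in Q x) x u = 0 \<Longrightarrow> u = 0"
    and surj: "\<And>x v. x \<in> upper P Q \<Longrightarrow> v \<in> sp M x \<Longrightarrow> v \<in> mp M (floor_in Q x) x ` sp M (floor_in Q x)"
  shows "tame P Q M"
  unfolding tame_def
proof (intro conjI ballI)
  fix x assume "x \<in> P - upper P Q"
  then show "sp M x = {0}"
    using assms(4) subspace_0[OF Rep_subspace[OF assms(1)]] by blast
next
  fix x assume x: "x \<in> upper P Q"
  have z: "floor_in Q x \<in> P" "floor_in Q x \<le> x" "x \<in> P"
    using floor_in_props[OF assms(2) x] upper_mem[OF x] by auto
  note sub = Rep_subspace[OF assms(1) z(1)]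
  have "inj_on (mp M (floor_in Q x) x) (sp M (floor_in Q x))"
  proof (rule inj_onI)
    fix u v assume uv: "u \<in> sp M (floor_in Q x)" "v \<in> sp M (floor_in Q x)"
      "mp M (floor_in Q x) x u = mp M (floor_in Q x) x v"
    then have "mp M (floor_in Q x) x (u - v) = 0"
      using lin_on_diff[OF Rep_lin[OF assms(1) z(1,3,2)] sub] by simp
    then show "u = v"
      using inj[OF x subspace_diff[OF sub uv(1,2)]] by simp
  qed
  then show "bij_betw (mp M (floor_in Q x) x) (sp M (floor_in Q x)) (sp M x)"
    unfolding bij_betw_def using surj[OF x] Rep_mem[OF assms(1) z(1,3,2)]
    by (intro conjI equalityI subsetI) auto
qed (use assms(3) in auto)

lemma tame_retract:
  assumes "retract_of P X M" "M \<in> Rep P" "has_floors P Q"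
    and X: "\<And>A. A \<in> X \<Longrightarrow> A \<in> Rep P \<and> tame P Q A"
  shows "tame P Q M"
proof (rule tameI[OF assms(2,3)])
  \<comment> \<open>Each clause of \<open>tame\<close> is proved by induction for every sum in
    \<open>gen\<close> and then read off at the identity.\<close>
  have id: "id_mor \<in> gen P (into P X M) M"
    using assms(1) unfolding retract_of_def .
  {
    fix x assume x: "x \<in> P"
    have "fd (f x ` sp M x)" if "f \<in> gen P (into P X M) M" for f
      using that
    proof induction
      case zero
      show ?case by (rule fd_subset[OF fd_zero]) auto
    next
      case (add f A b a)
      then have A: "A \<in> Rep P" "tame P Q A" "b \<in> Hom P A M" using X unfolding into_def by auto
      have "fd (b x ` sp A x)"
        using lin_on_image_fd[OF Hom_lin[OF A(3) x] Rep_subspace[OF A(1) x] tame_fd[OF A(2) x]] .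
      then show ?case
        by (rule fd_sum[OF add.IH]) (use Hom_mem[OF add.hyps(3) x] in auto)
    next
      case (eq f f')
      then have "f x ` sp M x = f' x ` sp M x" using x by (auto simp: mor_eq_def)
      then show ?case using eq.IH by simp
    qed
    from this[OF id] show "fd (sp M x)" by simp
  }
  {
    fix x v assume x: "x \<in> P" "x \<notin> upper P Q" and v: "v \<in> sp M x"
    have "f x v = 0" if "f \<in> gen P (into P X M) M" for f
      using that
    proof induction
      case (add f A b a)
      then have A: "A \<in> Rep P" "tame P Q A" "b \<in> Hom P A M" using X unfolding into_def by auto
      have "a x v = 0"
        using Hom_mem[OF add.hyps(3) x(1) v] tame_zero[OF A(2) x] by simp
      then show ?case using add.IH Hom_vanish[OF A(3,1) x(1)] by simp
    qed (use x v in \<open>auto simp: mor_eq_def\<close>)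
    from this[OF id] show "v = 0" by simp
  }
  fix x assume x: "x \<in> upper P Q"
  let ?z = "floor_in Q x"
  have z: "?z \<in> P" "?z \<le> x" "x \<in> P"
    using floor_in_props[OF assms(3) x] upper_mem[OF x] by auto
  {
    fix u assume u: "u \<in> sp M ?z" "mp M ?z x u = 0"
    have "f ?z u = 0" if "f \<in> gen P (into P X M) M" for f
      using that
    proof induction
      case (add f A b a)
      then have A: "A \<in> Rep P" "tame P Q A" "b \<in> Hom P A M" using X unfolding into_def by auto
      have "mp A ?z x (a ?z u) = 0"
        using Hom_nat[OF add.hyps(3) z(1,3,2) u(1)] u(2) Hom_vanish[OF add.hyps(3) assms(2) z(3)] by simp
      then have "a ?z u = 0"
        using tame_inj[OF A(2,1) assms(3) x Hom_mem[OF add.hyps(3) z(1) u(1)]] by simp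
      then show ?case using add.IH Hom_vanish[OF A(3,1) z(1)] by simp
    qed (use z u in \<open>auto simp: mor_eq_def\<close>)
    from this[OF id] show "u = 0" by simp
  }
  {
    fix v assume v: "v \<in> sp M x"
    have sub: "subspace (mp M ?z x ` sp M ?z)"
      using lin_on_image_subspace[OF Rep_lin[OF assms(2) z(1,3,2)] Rep_subspace[OF assms(2) z(1)]] .
    have "f x v \<in> mp M ?z x ` sp M ?z" if "f \<in> gen P (into P X M) M" for f
      using that
    proof induction
      case zero
      show ?case using subspace_0[OF sub] by simp
    next
      case (add f A b a)
      then have A: "A \<in> Rep P" "tame P Q A" "b \<in> Hom P A M" using X unfolding into_def by auto
      obtain w where w: "w \<in> sp A ?z" "mp A ?z x w = a x v"
        by (rule tame_surj[OF A(2) x Hom_mem[OF add.hyps(3) z(3) v]])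
      have "b x (a x v) = mp M ?z x (b ?z w)"
        using Hom_nat[OF A(3) z(1,3,2) w(1)] w(2) by simp
      then have "b x (a x v) \<in> mp M ?z x ` sp M ?z"
        using Hom_mem[OF A(3) z(1) w(1)] by simp
      then show ?case using add.IH subspace_add[OF sub] by simp
    next
      case (eq f f')
      then show ?case using z v by (auto simp: mor_eq_def)
    qed
    from this[OF id] show "v \<in> mp M ?z x ` sp M ?z" by simp
  }
qed

text \<open>The floor of \<open>x\<close> in \<open>Q'\<close> lies between the floor in
  \<open>Q\<close> and \<open>x\<close>, and has the same floor in \<open>Q\<close>. The maps from
  the \<open>Q\<close>-floor to both points are bijective, hence so is the map from the
  \<open>Q'\<close>-floor to \<open>x\<close>.\<close>

lemma tame_mono:
  assumes "tame P Q M" "M \<in> Rep P" "has_floors P Q" "has_floors P Q'" "Q \<subseteq> Q'"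
  shows "tame P Q' M"
proof (rule tameI[OF assms(2,4) tame_fd[OF assms(1)]])
  fix x v assume "x \<in> P" "x \<notin> upper P Q'" "v \<in> sp M x"
  moreover have "x \<notin> upper P Q"
    using calculation assms(5) unfolding upper_def by blast
  ultimately show "v = 0" using tame_zero[OF assms(1)] by simp
next
  fix x assume x: "x \<in> upper P Q'"
  let ?z' = "floor_in Q' x" and ?z = "floor_in Q x"
  note z' = floor_in_props[OF assms(4) x]
  have "(u \<in> sp M ?z' \<longrightarrow> mp M ?z' x u = 0 \<longrightarrow> u = 0) \<and> (v \<in> sp M x \<longrightarrow> v \<in> mp M ?z' x ` sp M ?z')" for u v
  proof (cases "x \<in> upper P Q")
    case True
    note z = floor_in_props[OF assms(3) True]
    have zz: "?z \<le> ?z'" using z z'(3) assms(5) by blast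
    have fz: "floor_in Q ?z' = ?z"
      using floor_in_between[OF assms(3) True zz z'(2)] .
    have uz: "?z' \<in> upper P Q" using upperI[OF z'(4) z(1) zz] .
    note tr = Rep_trans[OF assms(2) z(4) z'(4) upper_mem[OF x] zz z'(2)]
    have "u = 0" if u: "u \<in> sp M ?z'" "mp M ?z' x u = 0"
    proof -
      obtain w where w: "w \<in> sp M ?z" "mp M ?z ?z' w = u"
        using tame_surj[OF assms(1) uz u(1)] unfolding fz .
      then have "mp M ?z x w = 0" using tr u(2) by auto
      then have "w = 0" using tame_inj[OF assms(1-3) True w(1)] by blast
      then show ?thesis
        using w(2) lin_on_zero[OF Rep_lin[OF assms(2) z(4) z'(4) zz] Rep_subspace[OF assms(2) z(4)]] by simp
    qed
    moreover have "v \<in> mp M ?z' x ` sp M ?z'" if v: "v \<in> sp M x"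
    proof -
      obtain w where w: "w \<in> sp M ?z" "mp M ?z x w = v"
        by (rule tame_surj[OF assms(1) True v])
      then have "mp M ?z' x (mp M ?z ?z' w) = v" using tr by simp
      then show ?thesis using Rep_mem[OF assms(2) z(4) z'(4) zz w(1)] by blast
    qed
    ultimately show ?thesis by blast
  next
    case False
    have "?z' \<notin> upper P Q" using False upper_up z'(2) upper_mem[OF x] by blast
    then have "sp M ?z' = {0}" "sp M x = {0}"
      using tame_zero[OF assms(1)] False z'(4) upper_mem[OF x] by auto
    then show ?thesis
      using lin_on_zero[OF Rep_lin[OF assms(2) z'(4) upper_mem[OF x] z'(2)] Rep_subspace[OF assms(2) z'(4)]]
      by auto
  qed
  then show "\<And>u. u \<in> sp M ?z' \<Longrightarrow> mp M ?z' x u = 0 \<Longrightarrow> u = 0"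
    and "\<And>v. v \<in> sp M x \<Longrightarrow> v \<in> mp M ?z' x ` sp M ?z'" by blast+
qed

lemma tame_principal:
  assumes "has_floors P Q" "y \<in> Q"
  shows "tame P Q (principal y)"
proof (rule tameI[OF principal_Rep assms(1) principal_fd])
  fix x v assume "x \<in> P" "x \<notin> upper P Q" "v \<in> sp (principal y) x"
  moreover from this have "\<not> y \<le> x" using upperI assms(2) by blast
  ultimately show "v = 0" by (simp add: principal_sp)
next
  fix x v assume x: "x \<in> upper P Q" and v: "v \<in> sp (principal y) x"
  have "y \<le> x \<Longrightarrow> y \<le> floor_in Q x" using floor_in_props(3)[OF assms(1) x assms(2)] .
  then have "v \<in> sp (principal y) (floor_in Q x)"
    using v by (auto simp: principal_sp span_zero split: if_splits)
  then show "v \<in> mp (principal y) (floor_in Q x) x ` sp (principal y) (floor_in Q x)"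
    by simp
qed simp

lemma tame_kernel:
  assumes "tame P Q M" "tame P Q N" "M \<in> Rep P" "N \<in> Rep P" "g \<in> Hom P M N" "has_floors P Q"
  shows "tame P Q (kernel_rep M g)"
proof (rule tameI[OF kernel_rep_Rep[OF assms(3-5)] assms(6)])
  show "fd (sp (kernel_rep M g) x)" if "x \<in> P" for x
    by (rule fd_subset[OF tame_fd[OF assms(1) that]]) auto
  show "v = 0" if "x \<in> P" "x \<notin> upper P Q" "v \<in> sp (kernel_rep M g) x" for x v
    using tame_zero[OF assms(1) that(1,2)] that(3) by auto
  fix x assume x: "x \<in> upper P Q"
  note z = floor_in_props[OF assms(6) x]
  show "u = 0" if "u \<in> sp (kernel_rep M g) (floor_in Q x)" "mp (kernel_rep M g) (floor_in Q x) x u = 0" for u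
    using tame_inj[OF assms(1,3,6) x] that by auto
  fix v assume v: "v \<in> sp (kernel_rep M g) x"
  then obtain w where w: "w \<in> sp M (floor_in Q x)" "mp M (floor_in Q x) x w = v"
    using tame_surj[OF assms(1) x, of v] by auto
  \<comment> \<open>The preimage \<open>w\<close> lies in the kernel: its image in \<open>N\<close>
    dies at \<open>x\<close>, and the map from the floor to \<open>x\<close> is injective for
    \<open>N\<close>.\<close>
  have "mp N (floor_in Q x) x (g (floor_in Q x) w) = 0"
    using Hom_nat[OF assms(5) z(4) upper_mem[OF x] z(2) w(1)] w(2) v by simp
  then have "g (floor_in Q x) w = 0"
    using tame_inj[OF assms(2,4,6) x Hom_mem[OF assms(5) z(4) w(1)]] by blast
  then show "v \<in> mp (kernel_rep M g) (floor_in Q x) x ` sp (kernel_rep M g) (floor_in Q x)"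
    using w by auto
qed

lemma tame_quotient:
  assumes "tame P Q M" "tame P Q N" "M \<in> Rep P" "N \<in> Rep P" "Z \<in> Rep P"
    and "g \<in> Hom P M N" "q \<in> Hom P N Z" "surj_mor P N q Z"
    and ker: "\<And>x v. x \<in> P \<Longrightarrow> v \<in> sp N x \<Longrightarrow> q x v = 0 \<longleftrightarrow> v \<in> g x ` sp M x"
    and fl: "has_floors P Q"
  shows "tame P Q Z"
proof (rule tameI[OF assms(5) fl])
  show "fd (sp Z x)" if x: "x \<in> P" for x
    by (rule fd_subset[OF lin_on_image_fd[OF Hom_lin[OF assms(7) x] Rep_subspace[OF assms(4) x]
            tame_fd[OF assms(2) x]]]) (use assms(8) x in \<open>simp add: surj_mor_def\<close>)
  show "v = 0" if x: "x \<in> P" "x \<notin> upper P Q" and v: "v \<in> sp Z x" for x v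
  proof -
    obtain w where "w \<in> sp N x" "q x w = v" by (rule surj_morE[OF assms(8) x(1) v])
    then show ?thesis using tame_zero[OF assms(2) x] Hom_vanish[OF assms(7,4) x(1)] by auto
  qed
  fix x assume x: "x \<in> upper P Q"
  let ?z = "floor_in Q x"
  note z = floor_in_props[OF fl x] and xP = upper_mem[OF x]
  {
    fix u assume u: "u \<in> sp Z ?z" "mp Z ?z x u = 0"
    obtain w where w: "w \<in> sp N ?z" "q ?z w = u" by (rule surj_morE[OF assms(8) z(4) u(1)])
    have "q x (mp N ?z x w) = 0" using Hom_nat[OF assms(7) z(4) xP z(2) w(1)] w(2) u(2) by simp
    \<comment> \<open>Diagram chase: \<open>m\<close> is pulled back to the floor by surjectivity
      for \<open>M\<close>; then \<open>w\<close> and \<open>g ?z m'\<close> agree at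
      \<open>x\<close>, hence already at the floor by injectivity for \<open>N\<close>.\<close>
    then obtain m where m: "m \<in> sp M x" "mp N ?z x w = g x m"
      using ker[OF xP Rep_mem[OF assms(4) z(4) xP z(2) w(1)]] by blast
    obtain m' where m': "m' \<in> sp M ?z" "mp M ?z x m' = m" by (rule tame_surj[OF assms(1) x m(1)])
    have gm: "g ?z m' \<in> sp N ?z" using Hom_mem[OF assms(6) z(4) m'(1)] .
    have "mp N ?z x (w - g ?z m') = 0"
      using lin_on_diff[OF Rep_lin[OF assms(4) z(4) xP z(2)] Rep_subspace[OF assms(4) z(4)] w(1) gm]
        Hom_nat[OF assms(6) z(4) xP z(2) m'(1)] m(2) m'(2) by simp
    then have "w - g ?z m' = 0"
      using tame_inj[OF assms(2,4) fl x subspace_diff[OF Rep_subspace[OF assms(4) z(4)] w(1) gm]] by blast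
    then have "w \<in> g ?z ` sp M ?z" using m'(1) by simp
    then show "u = 0" using ker[OF z(4) w(1)] w(2) by simp
  }
  fix v assume v: "v \<in> sp Z x"
  obtain w where w: "w \<in> sp N x" "q x w = v" by (rule surj_morE[OF assms(8) xP v])
  obtain w' where w': "w' \<in> sp N ?z" "mp N ?z x w' = w" by (rule tame_surj[OF assms(2) x w(1)])
  have "mp Z ?z x (q ?z w') = v"
    using Hom_nat[OF assms(7) z(4) xP z(2) w'(1)] w w' by simp
  then show "v \<in> mp Z ?z x ` sp Z ?z"
    using Hom_mem[OF assms(7) z(4) w'(1)] by blast
qed

text \<open>The pointwise cokernel is tame by \<open>tame_quotient\<close>, and the given cokernel
  is a retract of it.\<close>

lemma tame_cokernel:
  assumes "is_cokernel P (Rep P) L d M g N" "tame P Q L" "tame P Q M" "has_floors P Q"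
  shows "tame P Q N"
proof -
  have *: "L \<in> Rep P" "M \<in> Rep P" "d \<in> Hom P L M" "N \<in> Rep P"
    using assms(1) unfolding is_cokernel_def by auto
  show ?thesis
  proof (rule cokernel_exists[OF *(1-3)])
    fix Z q
    assume Z: "Z \<in> Rep P" "q \<in> Hom P M Z" "surj_mor P M q Z"
      and q: "\<And>x v. x \<in> P \<Longrightarrow> v \<in> sp M x \<Longrightarrow> q x v = 0 \<longleftrightarrow> v \<in> d x ` sp L x"
    have tZ: "tame P Q Z"
      by (rule tame_quotient[OF assms(2,3) *(1,2) Z(1) *(3) Z(2,3) q assms(4)])
    have "is_cokernel P (Rep P) L d M q Z"
      by (rule is_cokernelI[OF *(1,2) Z(1) subset_refl *(3) Z(2,3)])
        (use q Hom_mem[OF *(3)] in auto)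
    from is_cokernel_unique[OF assms(1) this] show ?thesis
      by (rule tame_retract[OF _ *(4) assms(4)]) (use Z(1) tZ in auto)
  qed
qed

text \<open>Bases at the points of \<open>Q\<close> generate, since every nonzero value is the image
  of the one at its floor.\<close>

lemma tame_generates:
  assumes "tame P Q M" "M \<in> Rep P" "has_floors P Q" "finite Q"
  obtains G where "finite G" "generates P M G" "fst ` G \<subseteq> Q"
proof -
  have QP: "Q \<subseteq> P" using assms(3) unfolding has_floors_def by blast
  have "\<exists>B. finite B \<and> B \<subseteq> sp M y \<and> span B = sp M y" if "y \<in> Q" for y
    using fd_basis[OF Rep_subspace[OF assms(2)] tame_fd[OF assms(1)]] that QP by (metis subsetD)
  then obtain B where B: "\<And>y. y \<in> Q \<Longrightarrow> finite (B y) \<and> B y \<subseteq> sp M y \<and> span (B y) = sp M y"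
    by metis
  let ?G = "Sigma Q B"
  have "finite ?G" using B assms(4) by auto
  moreover have "generates P M ?G"
  proof (rule generatesI[OF assms(2)])
    show "x \<in> P \<and> v \<in> sp M x" if "(x, v) \<in> ?G" for x v
      using that B QP by blast
    fix x v assume x: "x \<in> P" and v: "v \<in> sp M x"
    show "v \<in> span {mp M y x v | y v. (y, v) \<in> ?G \<and> y \<le> x}"
    proof (cases "x \<in> upper P Q")
      case True
      note z = floor_in_props[OF assms(3) True]
      obtain u where u: "u \<in> sp M (floor_in Q x)" "mp M (floor_in Q x) x u = v"
        by (rule tame_surj[OF assms(1) True v])
      have "mp M (floor_in Q x) x u \<in> span (mp M (floor_in Q x) x ` B (floor_in Q x))"
        using lin_on_image_span[OF Rep_lin[OF assms(2) z(4) x z(2)] Rep_subspace[OF assms(2) z(4)]]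
          B[OF z(1)] u(1) by auto
      also have "\<dots> \<subseteq> span {mp M y x v | y v. (y, v) \<in> ?G \<and> y \<le> x}"
        using z by (intro span_mono) auto
      finally show ?thesis using u(2) by simp
    next
      case False
      then show ?thesis using tame_zero[OF assms(1) x] v by (simp add: span_zero)
    qed
  qed
  moreover have "fst ` ?G \<subseteq> Q" by auto
  ultimately show ?thesis by (rule that)
qed

lemma psum_tame:
  assumes "psum_data P xs U \<iota> \<pi>" "has_floors P Q" "set xs \<subseteq> Q"
  shows "tame P Q U"
proof (rule tame_retract[OF psum_retract[OF assms(1)] _ assms(2)])
  show "U \<in> Rep P" using assms(1) unfolding psum_data_def by blast
qed (use tame_principal[OF assms(2)] principal_Rep assms(3) in auto)

lemma psum_proj_Rep:
  assumes "psum_data P xs U \<iota> \<pi>"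
  shows "U \<in> proj P (Rep P)"
  by (rule proj_principals[OF psum_retract[OF assms]])
    (use assms epi_Rep_surj_mor in \<open>auto simp: psum_data_def\<close>)

section \<open>Tameness over a finite set characterizes finite presentability\<close>

lemma presentation_is_cokernel:
  assumes "M \<in> Rep P" "U \<in> Rep P" "V \<in> Rep P" "g \<in> Hom P U M" "surj_mor P U g M"
    "d \<in> Hom P V (kernel_rep U g)" "surj_mor P V d (kernel_rep U g)"
  shows "is_cokernel P (Rep P) V d U g M"
proof (rule is_cokernelI[OF assms(3,2,1) subset_refl _ assms(4,5)])
  show "d \<in> Hom P V U"
    using Hom_comp[OF assms(6) kernel_rep_incl] by (simp add: comp_mor_def)
  show "g x (d x v) = 0" if "x \<in> P" "v \<in> sp V x" for x v
    using Hom_mem[OF assms(6) that] by simp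
  show "v \<in> d x ` sp V x" if "x \<in> P" "v \<in> sp U x" "g x v = 0" for x v
    using assms(7) that unfolding surj_mor_def by auto
qed

text \<open>A cover by principal representations at points of \<open>Q\<close> has a kernel that is
  tame over the same \<open>Q\<close>, so a second cover completes a finite presentation.\<close>

lemma tame_fp_rep:
  assumes "M \<in> Rep P" "tame P Q M" "has_floors P Q" "finite Q"
  shows "M \<in> fp_rep P"
proof -
  obtain G where G: "finite G" "generates P M G" "fst ` G \<subseteq> Q"
    by (rule tame_generates[OF assms(2,1,3,4)])
  obtain xs U \<iota> \<pi> g where U: "set xs = fst ` G" "psum_data P xs U \<iota> \<pi>" "g \<in> Hom P U M" "surj_mor P U g M"
    by (rule cover_exists[OF assms(1) G(2,1)])
  have UR: "U \<in> Rep P" using U(2) unfolding psum_data_def by blast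
  have KR: "kernel_rep U g \<in> Rep P" using kernel_rep_Rep[OF UR assms(1) U(3)] .
  have "tame P Q (kernel_rep U g)"
    by (rule tame_kernel[OF psum_tame[OF U(2) assms(3)] assms(2) UR assms(1) U(3) assms(3)])
      (use U(1) G(3) in simp)
  then obtain G' where G': "finite G'" "generates P (kernel_rep U g) G'" "fst ` G' \<subseteq> Q"
    by (rule tame_generates[OF _ KR assms(3,4)])
  obtain ys V \<iota>' \<pi>' d where V: "psum_data P ys V \<iota>' \<pi>'" "d \<in> Hom P V (kernel_rep U g)"
      "surj_mor P V d (kernel_rep U g)"
    by (rule cover_exists[OF KR G'(2,1)])
  have VR: "V \<in> Rep P" using V(1) unfolding psum_data_def by blast
  have "is_cokernel P (Rep P) V d U g M"
    by (rule presentation_is_cokernel[OF assms(1) UR VR U(3,4) V(2,3)])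
  then show ?thesis
    unfolding fp_rep_def using psum_proj_Rep[OF U(2)] psum_proj_Rep[OF V(1)] psum_fin_gen[OF U(2)]
      psum_fin_gen[OF V(1)] by blast
qed

lemma fp_rep_Rep: "fp_rep P \<subseteq> Rep P"
  unfolding fp_rep_def is_cokernel_def by blast

text \<open>Both terms of a presentation are retracts of sums of principal representations at
  finitely many points; tameness over a finite set containing these points passes to the
  cokernel.\<close>

lemma fp_rep_tame:
  assumes "floor_cofinal P" "M \<in> fp_rep P"
  obtains Q where "finite Q" "has_floors P Q" "tame P Q M"
proof -
  obtain V d U g where *: "V \<in> proj P (Rep P)" "fin_gen P V" "U \<in> proj P (Rep P)" "fin_gen P U"
      "is_cokernel P (Rep P) V d U g M"
    using assms(2) unfolding fp_rep_def by blast
  have R: "V \<in> Rep P" "U \<in> Rep P" using *(1,3) unfolding proj_def by auto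
  obtain D where D: "finite D" "D \<subseteq> P" "retract_of P (principal ` D) V"
    by (rule proj_fin_gen_retract[OF *(1,2)])
  obtain E where E: "finite E" "E \<subseteq> P" "retract_of P (principal ` E) U"
    by (rule proj_fin_gen_retract[OF *(3,4)])
  obtain Q where Q: "finite Q" "has_floors P Q" "D \<union> E \<subseteq> Q"
    by (rule floor_cofinalE[OF assms(1), of "D \<union> E"]) (use D(1,2) E(1,2) in auto)
  have "tame P Q V"
    by (rule tame_retract[OF D(3) R(1) Q(2)]) (use tame_principal[OF Q(2)] principal_Rep Q(3) in auto)
  moreover have "tame P Q U"
    by (rule tame_retract[OF E(3) R(2) Q(2)]) (use tame_principal[OF Q(2)] principal_Rep Q(3) in auto)
  ultimately have "tame P Q M"
    by (rule tame_cokernel[OF *(5) _ _ Q(2)])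
  then show ?thesis using that Q by blast
qed

lemma fp_rep_common_tame:
  assumes "floor_cofinal P" "M \<in> fp_rep P" "N \<in> fp_rep P" "finite D" "D \<subseteq> P"
  obtains Q where "finite Q" "has_floors P Q" "tame P Q M" "tame P Q N" "D \<subseteq> Q"
proof -
  have R: "M \<in> Rep P" "N \<in> Rep P" using assms(2,3) fp_rep_Rep by blast+
  obtain Q1 where Q1: "finite Q1" "has_floors P Q1" "tame P Q1 M" by (rule fp_rep_tame[OF assms(1,2)])
  obtain Q2 where Q2: "finite Q2" "has_floors P Q2" "tame P Q2 N" by (rule fp_rep_tame[OF assms(1,3)])
  have "finite (Q1 \<union> Q2 \<union> D)" "Q1 \<union> Q2 \<union> D \<subseteq> P"
    using Q1(1) Q2(1) has_floors_subset[OF Q1(2)] has_floors_subset[OF Q2(2)] assms(4,5) by auto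
  then obtain Q where Q: "finite Q" "has_floors P Q" "Q1 \<union> Q2 \<union> D \<subseteq> Q"
    by (rule floor_cofinalE[OF assms(1)])
  show ?thesis
    by (rule that[OF Q(1,2) tame_mono[OF Q1(3) R(1) Q1(2) Q(2)] tame_mono[OF Q2(3) R(2) Q2(2) Q(2)]])
      (use Q(3) in auto)
qed

section \<open>Kernels, epimorphisms, retracts and sums of finitely presentable
  representations\<close>

lemma fp_rep_kernel:
  assumes "floor_cofinal P" "M \<in> fp_rep P" "N \<in> fp_rep P" "g \<in> Hom P M N"
  shows "kernel_rep M g \<in> fp_rep P"
proof -
  have R: "M \<in> Rep P" "N \<in> Rep P" using assms(2,3) fp_rep_Rep by blast+
  obtain Q where Q: "finite Q" "has_floors P Q" "tame P Q M" "tame P Q N"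
    by (rule fp_rep_common_tame[OF assms(1-3), of "{}"]) auto
  show ?thesis
    by (rule tame_fp_rep[OF kernel_rep_Rep[OF R assms(4)] tame_kernel[OF Q(3,4) R assms(4) Q(2)] Q(2,1)])
qed

text \<open>The cokernel that tests \<open>g\<close> is tame over the same finite set as
  \<open>M\<close> and \<open>N\<close>, hence finitely presentable, so an epimorphism of
  \<open>fp_rep P\<close> already has to face it.\<close>

lemma fp_rep_epi_surj:
  assumes "floor_cofinal P" "epi P (fp_rep P) M g N"
  shows "surj_mor P M g N"
proof -
  have *: "M \<in> fp_rep P" "N \<in> fp_rep P" "g \<in> Hom P M N" using assms(2) unfolding epi_def by auto
  then have R: "M \<in> Rep P" "N \<in> Rep P" using fp_rep_Rep by blast+
  obtain Q where Q: "finite Q" "has_floors P Q" "tame P Q M" "tame P Q N"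
    by (rule fp_rep_common_tame[OF assms(1) *(1,2), of "{}"]) auto
  show ?thesis
  proof (rule cokernel_exists[OF R *(3)])
    fix Z q
    assume Z: "Z \<in> Rep P" "q \<in> Hom P N Z" "surj_mor P N q Z"
      and q: "\<And>x v. x \<in> P \<Longrightarrow> v \<in> sp N x \<Longrightarrow> q x v = 0 \<longleftrightarrow> v \<in> g x ` sp M x"
    have "Z \<in> fp_rep P"
      by (rule tame_fp_rep[OF Z(1) tame_quotient[OF Q(3,4) R Z(1) *(3) Z(2,3) q Q(2)] Q(2,1)])
    then show ?thesis
      by (rule epi_surj_mor[OF assms(2) fp_rep_Rep _ Z(2) q])
  qed
qed

lemma fp_rep_retract:
  assumes "floor_cofinal P" "retract_of P X M" "M \<in> Rep P" "X \<subseteq> fp_rep P"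
  shows "M \<in> fp_rep P"
proof -
  \<comment> \<open>Only finitely many members of \<open>X\<close> are involved in the retraction,
    so one finite set with floors can serve all of them.\<close>
  obtain G where G: "finite G" "G \<subseteq> into P X M" "id_mor \<in> gen P G M"
    using assms(2) unfolding retract_of_def by (rule gen_finite)
  have R: "A \<in> Rep P" if "A \<in> X" for A using that assms(4) fp_rep_Rep by blast
  have GX: "A \<in> X" if "A \<in> fst ` G" for A
    using that G(2) unfolding into_def by auto
  have "\<exists>Q. finite Q \<and> has_floors P Q \<and> tame P Q A" if A: "A \<in> fst ` G" for A
    by (rule fp_rep_tame[OF assms(1) subsetD[OF assms(4) GX[OF A]]]) auto
  then obtain q where q: "\<And>A. A \<in> fst ` G \<Longrightarrow> finite (q A) \<and> has_floors P (q A) \<and> tame P (q A) A"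
    by metis
  have "finite (\<Union>A\<in>fst ` G. q A)" "(\<Union>A\<in>fst ` G. q A) \<subseteq> P"
    using G(1) q has_floors_subset by auto
  then obtain Q where Q: "finite Q" "has_floors P Q" "(\<Union>A\<in>fst ` G. q A) \<subseteq> Q"
    by (rule floor_cofinalE[OF assms(1)])
  have "retract_of P (fst ` G) M"
    unfolding retract_of_def
    by (rule gen_mono[OF G(3)]) (use G(2) in \<open>force simp: into_def\<close>)
  then have "tame P Q M"
  proof (rule tame_retract[OF _ assms(3) Q(2)])
    fix A assume A: "A \<in> fst ` G"
    then have "A \<in> Rep P" using GX R by auto
    moreover have "tame P Q A"
      by (rule tame_mono[OF _ \<open>A \<in> Rep P\<close> _ Q(2), of "q A"]) (use q[OF A] Q(3) A in auto)
    ultimately show "A \<in> Rep P \<and> tame P Q A" ..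
  qed
  then show ?thesis by (rule tame_fp_rep[OF assms(3) _ Q(2,1)])
qed

lemma principal_fp_rep:
  assumes "floor_cofinal P" "x \<in> P"
  shows "principal x \<in> fp_rep P"
proof -
  obtain Q where Q: "finite Q" "has_floors P Q" "{x} \<subseteq> Q"
    by (rule floor_cofinalE[OF assms(1), of "{x}"]) (use assms(2) in auto)
  then show ?thesis by (intro tame_fp_rep[OF principal_Rep tame_principal[OF Q(2)] Q(2,1)]) auto
qed

lemma psum_fp_rep:
  assumes "floor_cofinal P" "psum_data P xs U \<iota> \<pi>"
  shows "U \<in> fp_rep P" "U \<in> proj P (fp_rep P)"
proof -
  have U: "U \<in> Rep P" "set xs \<subseteq> P" using assms(2) unfolding psum_data_def by auto
  show fp: "U \<in> fp_rep P"
    by (rule fp_rep_retract[OF assms(1) psum_retract[OF assms(2)] U(1)])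
      (use principal_fp_rep[OF assms(1)] U(2) in auto)
  show "U \<in> proj P (fp_rep P)"
    by (rule proj_principals[OF psum_retract[OF assms(2)] U(2) fp fp_rep_Rep fp_rep_epi_surj[OF assms(1)]])
qed

lemma fp_rep_direct_sum_exists:
  assumes "floor_cofinal P" "set Ms \<subseteq> fp_rep P"
  obtains S where "S \<in> fp_rep P" "direct_sum P Ms S"
proof -
  have fd: "fd (sp M x)" if M: "M \<in> set Ms" "x \<in> P" for M x
    by (rule fp_rep_tame[OF assms(1) subsetD[OF assms(2) M(1)]]) (rule tame_fd[OF _ M(2)])
  obtain S where S: "S \<in> Rep P" "direct_sum P Ms S"
    by (rule direct_sum_exists[OF subset_trans[OF assms(2) fp_rep_Rep] fd])
  have "S \<in> fp_rep P"
    by (rule fp_rep_retract[OF assms(1) direct_sum_retract_of[OF S(2) subset_refl] S(1) assms(2)])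
  then show ?thesis using that S by blast
qed


subsection \<open>Minimal projective presentations\<close>

text \<open>The expression of \<open>v\<close> at \<open>x\<close> by the other generators is pushed
  by functoriality to every point above \<open>x\<close>.\<close>

lemma generates_redundant:
  assumes "M \<in> Rep P" "generates P M G" "(x, v) \<in> G"
    and "v \<in> span {mp M x' x v' | x' v'. (x', v') \<in> G - {(x, v)} \<and> x' \<le> x}"
  shows "generates P M (G - {(x, v)})"
proof (rule generatesI[OF assms(1)])
  note xv = generates_mem[OF assms(2,3)]
  show "x' \<in> P \<and> v' \<in> sp M x'" if "(x', v') \<in> G - {(x, v)}" for x' v'
    using generates_mem[OF assms(2)] that by blast
  fix y w assume y: "y \<in> P" and w: "w \<in> sp M y"
  let ?S = "\<lambda>z. {mp M x' z v' | x' v'. (x', v') \<in> G - {(x, v)} \<and> x' \<le> z}"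
  have "mp M x' y v' \<in> span (?S y)" if x': "(x', v') \<in> G" "x' \<le> y" for x' v'
  proof (cases "(x', v') = (x, v)")
    case True
    then have xy: "x \<le> y" using x' by simp
    have "?S x \<subseteq> sp M x"
      using generates_mem[OF assms(2)] Rep_mem[OF assms(1)] xv by auto
    then have **: "mp M x y v \<in> span (mp M x y ` ?S x)"
      using lin_on_image_span[OF Rep_lin[OF assms(1) _ y xy] Rep_subspace[OF assms(1)] _ assms(4)] xv
      by simp
    have *: "mp M x y ` ?S x \<subseteq> ?S y"
    proof
      fix t assume "t \<in> mp M x y ` ?S x"
      then obtain z u where t: "t = mp M x y (mp M z x u)" "(z, u) \<in> G - {(x, v)}" "z \<le> x" by blast
      have "z \<in> P \<and> u \<in> sp M z" using generates_mem[OF assms(2), of z u] t(2) by simp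
      then have "t = mp M z y u"
        using Rep_trans[OF assms(1) _ _ y t(3) xy] xv t(1) by simp
      moreover have "z \<le> y" using t(3) xy by (rule order_trans)
      ultimately show "t \<in> ?S y" using t(2) by auto
    qed
    have "mp M x y v \<in> span (?S y)"
      using span_mono[OF *] ** by (rule subsetD)
    then show ?thesis using True by simp
  next
    case False
    then show ?thesis using x' by (intro span_base) auto
  qed
  then have "span {mp M x' y v' | x' v'. (x', v') \<in> G \<and> x' \<le> y} \<subseteq> span (?S y)"
    by (intro span_minimal subspace_span) auto
  then show "w \<in> span (?S y)"
    using w generates_span[OF assms(2) y] by auto
qed

text \<open>A generating set of least cardinality does it; the list supplies the indices for the
  cover.\<close>

lemma irredundant_generators:
  assumes "finite G" "generates P M G"
  obtains gs where "distinct gs" "generates P M (set gs)" "\<And>g. g \<in> set gs \<Longrightarrow> \<not> generates P M (set gs - {g})"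
proof -
  define R where "R k \<longleftrightarrow> (\<exists>G. finite G \<and> generates P M G \<and> card G = k)" for k
  have "R (card G)" using assms unfolding R_def by blast
  then have "R (LEAST k. R k)" by (rule LeastI)
  then obtain G' where G': "finite G'" "generates P M G'" "card G' = (LEAST k. R k)"
    unfolding R_def by blast
  obtain gs where gs: "set gs = G'" "distinct gs" using finite_distinct_list[OF G'(1)] by blast
  have "\<not> generates P M (set gs - {g})" if g: "g \<in> set gs" for g
  proof
    assume "generates P M (set gs - {g})"
    then have "R (card (G' - {g}))" using G'(1) gs(1) unfolding R_def by blast
    then have "card G' \<le> card (G' - {g})" unfolding G'(3) by (rule Least_le)
    moreover have "card (G' - {g}) < card G'"
      using G'(1) g gs(1) by (intro psubset_card_mono) auto
    ultimately show False by simp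
  qed
  then show ?thesis using that gs G'(2) by blast
qed

text \<open>A relation at \<open>x\<close> cannot involve a generator located at \<open>x\<close>
  itself: dividing by its coefficient would express it by the others and make it redundant. This
  plays the role of Nakayama's lemma.\<close>

lemma irredundant_combination:
  assumes "M \<in> Rep P" "distinct gs" "generates P M (set gs)"
    and irr: "\<And>g. g \<in> set gs \<Longrightarrow> \<not> generates P M (set gs - {g})"
    and eq: "(\<Sum>i | i < length gs \<and> fst (gs ! i) \<le> x. c i *s mp M (fst (gs ! i)) x (snd (gs ! i))) = 0"
    and k: "k < length gs" "fst (gs ! k) = x"
  shows "c k = 0"
proof (rule ccontr)
  assume ck: "c k \<noteq> 0"
  define v where "v = snd (gs ! k)"
  have gk: "gs ! k = (x, v)" "(x, v) \<in> set gs"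
    using k nth_mem[OF k(1)] by (auto simp: v_def prod_eq_iff)
  note xv = generates_mem[OF assms(3) gk(2)]
  let ?I = "{i. i < length gs \<and> fst (gs ! i) \<le> x}"
  let ?t = "\<lambda>i. mp M (fst (gs ! i)) x (snd (gs ! i))"
  have fin: "finite ?I" "k \<in> ?I" using k by auto
  have "?t k = v" using Rep_refl[OF assms(1)] xv k by (simp add: v_def)
  then have "c k *s v + (\<Sum>i\<in>?I - {k}. c i *s ?t i) = 0"
    using eq sum.remove[OF fin, of "\<lambda>i. c i *s ?t i"] by simp
  then have "c k *s v = - (\<Sum>i\<in>?I - {k}. c i *s ?t i)"
    by (simp add: eq_neg_iff_add_eq_0)
  then have "inverse (c k) *s (c k *s v) = inverse (c k) *s (- (\<Sum>i\<in>?I - {k}. c i *s ?t i))"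
    by (rule arg_cong)
  then have "v = inverse (c k) *s (- (\<Sum>i\<in>?I - {k}. c i *s ?t i))"
    using ck by simp
  also have "\<dots> \<in> span {mp M x' x v' | x' v'. (x', v') \<in> set gs - {(x, v)} \<and> x' \<le> x}"
  proof (intro span_scale span_neg span_sum span_base)
    fix i assume i: "i \<in> ?I - {k}"
    then have "gs ! i \<in> set gs - {(x, v)}"
      using assms(2) k(1) gk(1) nth_eq_iff_index_eq[of gs i k] by auto
    then show "?t i \<in> {mp M x' x v' | x' v'. (x', v') \<in> set gs - {(x, v)} \<and> x' \<le> x}"
      using i by (intro CollectI exI[of _ "fst (gs ! i)"] exI[of _ "snd (gs ! i)"]) auto
  qed
  finally show False
    using generates_redundant[OF assms(1,3) gk(2)] irr[OF gk(2)] by blast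
qed

text \<open>Essentiality of the cover, by a minimal counterexample. At a minimal point where some
  generator \<open>e j\<close> escapes the image of \<open>h\<close>, correct \<open>e j\<close> by
  an element of that image so that it lies in the kernel of \<open>g\<close>; there the generators
  at the same point have coefficient zero, and the lower ones are already hit.\<close>

lemma irredundant_cover:
  assumes M: "M \<in> Rep P" and gs: "distinct gs" "generates P M (set gs)"
    and irr: "\<And>g. g \<in> set gs \<Longrightarrow> \<not> generates P M (set gs - {g})"
    and U: "psum_data P (map fst gs) U \<iota> \<pi>" and g: "g \<in> Hom P U M"
    and gv: "\<And>j. j < length gs \<Longrightarrow> g (fst (gs ! j)) (\<iota> j (fst (gs ! j)) e0) = snd (gs ! j)"
    and Z: "Z \<in> Rep P" and h: "h \<in> Hom P Z U" and gh: "surj_mor P Z (comp_mor g h) M"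
  shows "surj_mor P Z h U"
proof -
  have UR: "U \<in> Rep P" using U unfolding psum_data_def by blast
  let ?x = "\<lambda>j. fst (gs ! j)"
  define e where "e j = \<iota> j (?x j) e0" for j
  have xP: "?x j \<in> P" and eU: "e j \<in> sp U (?x j)" if "j < length gs" for j
    using psum_mem[OF U, of j] that by (auto simp: e_def)
  have sub: "subspace (h y ` sp Z y)" if "y \<in> P" for y
    using lin_on_image_subspace[OF Hom_lin[OF h that] Rep_subspace[OF Z that]] .
  have push: "mp U x y u \<in> h y ` sp Z y" if xy: "x \<in> P" "y \<in> P" "x \<le> y" and u: "u \<in> h x ` sp Z x" for x y u
  proof -
    obtain z where z: "z \<in> sp Z x" "u = h x z" using u by (rule imageE)
    then have "mp U x y u = h y (mp Z x y z)" using Hom_nat[OF h xy] by simp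
    then show ?thesis using Rep_mem[OF Z xy z(1)] by simp
  qed
  have expand: "\<exists>c. u = (\<Sum>j | j < length gs \<and> ?x j \<le> y. c j *s mp U (?x j) y (e j))"
    if yu: "y \<in> P" "u \<in> sp U y" for y u
  proof -
    obtain c where c: "u = (\<Sum>j | j < length (map fst gs) \<and> map fst gs ! j \<le> y.
        c j *s mp U (map fst gs ! j) y (\<iota> j (map fst gs ! j) e0))"
      by (rule psum_expand[OF U yu])
    show ?thesis
      unfolding c by (rule exI[of _ c], rule sum.cong) (auto simp: e_def)
  qed
  define B where "B = {j. j < length gs \<and> e j \<notin> h (?x j) ` sp Z (?x j)}"
  have "B = {}"
  proof (rule ccontr)
    assume "B \<noteq> {}"
    moreover have "finite B" unfolding B_def by simp
    ultimately obtain m where m: "m \<in> ?x ` B" "\<And>b. b \<in> ?x ` B \<Longrightarrow> b \<le> m \<Longrightarrow> m = b"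
      using finite_has_minimal[of "?x ` B"] by auto
    then obtain j where j: "j \<in> B" "m = ?x j" by blast
    have jl: "j < length gs" and ej: "e j \<notin> h (?x j) ` sp Z (?x j)"
      using j(1) unfolding B_def by auto
    have lower: "e i \<in> h (?x i) ` sp Z (?x i)" if "i < length gs" "?x i \<le> ?x j" "?x i \<noteq> ?x j" for i
    proof (rule ccontr)
      assume "e i \<notin> h (?x i) ` sp Z (?x i)"
      then have "i \<in> B" using that(1) unfolding B_def by simp
      then show False using m(2)[of "?x i"] that(2,3) j(2) by auto
    qed
    \<comment> \<open>\<open>z\<close> has the same image in \<open>M\<close> as \<open>e j\<close>,
      so the difference \<open>u\<close> defined below is killed by \<open>g\<close>.\<close>
    obtain z where z: "z \<in> sp Z (?x j)" "comp_mor g h (?x j) z = g (?x j) (e j)"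
      by (rule surj_morE[OF gh xP[OF jl] Hom_mem[OF g xP[OF jl] eU[OF jl]]])
    have hz: "h (?x j) z \<in> sp U (?x j)" using Hom_mem[OF h xP[OF jl] z(1)] .
    define u where "u = e j - h (?x j) z"
    have u: "u \<in> sp U (?x j)"
      unfolding u_def using subspace_diff[OF Rep_subspace[OF UR xP[OF jl]] eU[OF jl] hz] .
    have gu: "g (?x j) u = 0"
      unfolding u_def
      using lin_on_diff[OF Hom_lin[OF g xP[OF jl]] Rep_subspace[OF UR xP[OF jl]] eU[OF jl] hz] z(2) by simp
    obtain c where c: "u = (\<Sum>i | i < length gs \<and> ?x i \<le> ?x j. c i *s mp U (?x i) (?x j) (e i))"
      using expand[OF xP[OF jl] u] by (elim exE)
    have mem: "mp U (?x i) (?x j) (e i) \<in> sp U (?x j)" if "i < length gs" "?x i \<le> ?x j" for i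
      using Rep_mem[OF UR xP[OF that(1)] xP[OF jl] that(2) eU[OF that(1)]] .
    have "(\<Sum>i | i < length gs \<and> ?x i \<le> ?x j. c i *s mp M (?x i) (?x j) (snd (gs ! i))) =
        (\<Sum>i | i < length gs \<and> ?x i \<le> ?x j. g (?x j) (c i *s mp U (?x i) (?x j) (e i)))"
    proof (rule sum.cong[OF refl])
      fix i assume "i \<in> {i. i < length gs \<and> ?x i \<le> ?x j}"
      then have i: "i < length gs" "?x i \<le> ?x j" by auto
      have "g (?x j) (mp U (?x i) (?x j) (e i)) = mp M (?x i) (?x j) (snd (gs ! i))"
        using Hom_nat[OF g xP[OF i(1)] xP[OF jl] i(2) eU[OF i(1)]] gv[OF i(1)] by (simp add: e_def)
      then show "c i *s mp M (?x i) (?x j) (snd (gs ! i)) = g (?x j) (c i *s mp U (?x i) (?x j) (e i))"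
        using lin_on_scale[OF Hom_lin[OF g xP[OF jl]] mem[OF i]] by simp
    qed
    also have "\<dots> = g (?x j) u"
      unfolding c by (rule lin_on_sum[OF Hom_lin[OF g xP[OF jl]] Rep_subspace[OF UR xP[OF jl]], symmetric])
        (use mem subspace_scale[OF Rep_subspace[OF UR xP[OF jl]]] in auto)
    \<comment> \<open>Applying \<open>g\<close> has turned the expansion of \<open>u\<close> into a
      relation between generators of \<open>M\<close>, to which irredundancy applies.\<close>
    finally have "c i = 0" if "i < length gs" "?x i = ?x j" for i
      using irredundant_combination[OF M gs irr _ that] gu by simp
    then have "c i *s mp U (?x i) (?x j) (e i) \<in> h (?x j) ` sp Z (?x j)"
      if "i < length gs" "?x i \<le> ?x j" for i
      using subspace_scale[OF sub[OF xP[OF jl]] push[OF xP[OF that(1)] xP[OF jl] that(2) lower[OF that]]]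
        subspace_0[OF sub[OF xP[OF jl]]] that
      by (cases "?x i = ?x j") simp_all
    then have "u \<in> h (?x j) ` sp Z (?x j)"
      unfolding c by (intro subspace_sum[OF sub[OF xP[OF jl]]]) simp
    then have "u + h (?x j) z \<in> h (?x j) ` sp Z (?x j)"
      by (rule subspace_add[OF sub[OF xP[OF jl]]]) (use z(1) in simp)
    then show False using ej by (simp add: u_def)
  qed
  then have e_in: "e j \<in> h (?x j) ` sp Z (?x j)" if "j < length gs" for j
    using that unfolding B_def by blast
  show ?thesis
    unfolding surj_mor_def
  proof (intro ballI subsetI)
    fix y u assume y: "y \<in> P" and u: "u \<in> sp U y"
    obtain c where c: "u = (\<Sum>i | i < length gs \<and> ?x i \<le> y. c i *s mp U (?x i) y (e i))"
      using expand[OF y u] by (elim exE)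
    show "u \<in> h y ` sp Z y"
      unfolding c
      by (rule subspace_sum[OF sub[OF y]], rule subspace_scale[OF sub[OF y]], rule push) (use xP y e_in in auto)
  qed
qed

lemma fp_rep_fin_gen:
  assumes "floor_cofinal P" "M \<in> fp_rep P"
  obtains G where "finite G" "generates P M G"
proof -
  obtain Q where Q: "finite Q" "has_floors P Q" "tame P Q M" by (rule fp_rep_tame[OF assms])
  show ?thesis
    by (rule tame_generates[OF Q(3) subsetD[OF fp_rep_Rep assms(2)] Q(2,1)]) (rule that)
qed

lemma proj_cover_exists:
  assumes "floor_cofinal P" "M \<in> fp_rep P"
  obtains xs U \<iota> \<pi> g where "psum_data P xs U \<iota> \<pi>" "proj_cover P (fp_rep P) U g M"
proof -
  have M: "M \<in> Rep P" using assms(2) fp_rep_Rep by blast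
  obtain G where G: "finite G" "generates P M G" by (rule fp_rep_fin_gen[OF assms])
  obtain gs where gs: "distinct gs" "generates P M (set gs)"
      and irr: "\<And>g. g \<in> set gs \<Longrightarrow> \<not> generates P M (set gs - {g})"
    by (rule irredundant_generators[OF G]) blast
  have "set (map fst gs) \<subseteq> P"
    using generates_mem[OF gs(2)] by auto
  then obtain U \<iota> \<pi> where U: "psum_data P (map fst gs) U \<iota> \<pi>"
    by (rule psum_exists)
  obtain g where g: "g \<in> Hom P U M" "surj_mor P U g M"
      and gv: "\<And>j. j < length gs \<Longrightarrow> g (fst (gs ! j)) (\<iota> j (fst (gs ! j)) e0) = snd (gs ! j)"
    by (rule psum_cover[OF M gs(2) U]) blast
  note fp = psum_fp_rep[OF assms(1) U]
  have "proj_cover P (fp_rep P) U g M"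
    unfolding proj_cover_def
  proof (intro conjI ballI impI)
    show "epi P (fp_rep P) U g M" by (rule surj_mor_epi[OF fp(1) assms(2) g])
    fix Z h assume Z: "Z \<in> fp_rep P" and h: "h \<in> Hom P Z U" and e: "epi P (fp_rep P) Z (comp_mor g h) M"
    have "surj_mor P Z h U"
      by (rule irredundant_cover[OF M gs irr U g(1) gv subsetD[OF fp_rep_Rep Z] h fp_rep_epi_surj[OF assms(1) e]])
    then show "epi P (fp_rep P) Z h U"
      by (rule surj_mor_epi[OF Z fp(1) h])
  qed (rule fp(2))
  then show ?thesis by (rule that[OF U])
qed

text \<open>Besides minimality the conclusion keeps the explicit sums of principal representations
  and the cokernel property in \<open>Rep P\<close>, because tameness of \<open>M\<close> is derived
  from them.\<close>

lemma min_proj_pres_exists: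
  assumes "floor_cofinal P" "M \<in> fp_rep P"
  obtains xs U \<iota> \<pi> ys V \<iota>' \<pi>' g d where "psum_data P xs U \<iota> \<pi>" "psum_data P ys V \<iota>' \<pi>'"
    "min_proj_pres P (fp_rep P) V d U g M" "is_cokernel P (Rep P) V d U g M"
    "surj_mor P V d (kernel_rep U g)" "d \<in> Hom P V (kernel_rep U g)"
proof -
  obtain xs U \<iota> \<pi> g where U: "psum_data P xs U \<iota> \<pi>" "proj_cover P (fp_rep P) U g M"
    by (rule proj_cover_exists[OF assms])
  have g: "g \<in> Hom P U M" "epi P (fp_rep P) U g M" "U \<in> fp_rep P"
    using U(2) unfolding proj_cover_def epi_def by auto
  have K: "kernel_rep U g \<in> fp_rep P"
    by (rule fp_rep_kernel[OF assms(1) g(3) assms(2) g(1)])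
  obtain ys V \<iota>' \<pi>' d where V: "psum_data P ys V \<iota>' \<pi>'" "proj_cover P (fp_rep P) V d (kernel_rep U g)"
    by (rule proj_cover_exists[OF assms(1) K])
  have d: "d \<in> Hom P V (kernel_rep U g)" "epi P (fp_rep P) V d (kernel_rep U g)" "V \<in> fp_rep P"
    using V(2) unfolding proj_cover_def epi_def by auto
  have "comp_mor id_mor d \<in> Hom P V U"
    by (rule Hom_comp[OF d(1) kernel_rep_incl])
  then have dU: "d \<in> Hom P V U" by (simp add: comp_mor_def)
  have "is_kernel P (fp_rep P) (kernel_rep U g) id_mor U g M"
    by (rule kernel_rep_is_kernel[OF g(3) assms(2) g(1) K])
  moreover have "mor_eq P V d (comp_mor id_mor d)" by (simp add: mor_eq_def)
  ultimately have "min_proj_pres P (fp_rep P) V d U g M"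
    unfolding min_proj_pres_def using dU U(2) V(2) by (intro conjI exI) assumption+
  moreover have "is_cokernel P (Rep P) V d U g M"
    by (rule presentation_is_cokernel[OF _ _ _ g(1) fp_rep_epi_surj[OF assms(1) g(2)] d(1)
          fp_rep_epi_surj[OF assms(1) d(2)]]) (use assms(2) g(3) d(3) fp_rep_Rep in auto)
  ultimately show ?thesis
    by (rule that[OF U(1) V(1) _ _ fp_rep_epi_surj[OF assms(1) d(2)] d(1)])
qed

section \<open>Comparison of all minimal presentations\<close>

lemma proj_cover_lift_surj:
  assumes "floor_cofinal P" "proj_cover P (fp_rep P) W q N" "U \<in> proj P (fp_rep P)"
    and "g \<in> Hom P U N" "surj_mor P U g N"
  obtains h where "h \<in> Hom P U W" "surj_mor P U h W" "mor_eq P U (comp_mor q h) g"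
proof -
  have U: "U \<in> fp_rep P" using assms(3) unfolding proj_def by blast
  have q: "epi P (fp_rep P) W q N" "N \<in> fp_rep P" "q \<in> Hom P W N" "W \<in> fp_rep P"
    using assms(2) unfolding proj_cover_def epi_def by auto
  have "Hom_surj P U W q N"
    using assms(3) q(1) by (simp add: proj_def)
  then have "\<exists>h\<in>Hom P U W. mor_eq P U (comp_mor q h) g"
    using assms(4) by (simp add: Hom_surj_def)
  then obtain h where h: "h \<in> Hom P U W" "mor_eq P U (comp_mor q h) g"
    by (elim bexE)
  have "surj_mor P U (comp_mor q h) N"
    unfolding surj_mor_def
  proof (intro ballI subsetI)
    fix x w assume x: "x \<in> P" and w: "w \<in> sp N x"
    obtain u where "u \<in> sp U x" "g x u = w" by (rule surj_morE[OF assms(5) x w])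
    then show "w \<in> comp_mor q h x ` sp U x"
      using mor_eqD[OF h(2) x] by (metis imageI)
  qed
  \<comment> \<open>The cover \<open>q\<close> is essential: once \<open>q \<circ> h\<close> is an
    epimorphism, so is \<open>h\<close>.\<close>
  then have "epi P (fp_rep P) U (comp_mor q h) N"
    by (rule surj_mor_epi[OF U q(2) Hom_comp[OF h(1) q(3)]])
  then have "epi P (fp_rep P) U h W"
    using assms(2) U h(1) by (simp add: proj_cover_def)
  then show ?thesis
    using that[OF h(1) fp_rep_epi_surj[OF assms(1)] h(2)] by simp
qed

text \<open>
  A projective presentation surjects onto every minimal one, so the points of all minimal
  presentations are among those of a single finite one.
\<close>

lemma min_proj_pres_nonbirth:
  assumes "floor_cofinal P"
    and U: "psum_data P xs U \<iota> \<pi>" and V: "psum_data P ys V \<iota>' \<pi>'"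
    and g: "g \<in> Hom P U M" "surj_mor P U g M"
    and d: "d \<in> Hom P V (kernel_rep U g)" "surj_mor P V d (kernel_rep U g)"
    and pres: "min_proj_pres P (fp_rep P) P1 d' P0 g' M"
    and x: "x \<in> P" "x \<notin> set xs \<union> set ys"
  shows "nonbirth P P0 x" "nonbirth P P1 x"
proof -
  note fU = psum_fp_rep[OF assms(1) U] and fV = psum_fp_rep[OF assms(1) V]
  have UR: "U \<in> Rep P" and VR: "V \<in> Rep P" and xsP: "set xs \<subseteq> P" "set ys \<subseteq> P"
    using U V unfolding psum_data_def by auto
  have nU: "nonbirth P U x"
    by (rule nonbirth_retract[OF psum_retract[OF U] x(1)])
      (use xsP x(2) in \<open>auto intro!: nonbirth_principal principal_Rep\<close>)
  have nV: "nonbirth P V x"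
    by (rule nonbirth_retract[OF psum_retract[OF V] x(1)])
      (use xsP x(2) in \<open>auto intro!: nonbirth_principal principal_Rep\<close>)
  obtain K k d'' where K: "proj_cover P (fp_rep P) P0 g' M" "is_kernel P (fp_rep P) K k P0 g' M"
      "proj_cover P (fp_rep P) P1 d'' K"
    using pres unfolding min_proj_pres_def by (elim conjE exE)
  obtain h where h: "h \<in> Hom P U P0" "surj_mor P U h P0" "mor_eq P U (comp_mor g' h) g"
    by (rule proj_cover_lift_surj[OF assms(1) K(1) fU(2) g])
  show "nonbirth P P0 x"
    by (rule nonbirth_surj[OF UR h(1,2) x(1) nU])
  have K': "K \<in> fp_rep P" "P0 \<in> fp_rep P" "M \<in> fp_rep P" "k \<in> Hom P K P0" "g' \<in> Hom P P0 M"
      "mor_eq P K (comp_mor g' k) zero_mor"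
    using K(2) unfolding is_kernel_def by auto
  let ?L = "kernel_rep U g"
  have L: "?L \<in> fp_rep P"
    by (rule fp_rep_kernel[OF assms(1) fU(1) K'(3) g(1)])
  have "comp_mor h id_mor \<in> Hom P ?L P0"
    by (rule Hom_comp[OF kernel_rep_incl h(1)])
  then have hL: "h \<in> Hom P ?L P0" by (simp add: comp_mor_def)
  have "mor_eq P ?L (comp_mor g' h) zero_mor"
    using mor_eqD[OF h(3)] by (auto simp: mor_eq_def)
  then have "\<exists>r\<in>Hom P ?L K. mor_eq P ?L (comp_mor k r) h \<and>
      (\<forall>k'\<in>Hom P ?L K. mor_eq P ?L (comp_mor k k') h \<longrightarrow> mor_eq P ?L k' r)"
    using K(2) L hL by (simp add: is_kernel_def)
  then obtain r where r: "r \<in> Hom P ?L K" "mor_eq P ?L (comp_mor k r) h"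
    by (elim bexE conjE)
  \<comment> \<open>A chase: \<open>k y w\<close> has a preimage \<open>p\<close> under
    \<open>h\<close>, which lies in the kernel of \<open>g\<close> because
    \<open>g' \<circ> h = g\<close>; then \<open>r y p = w\<close> since \<open>k\<close> is
    injective.\<close>
  have rs: "surj_mor P ?L r K"
    unfolding surj_mor_def
  proof (intro ballI subsetI)
    fix y w assume y: "y \<in> P" and w: "w \<in> sp K y"
    obtain p where p: "p \<in> sp U y" "h y p = k y w"
      by (rule surj_morE[OF h(2) y Hom_mem[OF K'(4) y w]])
    have "g y p = 0"
      using mor_eqD[OF h(3) y p(1)] mor_eqD[OF K'(6) y w] p(2) by simp
    then have pL: "p \<in> sp ?L y" using p(1) by simp
    have rp: "r y p \<in> sp K y" using Hom_mem[OF r(1) y pL] .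
    have KR: "K \<in> Rep P" using K'(1) fp_rep_Rep by blast
    have "k y (w - r y p) = 0"
      using lin_on_diff[OF Hom_lin[OF K'(4) y] Rep_subspace[OF KR y] w rp] mor_eqD[OF r(2) y pL] p(2) by simp
    then have "w - r y p = 0"
      by (rule is_kernel_inj[OF K(2) fp_rep_kernel[OF assms(1) K'(2,3,5)] fp_rep_Rep y
            subspace_diff[OF Rep_subspace[OF KR y] w rp]])
    then have "w = r y p" by simp
    then show "w \<in> r y ` sp ?L y" using pL by (rule image_eqI)
  qed
  have "surj_mor P V (comp_mor r d) K"
    unfolding surj_mor_def
  proof (intro ballI subsetI)
    fix y w assume y: "y \<in> P" and w: "w \<in> sp K y"
    obtain l where l: "l \<in> sp ?L y" "r y l = w" by (rule surj_morE[OF rs y w])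
    obtain v where v: "v \<in> sp V y" "d y v = l" by (rule surj_morE[OF d(2) y l(1)])
    show "w \<in> comp_mor r d y ` sp V y"
      by (rule image_eqI[OF _ v(1)]) (simp add: v(2) l(2))
  qed
  then obtain s where s: "s \<in> Hom P V P1" "surj_mor P V s P1" "mor_eq P V (comp_mor d'' s) (comp_mor r d)"
    by (rule proj_cover_lift_surj[OF assms(1) K(3) fV(2) Hom_comp[OF d(1) r(1)]])
  show "nonbirth P P1 x"
    by (rule nonbirth_surj[OF VR s(1,2) x(1) nV])
qed

lemma psum_split:
  assumes "psum_data P xs U \<iota> \<pi>" "j < length xs"
  shows "\<iota> j \<in> Hom P (principal (xs ! j)) U" "\<pi> j \<in> Hom P U (principal (xs ! j))"
    "mor_eq P (principal (xs ! j)) (comp_mor (\<pi> j) (\<iota> j)) id_mor"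
proof -
  have "mor_eq P (principal (xs ! j)) (comp_mor (\<pi> j) (\<iota> j)) (if j = j then id_mor else zero_mor)"
    using assms unfolding psum_data_def by blast
  then show "mor_eq P (principal (xs ! j)) (comp_mor (\<pi> j) (\<iota> j)) id_mor"
    by simp
qed (use assms in \<open>auto simp: psum_data_def\<close>)

text \<open>The definition of \<open>pres_points\<close> ranges over all minimal presentations. The
  points obtained are exactly those of one chosen finite presentation: any other point is excluded
  by a vanishing top, and each principal summand of the chosen presentation is itself a
  witness.\<close>

lemma pres_points_tame:
  assumes "floor_cofinal P" "M \<in> fp_rep P"
  shows "finite (pres_points P M)"
    and "\<And>Q. has_floors P Q \<Longrightarrow> pres_points P M \<subseteq> Q \<Longrightarrow> tame P Q M"
proof -
  obtain xs U \<iota> \<pi> ys V \<iota>' \<pi>' g d where U: "psum_data P xs U \<iota> \<pi>" and V: "psum_data P ys V \<iota>' \<pi>'"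
    and pres: "min_proj_pres P (fp_rep P) V d U g M" and cok: "is_cokernel P (Rep P) V d U g M"
    and d: "surj_mor P V d (kernel_rep U g)" "d \<in> Hom P V (kernel_rep U g)"
    by (rule min_proj_pres_exists[OF assms])
  note fU = psum_fp_rep[OF assms(1) U] and fV = psum_fp_rep[OF assms(1) V]
  have xsP: "set xs \<subseteq> P" "set ys \<subseteq> P"
    using U V unfolding psum_data_def by auto
  have g: "g \<in> Hom P U M" "surj_mor P U g M"
    using pres fp_rep_epi_surj[OF assms(1)] unfolding min_proj_pres_def proj_cover_def epi_def by auto
  have "pres_points P M \<subseteq> set xs \<union> set ys"
  proof
    fix x assume "x \<in> pres_points P M"
    then obtain P1 d' P0 g' S where x: "x \<in> P" and p: "min_proj_pres P (fp_rep P) P1 d' P0 g' M"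
        and S: "direct_sum P [P1, P0] S" "direct_summand P (fp_rep P) (principal x) S"
      unfolding pres_points_def by (elim CollectE conjE exE)
    obtain N where N: "S \<in> fp_rep P" "direct_sum P [principal x, N] S"
      using S(2) unfolding direct_summand_def by (elim conjE bexE)
    have P01: "P0 \<in> Rep P" "P1 \<in> Rep P"
      using p fp_rep_Rep[of P] unfolding min_proj_pres_def proj_cover_def epi_def by auto
    show "x \<in> set xs \<union> set ys"
    proof (rule ccontr)
      \<comment> \<open>At such an \<open>x\<close> the tops of both terms vanish, hence also those
        of their sum \<open>S\<close> and of every retract of \<open>S\<close>; but
        \<open>principal x\<close> has a nonzero top at \<open>x\<close>.\<close>
      assume nx: "x \<notin> set xs \<union> set ys"
      note nb = min_proj_pres_nonbirth[OF assms(1) U V g d(2,1) p x nx]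
      have nS: "nonbirth P S x"
        by (rule nonbirth_retract[OF direct_sum_retract_of[OF S(1) subset_refl] x])
          (use nb P01 in auto)
      obtain i p where ip: "i \<in> Hom P (principal x) S" "p \<in> Hom P S (principal x)"
          "mor_eq P (principal x) (comp_mor p i) id_mor"
        by (rule direct_sum_pair[OF N(2)])
      have "retract_of P {S} (principal x)"
        by (rule retract_ofI[OF _ ip]) simp
      then have "nonbirth P (principal x) x"
        by (rule nonbirth_retract[OF _ x]) (use nS N(1) fp_rep_Rep in auto)
      then show False using birth_principal by blast
    qed
  qed
  then show "finite (pres_points P M)"
    by (rule finite_subset) simp
  \<comment> \<open>The definition of \<open>pres_points\<close> asks for a direct sum of the two
    terms, which has to be exhibited inside the universe.\<close>
  have "set [V, U] \<subseteq> fp_rep P" using fU(1) fV(1) by simp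
  then obtain S where S: "S \<in> fp_rep P" "direct_sum P [V, U] S"
    by (rule fp_rep_direct_sum_exists[OF assms(1)])
  obtain i1 p1 i2 p2 where ip: "i1 \<in> Hom P V S" "p1 \<in> Hom P S V" "i2 \<in> Hom P U S" "p2 \<in> Hom P S U"
    "mor_eq P V (comp_mor p1 i1) id_mor" "mor_eq P U (comp_mor p2 i2) id_mor"
    by (rule direct_sum_pair[OF S(2)])
  have pp: "zs ! j \<in> pres_points P M"
    if W: "psum_data P zs W a b" and i: "i \<in> Hom P W S" and p: "p \<in> Hom P S W"
      and pi: "mor_eq P W (comp_mor p i) id_mor" and j: "j < length zs" for zs W a b i p j
  proof -
    let ?x = "zs ! j"
    have x: "?x \<in> P" using psum_mem(1)[OF W j] .
    note ab = psum_split[OF W j]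
    have A: "comp_mor i (a j) \<in> Hom P (principal ?x) S" "comp_mor (b j) p \<in> Hom P S (principal ?x)"
      using Hom_comp[OF ab(1) i] Hom_comp[OF p ab(2)] by auto
    have "mor_eq P (principal ?x) (comp_mor (comp_mor (b j) p) (comp_mor i (a j))) id_mor"
    proof (rule mor_eqI)
      fix y v assume y: "y \<in> P" and v: "v \<in> sp (principal ?x) y"
      show "comp_mor (comp_mor (b j) p) (comp_mor i (a j)) y v = id_mor y v"
        using mor_eqD[OF pi y Hom_mem[OF ab(1) y v]] mor_eqD[OF ab(3) y v] by simp
    qed
    then have "direct_summand P (fp_rep P) (principal ?x) S"
      by (rule retract_direct_summand[OF fp_rep_Rep principal_fp_rep[OF assms(1) x] S(1) A _
            fp_rep_kernel[OF assms(1) S(1) principal_fp_rep[OF assms(1) x] A(2)]])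
    then show ?thesis
      unfolding pres_points_def using x pres S(2) by (intro CollectI conjI exI) assumption+
  qed
  have sub: "set xs \<union> set ys \<subseteq> pres_points P M"
    using pp[OF U ip(3,4,6)] pp[OF V ip(1,2,5)] by (auto simp: in_set_conv_nth)
  fix Q assume Q: "has_floors P Q" "pres_points P M \<subseteq> Q"
  show "tame P Q M"
    by (rule tame_cokernel[OF cok psum_tame[OF V Q(1)] psum_tame[OF U Q(1)] Q(1)]) (use sub Q(2) in auto)
qed

end


subsection \<open>Finite aligned subgrids\<close>

lemma grid_poset_outside: "x \<in> grid_poset n T \<Longrightarrow> \<not> i < n \<Longrightarrow> x i = undefined"
  unfolding grid_poset_def by (auto simp: PiE_def extensional_def)

lemma grid_poset_mem: "x \<in> grid_poset n T \<Longrightarrow> i < n \<Longrightarrow> x i \<in> T i"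
  unfolding grid_poset_def by auto

lemma grid_posetI:
  "(\<And>i. i < n \<Longrightarrow> x i \<in> T i) \<Longrightarrow> (\<And>i. \<not> i < n \<Longrightarrow> x i = undefined) \<Longrightarrow> x \<in> grid_poset n T"
  unfolding grid_poset_def by (auto simp: PiE_def extensional_def)

lemma grid_poset_leI:
  fixes x y :: "nat \<Rightarrow> 't::order"
  assumes "x \<in> grid_poset n T" "y \<in> grid_poset n T'" "\<And>i. i < n \<Longrightarrow> x i \<le> y i"
  shows "x \<le> y"
  unfolding le_fun_def
proof
  fix i show "x i \<le> y i"
    using assms(3)[of i] grid_poset_outside[OF assms(1), of i] grid_poset_outside[OF assms(2), of i]
    by (cases "i < n") auto
qed

lemma subgridE:
  assumes "Q \<in> subgrids n T"
  obtains T' where "Q = grid_poset n T'" "\<And>i. i < n \<Longrightarrow> T' i \<subseteq> T i" "\<And>i. i < n \<Longrightarrow> finite (T' i)"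
  using assms unfolding subgrids_def by blast

lemma subgrid_finite: "Q \<in> subgrids n T \<Longrightarrow> finite Q"
  by (erule subgridE) (auto simp: grid_poset_def intro!: finite_PiE)

lemma subgrid_subset: "Q \<in> subgrids n T \<Longrightarrow> Q \<subseteq> grid_poset n T"
  by (erule subgridE) (auto intro!: grid_posetI dest: grid_poset_mem grid_poset_outside)

lemma subgrid_has_floors:
  fixes T :: "nat \<Rightarrow> 't::linorder set"
  assumes "Q \<in> subgrids n T"
  shows "has_floors (grid_poset n T) Q"
  unfolding has_floors_def
proof (intro conjI ballI)
  show "Q \<subseteq> grid_poset n T" by (rule subgrid_subset[OF assms])
  obtain T' where T': "Q = grid_poset n T'" "\<And>i. i < n \<Longrightarrow> finite (T' i)"
    using assms by (elim subgridE) blast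
  fix x assume x: "x \<in> upper (grid_poset n T) Q"
  then obtain y where y: "y \<in> Q" "y \<le> x" unfolding upper_def by blast
  \<comment> \<open>The floor is computed coordinatewise, as the largest grid value not above
    \<open>x i\<close>; outside \<open>{..<n}\<close> the extensional encoding forces
    \<open>undefined\<close>.\<close>
  define z where "z i = (if i < n then Max {s \<in> T' i. s \<le> x i} else undefined)" for i
  have fin: "finite {s \<in> T' i. s \<le> x i}" if "i < n" for i
    using T'(2)[OF that] by simp
  have ne: "{s \<in> T' i. s \<le> x i} \<noteq> {}" if "i < n" for i
    using y grid_poset_mem[of y n T' i] that unfolding T'(1) le_fun_def by auto
  have z: "z i \<in> T' i \<and> z i \<le> x i" if "i < n" for i
    using Max_in[OF fin[OF that] ne[OF that]] that unfolding z_def by simp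
  have zQ: "z \<in> Q"
    unfolding T'(1) by (rule grid_posetI) (use z in \<open>auto simp: z_def\<close>)
  have "z \<le> x"
    by (rule grid_poset_leI[OF zQ[unfolded T'(1)] upper_mem[OF x]]) (use z in auto)
  moreover have "w \<le> z" if w: "w \<in> Q" "w \<le> x" for w
  proof (rule grid_poset_leI[OF w(1)[unfolded T'(1)] zQ[unfolded T'(1)]])
    fix i assume i: "i < n"
    then have "w i \<in> {s \<in> T' i. s \<le> x i}"
      using w grid_poset_mem[of w n T' i] unfolding T'(1) le_fun_def by auto
    then show "w i \<le> z i" using Max_ge[OF fin[OF i]] i unfolding z_def by simp
  qed
  ultimately show "\<exists>z\<in>Q. z \<le> x \<and> (\<forall>y\<in>Q. y \<le> x \<longrightarrow> y \<le> z)"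
    using zQ by blast
qed

text \<open>Being the least subgrid around \<open>D\<close>, the hull gives meaning to the
  \<open>LEAST\<close> in \<open>pres_grid\<close>, and it provides common refinements of finite
  sets.\<close>

lemma subgrid_hull:
  fixes T :: "nat \<Rightarrow> 't set"
  assumes "finite D" "D \<subseteq> grid_poset n T"
  defines "Q \<equiv> grid_poset n (\<lambda>i. (\<lambda>x. x i) ` D)"
  shows "Q \<in> subgrids n T" "D \<subseteq> Q" "\<And>Q'. Q' \<in> subgrids n T \<Longrightarrow> D \<subseteq> Q' \<Longrightarrow> Q \<subseteq> Q'"
proof -
  have "\<forall>i<n. (\<lambda>x. x i) ` D \<subseteq> T i \<and> finite ((\<lambda>x. x i) ` D)"
    using assms(1,2) grid_poset_mem by blast
  then show "Q \<in> subgrids n T" unfolding subgrids_def Q_def by blast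
  show "D \<subseteq> Q"
    unfolding Q_def using assms(2) grid_poset_outside[of _ n T] by (intro subsetI grid_posetI) auto
  fix Q' assume "Q' \<in> subgrids n T" and D: "D \<subseteq> Q'"
  then obtain T' where T': "Q' = grid_poset n T'" by (elim subgridE) blast
  show "Q \<subseteq> Q'"
  proof
    fix x assume x: "x \<in> Q"
    show "x \<in> Q'"
      unfolding T'
    proof (rule grid_posetI)
      fix i assume i: "i < n"
      then obtain d where "d \<in> D" "x i = d i"
        using grid_poset_mem[OF x[unfolded Q_def] i] by blast
      then show "x i \<in> T' i" using D grid_poset_mem[of d n T' i] i unfolding T' by auto
    qed (use grid_poset_outside[OF x[unfolded Q_def]] in simp)
  qed
qed

lemma grid_poset_floor_cofinal:
  fixes T :: "nat \<Rightarrow> 't::linorder set"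
  shows "floor_cofinal (grid_poset n T)"
  unfolding floor_cofinal_def
proof (intro allI impI)
  fix D assume D: "finite D" "D \<subseteq> grid_poset n T"
  note h = subgrid_hull[OF D]
  show "\<exists>Q. finite Q \<and> has_floors (grid_poset n T) Q \<and> D \<subseteq> Q"
    using subgrid_finite[OF h(1)] subgrid_has_floors[OF h(1)] h(2) by blast
qed

lemma has_floors_self: "has_floors Q Q"
  unfolding has_floors_def upper_def by auto

lemma finite_floor_cofinal: "finite Q \<Longrightarrow> floor_cofinal Q"
  unfolding floor_cofinal_def using has_floors_self by blast

lemma upper_self: "upper Q Q = Q"
  unfolding upper_def by auto

section \<open>Joins and fibres of the floor map\<close>

lemma grid_join:
  fixes T :: "nat \<Rightarrow> 't::linorder set"
  assumes "x \<in> grid_poset n T" "y \<in> grid_poset n T"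
  shows "join_in (grid_poset n T) x y = (\<lambda>i. max (x i) (y i))"
    "(\<lambda>i. max (x i) (y i)) \<in> grid_poset n T"
proof -
  show m: "(\<lambda>i. max (x i) (y i)) \<in> grid_poset n T"
    using grid_poset_mem[OF assms(1)] grid_poset_mem[OF assms(2)] grid_poset_outside[OF assms(1)]
      grid_poset_outside[OF assms(2)] by (intro grid_posetI) (auto simp: max_def)
  show "join_in (grid_poset n T) x y = (\<lambda>i. max (x i) (y i))"
    unfolding join_in_def using m by (intro Least_equality) (auto simp: le_fun_def)
qed

text \<open>The fibre over \<open>y\<close> is a product: in each coordinate no grid value lies
  strictly above \<open>y i\<close> and at most at \<open>x i\<close>. Joins and greatest elements
  can then be handled one coordinate at a time.\<close>

lemma ceil_in_grid_iff:
  fixes T T' :: "nat \<Rightarrow> 't::linorder set"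
  assumes "Q \<in> subgrids n T" "Q = grid_poset n T'"
  shows "x \<in> ceil_in (grid_poset n T) Q y \<longleftrightarrow>
    x \<in> grid_poset n T \<and> y \<in> Q \<and> y \<le> x \<and> (\<forall>i<n. \<forall>r\<in>T' i. r \<le> x i \<longrightarrow> r \<le> y i)"
proof
  assume "x \<in> ceil_in (grid_poset n T) Q y"
  then have x: "x \<in> upper (grid_poset n T) Q" "floor_in Q x = y" unfolding ceil_in_def by auto
  note z = floor_in_props[OF subgrid_has_floors[OF assms(1)] x(1), unfolded x(2)]
  have "r \<le> y i" if i: "i < n" and r: "r \<in> T' i" "r \<le> x i" for i r
  proof -
    \<comment> \<open>Changing a single coordinate stays in the product \<open>Q\<close> and below
      \<open>x\<close>, so maximality of the floor bounds the new value.\<close>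
    have "y(i := r) \<in> Q"
      unfolding assms(2) using z(1)[unfolded assms(2)] i r(1) grid_poset_mem grid_poset_outside
      by (intro grid_posetI) (auto simp: fun_upd_def)
    moreover have "y(i := r) \<le> x" using z(2) r(2) unfolding le_fun_def by auto
    ultimately have "y(i := r) \<le> y" by (rule z(3))
    then show ?thesis unfolding le_fun_def by (metis fun_upd_same)
  qed
  then show "x \<in> grid_poset n T \<and> y \<in> Q \<and> y \<le> x \<and> (\<forall>i<n. \<forall>r\<in>T' i. r \<le> x i \<longrightarrow> r \<le> y i)"
    using upper_mem[OF x(1)] z(1,2) by blast
next
  assume a: "x \<in> grid_poset n T \<and> y \<in> Q \<and> y \<le> x \<and> (\<forall>i<n. \<forall>r\<in>T' i. r \<le> x i \<longrightarrow> r \<le> y i)"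
  have "floor_in Q x = y"
  proof (rule floor_in_eqI)
    fix w assume w: "w \<in> Q" "w \<le> x"
    show "w \<le> y"
    proof (rule grid_poset_leI)
      show "w \<in> grid_poset n T'" "y \<in> grid_poset n T'" using w(1) a assms(2) by auto
      show "w i \<le> y i" if "i < n" for i
        using a that grid_poset_mem[of w n T' i] w unfolding assms(2) le_fun_def by auto
    qed
  qed (use a in auto)
  then show "x \<in> ceil_in (grid_poset n T) Q y"
    unfolding ceil_in_def using a upperI[of x "grid_poset n T" y Q] by simp
qed

text \<open>A grid value at most the maximum of \<open>y' i\<close> and \<open>x i\<close> is at
  most \<open>y' i\<close>, or else at most \<open>x i\<close> and therefore at most
  \<open>y i\<close>, which is at most \<open>y' i\<close>.\<close>

lemma ceil_in_join:
  fixes T :: "nat \<Rightarrow> 't::linorder set"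
  assumes "Q \<in> subgrids n T" "y' \<in> Q" "y \<le> y'" "x \<in> ceil_in (grid_poset n T) Q y"
  shows "join_in (grid_poset n T) y' x \<in> ceil_in (grid_poset n T) Q y'"
    "x \<le> join_in (grid_poset n T) y' x"
proof -
  obtain T' where T': "Q = grid_poset n T'" using assms(1) by (elim subgridE) blast
  note iff = ceil_in_grid_iff[OF assms(1) T']
  have x: "x \<in> grid_poset n T" "y \<le> x" "\<And>i r. i < n \<Longrightarrow> r \<in> T' i \<Longrightarrow> r \<le> x i \<Longrightarrow> r \<le> y i"
    using assms(4) unfolding iff by auto
  have y': "y' \<in> grid_poset n T" using subgrid_subset[OF assms(1)] assms(2) by blast
  note j = grid_join[OF y' x(1)]
  have "r \<le> y' i" if i: "i < n" "r \<in> T' i" and r: "r \<le> max (y' i) (x i)" for i r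
  proof (cases "r \<le> y' i")
    case False
    then have "r \<le> x i" using r by (auto simp: max_def split: if_splits)
    then have "r \<le> y i" by (rule x(3)[OF i])
    also have "y i \<le> y' i" using assms(3) unfolding le_fun_def by blast
    finally show ?thesis .
  qed
  then show "join_in (grid_poset n T) y' x \<in> ceil_in (grid_poset n T) Q y'"
    unfolding iff j(1) using j(2) assms(2) by (auto simp: le_fun_def)
  show "x \<le> join_in (grid_poset n T) y' x"
    unfolding j(1) by (simp add: le_fun_def)
qed

text \<open>The part of a fibre inside a finer finite subgrid is again a finite product, so its
  greatest element is taken coordinatewise. This is the point at which the colimit over the fibre
  will be attained.\<close>

lemma ceil_in_refine_greatest:
  fixes T :: "nat \<Rightarrow> 't::linorder set"
  assumes "Q \<in> subgrids n T" "R \<in> subgrids n T" "Q \<subseteq> R" "y \<in> Q"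
  obtains t where "t \<in> R" "t \<in> ceil_in (grid_poset n T) Q y"
    "\<And>z. z \<in> R \<Longrightarrow> z \<in> ceil_in (grid_poset n T) Q y \<Longrightarrow> z \<le> t"
proof -
  obtain T' where T': "Q = grid_poset n T'" using assms(1) by (elim subgridE) blast
  obtain S where S: "R = grid_poset n S" "\<And>i. i < n \<Longrightarrow> finite (S i)" using assms(2) by (elim subgridE) blast
  note iff = ceil_in_grid_iff[OF assms(1) T']
  define A where "A i = {s \<in> S i. y i \<le> s \<and> (\<forall>r\<in>T' i. r \<le> s \<longrightarrow> r \<le> y i)}" for i
  define t where "t i = (if i < n then Max (A i) else undefined)" for i
  have fin: "finite (A i)" if "i < n" for i using S(2)[OF that] unfolding A_def by simp
  have yR: "y \<in> R" using assms(3,4) by blast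
  have ne: "A i \<noteq> {}" if "i < n" for i
    using grid_poset_mem[OF yR[unfolded S(1)] that] unfolding A_def by auto
  have tA: "t i \<in> A i" if "i < n" for i
    using Max_in[OF fin[OF that] ne[OF that]] that by (simp add: t_def)
  have tS: "t i \<in> S i" "y i \<le> t i" "\<And>r. r \<in> T' i \<Longrightarrow> r \<le> t i \<Longrightarrow> r \<le> y i" if "i < n" for i
    using tA[OF that] by (simp_all add: A_def)
  have tR: "t \<in> R"
    unfolding S(1) by (rule grid_posetI[OF tS(1)]) (simp_all add: t_def)
  have "y \<le> t"
    by (rule grid_poset_leI[OF yR[unfolded S(1)] tR[unfolded S(1)] tS(2)])
  then have tc: "t \<in> ceil_in (grid_poset n T) Q y"
    unfolding iff using assms(4) tS(3) subsetD[OF subgrid_subset[OF assms(2)] tR] by simp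
  show ?thesis
  proof (rule that[OF tR tc])
    fix z assume z: "z \<in> R" "z \<in> ceil_in (grid_poset n T) Q y"
    show "z \<le> t"
    proof (rule grid_poset_leI[OF z(1)[unfolded S(1)] tR[unfolded S(1)]])
      fix i assume i: "i < n"
      have "z i \<in> A i"
        using z(2) i grid_poset_mem[OF z(1)[unfolded S(1)] i] unfolding iff A_def le_fun_def by auto
      then show "z i \<le> t i" using Max_ge[OF fin[OF i]] i by (simp add: t_def)
    qed
  qed
qed

section \<open>Finite presentability over grids and finite posets\<close>

context vec_universe
begin

text \<open>\<open>pres_grid\<close> is a \<open>LEAST\<close>, so a least subgrid must be known to
  exist; finiteness of the set of points provides it as a hull.\<close>

lemma pres_points_subset_pres_grid:
  fixes M :: "(nat \<Rightarrow> 't::linorder, 'b) prep"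
  assumes "M \<in> fp_rep (grid_poset n T)"
  shows "pres_points (grid_poset n T) M \<subseteq> pres_grid n T M"
proof -
  let ?D = "pres_points (grid_poset n T) M"
  have D: "finite ?D" "?D \<subseteq> grid_poset n T"
    using pres_points_tame(1)[OF grid_poset_floor_cofinal assms] by (auto simp: pres_points_def)
  note h = subgrid_hull[OF D]
  have "pres_grid n T M = grid_poset n (\<lambda>i. (\<lambda>x. x i) ` ?D)"
    unfolding pres_grid_def using h by (intro Least_equality) auto
  then show ?thesis using h(2) by simp
qed

text \<open>Over \<open>Q\<close> itself every point is its own floor, so tameness reduces to
  pointwise finite dimension.\<close>

lemma fp_rep_finite_iff:
  assumes "finite Q"
  shows "M \<in> fp_rep Q \<longleftrightarrow> M \<in> Rep Q \<and> (\<forall>x\<in>Q. fd (sp M x))"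
proof
  assume M: "M \<in> fp_rep Q"
  obtain R where "tame Q R M" by (rule fp_rep_tame[OF finite_floor_cofinal[OF assms] M])
  then show "M \<in> Rep Q \<and> (\<forall>x\<in>Q. fd (sp M x))"
    using tame_fd M fp_rep_Rep by blast
next
  assume M: "M \<in> Rep Q \<and> (\<forall>x\<in>Q. fd (sp M x))"
  then have refl: "mp M x x v = v" if "x \<in> Q" "v \<in> sp M x" for x v
    using Rep_refl that by blast
  have "tame Q Q M"
    by (rule tameI[OF _ has_floors_self])
      (use M refl in \<open>auto simp: upper_self floor_in_self image_iff\<close>)
  then show "M \<in> fp_rep Q"
    using tame_fp_rep[OF _ _ has_floors_self assms] M by blast
qed


subsection \<open>Extension\<close>

lemma extension_sp: "x \<in> upper P Q \<Longrightarrow> sp (extension P Q N) x = sp N (floor_in Q x)"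
  unfolding extension_def by simp

lemma extension_sp_zero: "x \<notin> upper P Q \<Longrightarrow> sp (extension P Q N) x = {0}"
  unfolding extension_def by simp

lemma extension_mp: "x \<in> upper P Q \<Longrightarrow> y \<in> P \<Longrightarrow> x \<le> y \<Longrightarrow>
    mp (extension P Q N) x y v = mp N (floor_in Q x) (floor_in Q y) v"
  unfolding extension_def using upper_up by auto

lemma extension_mp_zero: "x \<notin> upper P Q \<Longrightarrow> mp (extension P Q N) x y v = 0"
  unfolding extension_def by simp

lemma extension_Rep:
  assumes "N \<in> Rep Q" "has_floors P Q"
  shows "extension P Q N \<in> Rep P"
  unfolding Rep_def
proof (intro CollectI conjI ballI impI)
  let ?E = "extension P Q N"
  note fl = floor_in_props[OF assms(2)]
  fix x assume x: "x \<in> P"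
  show sub: "subspace (sp ?E x)"
    using Rep_subspace[OF assms(1) fl(1)]
    by (cases "x \<in> upper P Q") (simp_all add: extension_sp extension_sp_zero subspace_single_0)
  {
    fix v assume v: "v \<in> sp ?E x"
    then show "mp ?E x x v = v"
      using Rep_refl[OF assms(1) fl(1)] x
      by (cases "x \<in> upper P Q") (simp_all add: extension_sp extension_sp_zero extension_mp extension_mp_zero)
  }
  fix y assume y: "y \<in> P" "x \<le> y"
  show "lin_on (sp ?E x) (sp ?E y) (mp ?E x y)"
  proof (cases "x \<in> upper P Q")
    case True
    then show ?thesis
      using Rep_lin[OF assms(1) fl(1)[OF True] fl(1)[OF upper_up[OF True y(2,1)]] floor_in_mono[OF assms(2) True y(2,1)]]
        upper_up[OF True y(2,1)] y
      by (simp add: extension_sp extension_mp lin_on_def)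
  next
    case False
    have "0 \<in> sp ?E y"
      using Rep_subspace[OF assms(1) fl(1), THEN subspace_0]
      by (cases "y \<in> upper P Q") (simp_all add: extension_sp extension_sp_zero)
    then show ?thesis
      using False by (simp add: extension_sp_zero extension_mp_zero lin_on_def)
  qed
  fix z v assume z: "z \<in> P" "y \<le> z" and v: "v \<in> sp ?E x"
  show "mp ?E y z (mp ?E x y v) = mp ?E x z v"
  proof (cases "x \<in> upper P Q")
    case True
    note yu = upper_up[OF True y(2,1)]
    note zu = upper_up[OF yu z(2,1)]
    show ?thesis
      using Rep_trans[OF assms(1) fl(1)[OF True] fl(1)[OF yu] fl(1)[OF zu] floor_in_mono[OF assms(2) True y(2,1)]
          floor_in_mono[OF assms(2) yu z(2,1)]] v True yu y z order_trans[OF y(2) z(2)]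
      by (simp add: extension_sp extension_mp)
  next
    case False
    have "mp ?E y z 0 = 0"
    proof (cases "y \<in> upper P Q")
      case True
      note zu = upper_up[OF True z(2,1)]
      show ?thesis
        using lin_on_zero[OF Rep_lin[OF assms(1) fl(1)[OF True] fl(1)[OF zu] floor_in_mono[OF assms(2) True z(2,1)]]
            Rep_subspace[OF assms(1) fl(1)[OF True]]] True z by (simp add: extension_mp)
    qed (simp add: extension_mp_zero)
    then show ?thesis using False by (simp add: extension_mp_zero)
  qed
qed

text \<open>Between a floor and a point above it in the same fibre, the structure map of the
  extension acts as the identity.\<close>

lemma extension_tame:
  assumes "N \<in> fp_rep Q" "has_floors P Q" "finite Q"
  shows "tame P Q (extension P Q N)"
proof -
  have N: "N \<in> Rep Q" "\<And>x. x \<in> Q \<Longrightarrow> fd (sp N x)"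
    using assms(1) unfolding fp_rep_finite_iff[OF assms(3)] by auto
  note fl = floor_in_props[OF assms(2)]
  have mp: "mp (extension P Q N) (floor_in Q x) x u = u" if "x \<in> upper P Q" "u \<in> sp N (floor_in Q x)" for x u
    using extension_mp[OF fl(5)[OF that(1)] upper_mem[OF that(1)] fl(2)[OF that(1)], of N u]
      floor_in_self[OF fl(1)[OF that(1)]] Rep_refl[OF N(1) fl(1)[OF that(1)] that(2)] by simp
  have sp: "sp (extension P Q N) (floor_in Q x) = sp N (floor_in Q x)" if "x \<in> upper P Q" for x
    using extension_sp[OF fl(5)[OF that], of N] floor_in_self[OF fl(1)[OF that]] by simp
  show ?thesis
  proof (rule tameI[OF extension_Rep[OF N(1) assms(2)] assms(2)])
    show "fd (sp (extension P Q N) x)" for x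
      using N(2)[OF fl(1), of x] fd_zero
      by (cases "x \<in> upper P Q") (simp_all add: extension_sp extension_sp_zero)
    show "v = 0" if "x \<notin> upper P Q" "v \<in> sp (extension P Q N) x" for x v
      using that by (simp add: extension_sp_zero)
    fix x assume x: "x \<in> upper P Q"
    show "u = 0" if "u \<in> sp (extension P Q N) (floor_in Q x)"
        "mp (extension P Q N) (floor_in Q x) x u = 0" for u
      using that mp[OF x, of u] sp[OF x] by simp
    show "v \<in> mp (extension P Q N) (floor_in Q x) x ` sp (extension P Q N) (floor_in Q x)"
      if "v \<in> sp (extension P Q N) x" for v
      using that mp[OF x, of v] sp[OF x] extension_sp[OF x, of N] by (intro image_eqI[of _ _ v]) simp_all
  qed
qed

lemma extension_fp_rep:
  assumes "N \<in> fp_rep Q" "has_floors P Q" "finite Q"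
  shows "extension P Q N \<in> fp_rep P"
  by (rule tame_fp_rep[OF extension_Rep[OF subsetD[OF fp_rep_Rep assms(1)] assms(2)] extension_tame[OF assms] assms(2,3)])

text \<open>The action of the extension functor on morphisms; the value 0 outside
  \<open>upper P Q\<close> matches the zero spaces there.\<close>

definition ext_mor :: "'p::order set \<Rightarrow> 'p set \<Rightarrow> ('p, 'b) mor \<Rightarrow> ('p, 'b) mor" where
  "ext_mor P Q f = (\<lambda>x v. if x \<in> upper P Q then f (floor_in Q x) v else 0)"

lemma ext_mor_Hom:
  assumes "f \<in> Hom Q N N'" "N \<in> Rep Q" "N' \<in> Rep Q" "has_floors P Q"
  shows "ext_mor P Q f \<in> Hom P (extension P Q N) (extension P Q N')"
proof (rule HomI)
  note fl = floor_in_props[OF assms(4)]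
  fix x assume x: "x \<in> P"
  show "lin_on (sp (extension P Q N) x) (sp (extension P Q N') x) (ext_mor P Q f x)"
    using Hom_lin[OF assms(1) fl(1), of x]
    by (cases "x \<in> upper P Q") (simp_all add: extension_sp extension_sp_zero ext_mor_def lin_on_def)
  fix y v assume y: "y \<in> P" "x \<le> y" and v: "v \<in> sp (extension P Q N) x"
  show "ext_mor P Q f y (mp (extension P Q N) x y v) = mp (extension P Q N') x y (ext_mor P Q f x v)"
  proof (cases "x \<in> upper P Q")
    case True
    note yu = upper_up[OF True y(2,1)]
    show ?thesis
      using Hom_nat[OF assms(1) fl(1)[OF True] fl(1)[OF yu] floor_in_mono[OF assms(4) True y(2,1)]] v True yu y
      by (simp add: extension_sp extension_mp ext_mor_def)
  next
    case False
    then show ?thesis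
      using Hom_vanish[OF assms(1,2) fl(1), of y] by (simp add: extension_mp_zero ext_mor_def)
  qed
qed

text \<open>Extension is an additive functor and so preserves sums of composites.\<close>

lemma ext_mor_gen:
  assumes "f \<in> gen Q G N" "N \<in> Rep Q" "has_floors P Q" "\<And>A g. (A, g) \<in> G \<Longrightarrow> A \<in> Rep Q"
  shows "ext_mor P Q f \<in> gen P ((\<lambda>(A, g). (extension P Q A, ext_mor P Q g)) ` G) (extension P Q N)"
  using assms(1)
proof induction
  case zero
  show ?case
    by (rule gen.eq[OF gen.zero]) (simp add: mor_eq_def ext_mor_def)
next
  case (add f A g a)
  have "(extension P Q A, ext_mor P Q g) \<in> (\<lambda>(A, g). (extension P Q A, ext_mor P Q g)) ` G"
    using add.hyps(2) by (intro image_eqI[of _ _ "(A, g)"]) simp_all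
  from gen.add[OF add.IH this ext_mor_Hom[OF add.hyps(3) assms(2) assms(4)[OF add.hyps(2)] assms(3)]]
  show ?case
    by (rule gen.eq) (simp add: mor_eq_def ext_mor_def)
next
  case (eq f f')
  show ?case
    by (rule gen.eq[OF eq.IH])
      (use mor_eqD[OF eq.hyps(2) floor_in_props(1)[OF assms(3)]] in \<open>simp add: mor_eq_def ext_mor_def extension_sp\<close>)
qed

text \<open>Representations being total functions, \<open>M\<close> itself serves as its restriction
  to \<open>Q\<close>. The comparison \<open>b\<close> is the structure map from the floor, and
  \<open>a\<close> is its pointwise inverse.\<close>

lemma tame_extension_iso:
  assumes "tame P Q M" "M \<in> Rep P" "has_floors P Q" "finite Q"
  obtains a b where "M \<in> fp_rep Q" "a \<in> Hom P M (extension P Q M)" "b \<in> Hom P (extension P Q M) M"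
    "mor_eq P M (comp_mor b a) id_mor"
proof -
  note fl = floor_in_props[OF assms(3)]
  have QP: "Q \<subseteq> P" using assms(3) by (rule has_floors_subset)
  have MQ: "M \<in> Rep Q" using Rep_mono[OF assms(2) QP] .
  have MfQ: "M \<in> fp_rep Q"
    using MQ tame_fd[OF assms(1)] QP unfolding fp_rep_finite_iff[OF assms(4)] by blast
  let ?E = "extension P Q M"
  define b where "b x v = (if x \<in> upper P Q then mp M (floor_in Q x) x v else 0)" for x v
  have b: "b \<in> Hom P ?E M"
  proof (rule HomI)
    fix x assume x: "x \<in> P"
    show "lin_on (sp ?E x) (sp M x) (b x)"
    proof (cases "x \<in> upper P Q")
      case True
      then show ?thesis using Rep_lin[OF assms(2) fl(4)[OF True] x fl(2)[OF True]]
        by (simp add: extension_sp b_def lin_on_def)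
    next
      case False
      then show ?thesis using subspace_0[OF Rep_subspace[OF assms(2) x]]
        by (simp add: extension_sp_zero b_def lin_on_def)
    qed
    fix y v assume y: "y \<in> P" "x \<le> y" and v: "v \<in> sp ?E x"
    show "b y (mp ?E x y v) = mp M x y (b x v)"
    proof (cases "x \<in> upper P Q")
      case True
      note yu = upper_up[OF True y(2,1)] and mono = floor_in_mono[OF assms(3) True y(2,1)]
      have v': "v \<in> sp M (floor_in Q x)" using v True by (simp add: extension_sp)
      have "mp M (floor_in Q y) y (mp M (floor_in Q x) (floor_in Q y) v) = mp M x y (mp M (floor_in Q x) x v)"
        using Rep_trans[OF assms(2) fl(4)[OF True] fl(4)[OF yu] y(1) mono fl(2)[OF yu] v']
          Rep_trans[OF assms(2) fl(4)[OF True] x y(1) fl(2)[OF True] y(2) v'] by simp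
      then show ?thesis using True yu y by (simp add: extension_mp b_def)
    next
      case False
      then show ?thesis
        using lin_on_zero[OF Rep_lin[OF assms(2) x y] Rep_subspace[OF assms(2) x]]
          lin_on_zero[OF Rep_lin[OF assms(2) fl(4) y(1) fl(2)] Rep_subspace[OF assms(2) fl(4)]]
        by (simp add: extension_mp_zero b_def)
    qed
  qed
  define a where "a x v = (SOME u. u \<in> sp ?E x \<and> b x u = v)" for x v
  have ex: "\<exists>u. u \<in> sp ?E x \<and> b x u = v" if x: "x \<in> P" and v: "v \<in> sp M x" for x v
  proof (cases "x \<in> upper P Q")
    case True
    obtain u where "u \<in> sp M (floor_in Q x)" "mp M (floor_in Q x) x u = v"
      by (rule tame_surj[OF assms(1) True v])
    then show ?thesis using True by (intro exI[of _ u]) (simp add: extension_sp b_def)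
  next
    case False
    then show ?thesis using tame_zero[OF assms(1) x False] v
      by (intro exI[of _ 0]) (simp add: extension_sp_zero b_def)
  qed
  have a: "a x v \<in> sp ?E x" "b x (a x v) = v" if "x \<in> P" "v \<in> sp M x" for x v
    using someI_ex[OF ex[OF that]] unfolding a_def by auto
  have ER: "?E \<in> Rep P" by (rule extension_Rep[OF MQ assms(3)])
  \<comment> \<open>Injectivity of \<open>b\<close> transfers linearity and naturality to the chosen
    inverse \<open>a\<close>.\<close>
  have inj: "u = u'" if x: "x \<in> P" and u: "u \<in> sp ?E x" "u' \<in> sp ?E x" and eq: "b x u = b x u'" for x u u'
  proof (cases "x \<in> upper P Q")
    case True
    have "b x (u - u') = 0" "u - u' \<in> sp ?E x"
      using lin_on_diff[OF Hom_lin[OF b x] Rep_subspace[OF ER x] u] eq subspace_diff[OF Rep_subspace[OF ER x] u]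
      by auto
    then have "u - u' = 0"
      using tame_inj[OF assms(1-3) True, of "u - u'"] True by (simp add: extension_sp b_def)
    then show ?thesis by simp
  next
    case False
    then show ?thesis using u by (simp add: extension_sp_zero)
  qed
  have aH: "a \<in> Hom P M ?E"
  proof (rule HomI)
    fix x assume x: "x \<in> P"
    note subM = Rep_subspace[OF assms(2) x] and subE = Rep_subspace[OF ER x] and lb = Hom_lin[OF b x]
    show "lin_on (sp M x) (sp ?E x) (a x)"
      unfolding lin_on_def
    proof (intro conjI ballI allI)
      show "a x ` sp M x \<subseteq> sp ?E x" using a(1)[OF x] by auto
      fix u assume u: "u \<in> sp M x"
      show "a x (c *s u) = c *s a x u" for c
        by (rule inj[OF x]) (use a[OF x] u subspace_scale[OF subM] subspace_scale[OF subE] lin_on_scale[OF lb] in auto)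
      fix v assume v: "v \<in> sp M x"
      show "a x (u + v) = a x u + a x v"
        by (rule inj[OF x]) (use a[OF x] u v subspace_add[OF subM] subspace_add[OF subE] lin_on_add[OF lb] in auto)
    qed
    fix y v assume y: "y \<in> P" "x \<le> y" and v: "v \<in> sp M x"
    show "a y (mp M x y v) = mp ?E x y (a x v)"
      by (rule inj[OF y(1)])
        (use a[OF x v] a[OF y(1) Rep_mem[OF assms(2) x y v]] Rep_mem[OF ER x y] Hom_nat[OF b x y] in auto)
  qed
  show ?thesis
    by (rule that[OF MfQ aH b]) (use a(2) in \<open>simp add: mor_eq_def\<close>)
qed


subsection \<open>Contraction\<close>

text \<open>\<open>M\<close> is tame over a finite subgrid \<open>R\<close> containing
  \<open>Q\<close>, so the colimit over the fibre of \<open>y\<close> is the value of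
  \<open>M\<close> at the greatest point \<open>t y\<close> of \<open>R\<close> in that fibre. The
  morphism \<open>\<eta>\<close> is the unit of the adjunction, and the last clause factors
  morphisms into extensions through it.\<close>

lemma contraction_exists:
  fixes M :: "(nat \<Rightarrow> 't::linorder, 'b) prep"
  assumes P: "P = grid_poset n T" and Q: "Q \<in> subgrids n T" and M: "M \<in> supp_rep P Q"
  obtains N0 \<eta> where "N0 \<in> fp_rep Q" "is_contraction P Q M N0" "\<eta> \<in> Hom P M (extension P Q N0)"
    "\<And>N f. N \<in> fp_rep Q \<Longrightarrow> f \<in> Hom P M (extension P Q N) \<Longrightarrow>
      \<exists>f'\<in>Hom Q N0 N. mor_eq P M (comp_mor (ext_mor P Q f') \<eta>) f"
proof -
  have Mfp: "M \<in> fp_rep P" and Mz: "\<And>x. x \<in> P \<Longrightarrow> x \<notin> upper P Q \<Longrightarrow> sp M x = {0}"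
    using M unfolding supp_rep_def by auto
  have MR: "M \<in> Rep P" using Mfp fp_rep_Rep by blast
  have flQ: "has_floors P Q" and finQ: "finite Q" and QP: "Q \<subseteq> P"
    using subgrid_has_floors[OF Q] subgrid_finite[OF Q] subgrid_subset[OF Q] unfolding P by auto
  have cof: "floor_cofinal P" unfolding P by (rule grid_poset_floor_cofinal)
  obtain R0 where R0: "finite R0" "has_floors P R0" "tame P R0 M" by (rule fp_rep_tame[OF cof Mfp])
  \<comment> \<open>The hull of \<open>R0\<close> and \<open>Q\<close> keeps \<open>M\<close> tame
    and is at the same time a refinement of \<open>Q\<close>.\<close>
  define R where "R = grid_poset n (\<lambda>i. (\<lambda>x. x i) ` (R0 \<union> Q))"
  have "finite (R0 \<union> Q)" "R0 \<union> Q \<subseteq> grid_poset n T"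
    using R0(1) finQ has_floors_subset[OF R0(2)] QP unfolding P by auto
  note hull = subgrid_hull[OF this, folded R_def]
  have flR: "has_floors P R" unfolding P by (rule subgrid_has_floors[OF hull(1)])
  have RP: "R \<subseteq> P" by (rule has_floors_subset[OF flR])
  have tm: "tame P R M"
    by (rule tame_mono[OF R0(3) MR R0(2) flR]) (use hull(2) in blast)
  have QR: "Q \<subseteq> R" using hull(2) by blast
  have "\<exists>t. t \<in> R \<and> t \<in> ceil_in P Q y \<and> (\<forall>z. z \<in> R \<longrightarrow> z \<in> ceil_in P Q y \<longrightarrow> z \<le> t)" if y: "y \<in> Q" for y
    unfolding P by (rule ceil_in_refine_greatest[OF Q hull(1) QR y]) blast
  then obtain t where t: "\<And>y. y \<in> Q \<Longrightarrow> t y \<in> R" "\<And>y. y \<in> Q \<Longrightarrow> t y \<in> ceil_in P Q y"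
      "\<And>y z. y \<in> Q \<Longrightarrow> z \<in> R \<Longrightarrow> z \<in> ceil_in P Q y \<Longrightarrow> z \<le> t y"
    by metis
  have ceil: "x \<in> upper P Q" "floor_in Q x = y" "x \<in> P" if "x \<in> ceil_in P Q y" for x y
    using that upper_mem unfolding ceil_in_def by auto
  have tP: "t y \<in> P" if "y \<in> Q" for y using t(1)[OF that] RP by blast
  \<comment> \<open>For \<open>x\<close> in the fibre over \<open>y\<close> the floor in
    \<open>R\<close> lies between \<open>y\<close> and \<open>x\<close>, and therefore stays in the
    fibre.\<close>
  have z: "floor_in R x \<in> R" "floor_in R x \<le> x" "floor_in R x \<in> P" "x \<in> upper P R"
      "floor_in R x \<in> ceil_in P Q y" "floor_in R x \<le> t y" "y \<in> Q"
    if x: "x \<in> ceil_in P Q y" for x y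
  proof -
    note c = ceil[OF x]
    note fq = floor_in_props[OF flQ c(1), unfolded c(2)]
    show xR: "x \<in> upper P R" using upperI[OF c(3) _ fq(2)] fq(1) QR by blast
    note fr = floor_in_props[OF flR xR]
    show "floor_in R x \<in> R" "floor_in R x \<le> x" "floor_in R x \<in> P" "y \<in> Q" by (rule fr fq)+
    have le: "y \<le> floor_in R x" using fr(3) fq(1,2) QR by blast
    have "floor_in Q (floor_in R x) = y"
      using floor_in_between[OF flQ c(1), unfolded c(2), OF le fr(2)] .
    moreover have "floor_in R x \<in> upper P Q" by (rule upperI[OF fr(4) fq(1) le])
    ultimately show cc: "floor_in R x \<in> ceil_in P Q y" unfolding ceil_in_def by simp
    show "floor_in R x \<le> t y" by (rule t(3)[OF fq(1) fr(1) cc])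
  qed
  have join: "join_in P y' x \<in> ceil_in P Q y'" "x \<le> join_in P y' x"
    if "y' \<in> Q" "y \<le> y'" "x \<in> ceil_in P Q y" for x y y'
    using ceil_in_join[OF Q that[unfolded P]] unfolding P by auto
  \<comment> \<open>The join of \<open>y'\<close> with \<open>t y\<close> lies in the fibre over
    \<open>y'\<close>, so its floor in \<open>R\<close>, which is at least \<open>t y\<close>, is at
    most \<open>t y'\<close>.\<close>
  have tmono: "t y \<le> t y'" if y: "y \<in> Q" "y' \<in> Q" "y \<le> y'" for y y'
  proof -
    note j = join[OF y(2,3) t(2)[OF y(1)]]
    note zj = z[OF j(1)]
    have "t y \<le> floor_in R (join_in P y' (t y))"
      using floor_in_props(3)[OF flR zj(4) t(1)[OF y(1)] j(2)] .
    also have "\<dots> \<le> t y'" by (rule zj(6))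
    finally show ?thesis .
  qed
  define N0 where "N0 = \<lparr>sp = (\<lambda>y. sp M (t y)), mp = (\<lambda>y y'. mp M (t y) (t y'))\<rparr>"
  have N0s: "sp N0 y = sp M (t y)" "mp N0 y y' = mp M (t y) (t y')" for y y'
    unfolding N0_def by simp_all
  have N0R: "N0 \<in> Rep Q"
    unfolding Rep_def mem_Collect_eq N0s
    using Rep_subspace[OF MR tP] Rep_lin[OF MR tP tP tmono] Rep_refl[OF MR tP]
      Rep_trans[OF MR tP tP tP tmono tmono] by simp
  have N0fp: "N0 \<in> fp_rep Q"
    unfolding fp_rep_finite_iff[OF finQ] using N0R tame_fd[OF tm tP] by (simp add: N0s)
  \<comment> \<open>The coprojection at \<open>x\<close> goes back along the bijection from the
    floor in \<open>R\<close> and then on to \<open>t y\<close>. A single structure map would not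
    do, because \<open>x\<close> need not lie below \<open>t y\<close>.\<close>
  define \<iota> where "\<iota> x v = mp M (floor_in R x) (t (floor_in Q x))
      (SOME w. w \<in> sp M (floor_in R x) \<and> mp M (floor_in R x) x w = v)" for x v
  have \<iota>v: "\<iota> x (mp M (floor_in R x) x w) = mp M (floor_in R x) (t y) w"
    if x: "x \<in> ceil_in P Q y" and w: "w \<in> sp M (floor_in R x)" for x y w
  proof -
    note zx = z[OF x] and c = ceil[OF x]
    define w' where "w' = (SOME w'. w' \<in> sp M (floor_in R x) \<and> mp M (floor_in R x) x w' = mp M (floor_in R x) x w)"
    have w': "w' \<in> sp M (floor_in R x)" "mp M (floor_in R x) x w' = mp M (floor_in R x) x w"
      using someI[of "\<lambda>w'. w' \<in> sp M (floor_in R x) \<and> mp M (floor_in R x) x w' = mp M (floor_in R x) x w" w] w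
      unfolding w'_def by auto
    note sub = Rep_subspace[OF MR zx(3)]
    have "w' - w = 0"
      by (rule tame_inj[OF tm MR flR zx(4) subspace_diff[OF sub w'(1) w]])
        (use lin_on_diff[OF Rep_lin[OF MR zx(3) c(3) zx(2)] sub w'(1) w] w'(2) in simp)
    then have "w' = w" by simp
    then show ?thesis unfolding \<iota>_def w'_def[symmetric] c(2) by simp
  qed
  have pre: "\<exists>w. w \<in> sp M (floor_in R x) \<and> v = mp M (floor_in R x) x w"
    if x: "x \<in> ceil_in P Q y" and v: "v \<in> sp M x" for x y v
    by (rule tame_surj[OF tm z(4)[OF x] v]) blast
  have \<iota>lin: "lin_on (sp M x) (sp M (t y)) (\<iota> x)" if x: "x \<in> ceil_in P Q y" for x y
  proof -
    note zx = z[OF x] and c = ceil[OF x]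
    note l1 = Rep_lin[OF MR zx(3) c(3) zx(2)] and l2 = Rep_lin[OF MR zx(3) tP[OF zx(7)] zx(6)]
      and sub = Rep_subspace[OF MR zx(3)]
    show ?thesis
      unfolding lin_on_def
    proof (intro conjI ballI allI)
      show "\<iota> x ` sp M x \<subseteq> sp M (t y)"
      proof (intro image_subsetI)
        fix v assume "v \<in> sp M x"
        then obtain w where w: "w \<in> sp M (floor_in R x)" "v = mp M (floor_in R x) x w" using pre[OF x] by blast
        show "\<iota> x v \<in> sp M (t y)" unfolding w(2) \<iota>v[OF x w(1)] by (rule lin_on_mem[OF l2 w(1)])
      qed
      fix u assume "u \<in> sp M x"
      then obtain w where w: "w \<in> sp M (floor_in R x)" "u = mp M (floor_in R x) x w" using pre[OF x] by blast
      show "\<iota> x (c *s u) = c *s \<iota> x u" for c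
        using \<iota>v[OF x subspace_scale[OF sub w(1)], of c] \<iota>v[OF x w(1)] lin_on_scale[OF l1 w(1)]
          lin_on_scale[OF l2 w(1)] w(2) by simp
      fix v assume "v \<in> sp M x"
      then obtain w2 where w2: "w2 \<in> sp M (floor_in R x)" "v = mp M (floor_in R x) x w2" using pre[OF x] by blast
      show "\<iota> x (u + v) = \<iota> x u + \<iota> x v"
        using \<iota>v[OF x subspace_add[OF sub w(1) w2(1)]] \<iota>v[OF x w(1)] \<iota>v[OF x w2(1)]
          lin_on_add[OF l1 w(1) w2(1)] lin_on_add[OF l2 w(1) w2(1)] w(2) w2(2) by simp
    qed
  qed
  \<comment> \<open>For \<open>y = y'\<close> this gives the cocone condition, for \<open>x'\<close>
    a join the compatibility demanded of a contraction, and in general the naturality of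
    \<open>\<eta>\<close>.\<close>
  have nat: "\<iota> x' (mp M x x' v) = mp M (t y) (t y') (\<iota> x v)"
    if x: "x \<in> ceil_in P Q y" and x': "x' \<in> ceil_in P Q y'" and le: "x \<le> x'" and v: "v \<in> sp M x"
    for x x' y y' v
  proof -
    note zx = z[OF x] and c = ceil[OF x] and zx' = z[OF x'] and c' = ceil[OF x']
    obtain w where w: "w \<in> sp M (floor_in R x)" "v = mp M (floor_in R x) x w" using pre[OF x v] by blast
    have zz: "floor_in R x \<le> floor_in R x'"
      by (rule floor_in_mono[OF flR zx(4) le c'(3)])
    have yy: "y \<le> y'"
      using floor_in_mono[OF flQ c(1) le c'(3)] unfolding c(2) c'(2) .
    have "mp M x x' v = mp M (floor_in R x') x' (mp M (floor_in R x) (floor_in R x') w)"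
      using Rep_trans[OF MR zx(3) c(3) c'(3) zx(2) le w(1)]
        Rep_trans[OF MR zx(3) zx'(3) c'(3) zz zx'(2) w(1)] w(2) by simp
    then have "\<iota> x' (mp M x x' v) = mp M (floor_in R x') (t y') (mp M (floor_in R x) (floor_in R x') w)"
      using \<iota>v[OF x' Rep_mem[OF MR zx(3) zx'(3) zz w(1)]] by simp
    also have "\<dots> = mp M (t y) (t y') (mp M (floor_in R x) (t y) w)"
      using Rep_trans[OF MR zx(3) zx'(3) tP[OF zx'(7)] zz zx'(6) w(1)]
        Rep_trans[OF MR zx(3) tP[OF zx(7)] tP[OF zx'(7)] zx(6) tmono[OF zx(7) zx'(7) yy] w(1)] by simp
    also have "\<dots> = mp M (t y) (t y') (\<iota> x v)"
      unfolding w(2) \<iota>v[OF x w(1)] ..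
    finally show ?thesis .
  qed
  have \<iota>t: "\<iota> (t y) w = w" if y: "y \<in> Q" and w: "w \<in> sp M (t y)" for y w
  proof -
    have f: "floor_in R (t y) = t y" by (rule floor_in_self[OF t(1)[OF y]])
    show ?thesis
      using \<iota>v[OF t(2)[OF y], of w] w Rep_refl[OF MR tP[OF y] w] unfolding f by simp
  qed
  have colim: "is_colimit (ceil_in P Q y) M (sp N0 y) \<iota>" if y: "y \<in> Q" for y
    unfolding is_colimit_def
  proof (intro conjI allI impI)
    show "cocone (ceil_in P Q y) M (sp N0 y) \<iota>"
      unfolding cocone_def N0s
    proof (intro conjI ballI impI)
      show "subspace (sp M (t y))" by (rule Rep_subspace[OF MR tP[OF y]])
      fix x assume x: "x \<in> ceil_in P Q y"
      show "lin_on (sp M x) (sp M (t y)) (\<iota> x)" by (rule \<iota>lin[OF x])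
      fix x' v assume x': "x' \<in> ceil_in P Q y" "x \<le> x'" and v: "v \<in> sp M x"
      show "\<iota> x' (mp M x x' v) = \<iota> x v"
        using nat[OF x x' v] Rep_refl[OF MR tP[OF y] lin_on_mem[OF \<iota>lin[OF x] v]] by simp
    qed
    fix W' \<kappa> assume k: "cocone (ceil_in P Q y) M W' \<kappa>"
    have k1: "\<And>x. x \<in> ceil_in P Q y \<Longrightarrow> lin_on (sp M x) W' (\<kappa> x)"
      and k2: "\<And>x x' v. x \<in> ceil_in P Q y \<Longrightarrow> x' \<in> ceil_in P Q y \<Longrightarrow> x \<le> x' \<Longrightarrow> v \<in> sp M x \<Longrightarrow>
        \<kappa> x' (mp M x x' v) = \<kappa> x v"
      using k unfolding cocone_def by simp_all
    have h\<iota>: "\<kappa> (t y) (\<iota> x v) = \<kappa> x v" if x: "x \<in> ceil_in P Q y" and v: "v \<in> sp M x" for x v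
    proof -
      note zx = z[OF x]
      obtain w where w: "w \<in> sp M (floor_in R x)" "v = mp M (floor_in R x) x w" using pre[OF x v] by blast
      show ?thesis
        using k2[OF zx(5) t(2)[OF y] zx(6) w(1)] k2[OF zx(5) x zx(2) w(1)] \<iota>v[OF x w(1)] w(2) by simp
    qed
    show "\<exists>h. lin_on (sp N0 y) W' h \<and> (\<forall>x\<in>ceil_in P Q y. \<forall>v\<in>sp M x. h (\<iota> x v) = \<kappa> x v) \<and>
        (\<forall>h'. lin_on (sp N0 y) W' h' \<and> (\<forall>x\<in>ceil_in P Q y. \<forall>v\<in>sp M x. h' (\<iota> x v) = \<kappa> x v) \<longrightarrow>
          (\<forall>w\<in>sp N0 y. h' w = h w))"
    \<comment> \<open>The mediating map is the leg of the cocone at \<open>t y\<close>; it is unique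
      because \<open>\<iota> (t y)\<close> is the identity.\<close>
    proof (intro exI[of _ "\<kappa> (t y)"] conjI ballI allI impI)
      show "lin_on (sp N0 y) W' (\<kappa> (t y))" unfolding N0s by (rule k1[OF t(2)[OF y]])
      show "\<kappa> (t y) (\<iota> x v) = \<kappa> x v" if "x \<in> ceil_in P Q y" "v \<in> sp M x" for x v
        by (rule h\<iota>[OF that])
      fix h' w
      assume h': "lin_on (sp N0 y) W' h' \<and> (\<forall>x\<in>ceil_in P Q y. \<forall>v\<in>sp M x. h' (\<iota> x v) = \<kappa> x v)"
        and w: "w \<in> sp N0 y"
      have "h' (\<iota> (t y) w) = \<kappa> (t y) w"
        using h' t(2)[OF y] w unfolding N0s by simp
      then show "h' w = \<kappa> (t y) w"
        using \<iota>t[OF y] w unfolding N0s by simp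
    qed
  qed
  have contr: "is_contraction P Q M N0"
    unfolding is_contraction_def
  proof (intro conjI N0R exI[of _ \<iota>] ballI impI)
    show "is_colimit (ceil_in P Q y) M (sp N0 y) \<iota>" if "y \<in> Q" for y by (rule colim[OF that])
    fix y y' x v assume y: "y \<in> Q" "y' \<in> Q" "y \<le> y'" and x: "x \<in> ceil_in P Q y" and v: "v \<in> sp M x"
    note j = join[OF y(2,3) x]
    show "mp N0 y y' (\<iota> x v) = \<iota> (join_in P y' x) (mp M x (join_in P y' x) v)"
      unfolding N0s using nat[OF x j(1) j(2) v] by simp
  qed
  define \<eta> where "\<eta> x v = (if x \<in> upper P Q then \<iota> x v else 0)" for x v
  have cl: "x \<in> ceil_in P Q (floor_in Q x)" if "x \<in> upper P Q" for x
    using that unfolding ceil_in_def by simp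
  have \<eta>: "\<eta> \<in> Hom P M (extension P Q N0)"
  proof (rule HomI)
    fix x assume x: "x \<in> P"
    show "lin_on (sp M x) (sp (extension P Q N0) x) (\<eta> x)"
    proof (cases "x \<in> upper P Q")
      case True
      then show ?thesis using \<iota>lin[OF cl[OF True]] by (simp add: extension_sp N0s \<eta>_def lin_on_def)
    next
      case False
      then show ?thesis by (auto simp: extension_sp_zero \<eta>_def lin_on_def)
    qed
    fix x' v assume x': "x' \<in> P" "x \<le> x'" and v: "v \<in> sp M x"
    show "\<eta> x' (mp M x x' v) = mp (extension P Q N0) x x' (\<eta> x v)"
    proof (cases "x \<in> upper P Q")
      case True
      note u' = upper_up[OF True x'(2,1)]
      show ?thesis
        using nat[OF cl[OF True] cl[OF u'] x'(2) v] True u' x' by (simp add: extension_mp N0s \<eta>_def)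
    next
      case False
      have "v = 0" using v Mz[OF x False] by simp
      then have "mp M x x' v = 0" using lin_on_zero[OF Rep_lin[OF MR x x'] Rep_subspace[OF MR x]] by simp
      moreover have "\<eta> x' 0 = 0"
        using lin_on_zero[OF \<iota>lin[OF cl] Rep_subspace[OF MR x'(1)]] by (simp add: \<eta>_def)
      ultimately show ?thesis using False by (simp add: extension_mp_zero)
    qed
  qed
  have fac: "\<exists>f'\<in>Hom Q N0 N. mor_eq P M (comp_mor (ext_mor P Q f') \<eta>) f"
    if N: "N \<in> fp_rep Q" and f: "f \<in> Hom P M (extension P Q N)" for N f
  proof (rule bexI)
    have NR: "N \<in> Rep Q" using N fp_rep_Rep by blast
    let ?E = "extension P Q N"
    have Emp: "mp ?E x x' u = mp N y y' u" if "x \<in> ceil_in P Q y" "x' \<in> ceil_in P Q y'" "x \<le> x'" for x x' y y' u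
      using extension_mp[OF ceil(1)[OF that(1)] ceil(3)[OF that(2)] that(3)] ceil(2)[OF that(1)] ceil(2)[OF that(2)]
      by simp
    have Esp: "sp ?E x = sp N y" if "x \<in> ceil_in P Q y" for x y
      using extension_sp[OF ceil(1)[OF that]] ceil(2)[OF that] by simp
    \<comment> \<open>The factor is the component of \<open>f\<close> at \<open>t y\<close>; it
      lands in \<open>sp N y\<close> because the extension is constant on fibres.\<close>
    show "(\<lambda>y. f (t y)) \<in> Hom Q N0 N"
    proof (rule HomI)
      fix y assume y: "y \<in> Q"
      show "lin_on (sp N0 y) (sp N y) (f (t y))"
        using Hom_lin[OF f tP[OF y]] unfolding N0s Esp[OF t(2)[OF y]] .
      fix y' v assume y': "y' \<in> Q" "y \<le> y'" and v: "v \<in> sp N0 y"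
      show "f (t y') (mp N0 y y' v) = mp N y y' (f (t y) v)"
        using Hom_nat[OF f tP[OF y] tP[OF y'(1)] tmono[OF y y'] v[unfolded N0s]]
          Emp[OF t(2)[OF y] t(2)[OF y'(1)] tmono[OF y y']] unfolding N0s by simp
    qed
    show "mor_eq P M (comp_mor (ext_mor P Q (\<lambda>y. f (t y))) \<eta>) f"
    proof (rule mor_eqI)
      fix x v assume x: "x \<in> P" and v: "v \<in> sp M x"
      show "comp_mor (ext_mor P Q (\<lambda>y. f (t y))) \<eta> x v = f x v"
      proof (cases "x \<in> upper P Q")
        case True
        let ?y = "floor_in Q x"
        note c = cl[OF True]
        note zx = z[OF c]
        obtain w where w: "w \<in> sp M (floor_in R x)" "v = mp M (floor_in R x) x w" using pre[OF c v] by blast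
        have "f (t ?y) (\<iota> x v) = mp ?E (floor_in R x) (t ?y) (f (floor_in R x) w)"
          using \<iota>v[OF c w(1)] w(2) Hom_nat[OF f zx(3) tP[OF zx(7)] zx(6) w(1)] by simp
        also have "\<dots> = mp ?E (floor_in R x) x (f (floor_in R x) w)"
          unfolding Emp[OF zx(5) t(2)[OF zx(7)] zx(6)] Emp[OF zx(5) c zx(2)] ..
        also have "\<dots> = f x v"
          using Hom_nat[OF f zx(3) x zx(2) w(1)] w(2) by simp
        finally show ?thesis using True by (simp add: ext_mor_def \<eta>_def)
      next
        case False
        then have "v = 0" using v Mz[OF x False] by simp
        then show ?thesis using False Hom_vanish[OF f MR x] by (simp add: ext_mor_def)
      qed
    qed
  qed
  show ?thesis by (rule that[OF N0fp contr \<eta> fac])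
qed


subsection \<open>Precovers\<close>

text \<open>A precover given by finitely many morphisms in place of one from their direct sum.
  Surjectivity is not recorded; it will follow from the principal representations in
  \<open>X\<close>.\<close>

definition precovered :: "'p::order set \<Rightarrow> ('p, 'b) prep set \<Rightarrow> ('p, 'b) prep \<Rightarrow> bool" where
  "precovered P X M \<longleftrightarrow> (\<exists>G. finite G \<and> G \<subseteq> into P X M \<and> (\<forall>U\<in>X. \<forall>h\<in>Hom P U M. h \<in> gen P G U))"

text \<open>A family with sources in \<open>add P C X\<close> is refined to one with sources in
  \<open>X\<close>, each of its morphisms being a finite sum through members of
  \<open>X\<close>.\<close>

lemma precovered_add:
  assumes "C \<subseteq> Rep P" "M \<in> Rep P" "finite G" "G \<subseteq> into P (add P C X) M"
    and "\<And>U h. U \<in> X \<Longrightarrow> h \<in> Hom P U M \<Longrightarrow> h \<in> gen P G U"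
  shows "precovered P X M"
proof -
  have "\<exists>F. finite F \<and> F \<subseteq> into P X M \<and> snd p \<in> gen P F (fst p)" if p: "p \<in> G" for p
  proof -
    obtain A g where Ag: "p = (A, g)" by (cases p)
    have A: "A \<in> add P C X" "g \<in> Hom P A M" using p Ag assms(4) unfolding into_def by auto
    have "g \<in> gen P (into P X M) A"
      by (rule retract_of_gen_trans[OF add_retract_of[OF A(1) assms(1)] A(2) add_Rep[OF A(1) assms(1)]])
        (rule gen_base, simp add: into_def)
    then obtain F where "finite F" "F \<subseteq> into P X M" "g \<in> gen P F A" by (rule gen_finite)
    then show ?thesis using Ag by auto
  qed
  then obtain F where F: "\<And>p. p \<in> G \<Longrightarrow> finite (F p) \<and> F p \<subseteq> into P X M \<and> snd p \<in> gen P (F p) (fst p)"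
    by metis
  let ?F = "\<Union>p\<in>G. F p"
  have "finite ?F" "?F \<subseteq> into P X M" using F assms(3) by auto
  moreover have "h \<in> gen P ?F U" if "U \<in> X" "h \<in> Hom P U M" for U h
  proof (rule gen_trans[OF assms(5)[OF that]])
    fix A g assume Ag: "(A, g) \<in> G"
    then have "g \<in> gen P (F (A, g)) A" using F[OF Ag] by simp
    then show "g \<in> gen P ?F A" by (rule gen_mono) (use Ag in blast)
  qed
  ultimately show ?thesis unfolding precovered_def by blast
qed

lemma direct_sum_hom:
  assumes "direct_sum P Ms S" "M \<in> Rep P" "S \<in> Rep P" "set Ms \<subseteq> Rep P"
    and "\<And>j. j < length Ms \<Longrightarrow> f j \<in> Hom P (Ms ! j) M"
  obtains \<iota> g where "g \<in> Hom P S M" "\<And>j. j < length Ms \<Longrightarrow> \<iota> j \<in> Hom P (Ms ! j) S"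
    "\<And>j. j < length Ms \<Longrightarrow> mor_eq P (Ms ! j) (comp_mor g (\<iota> j)) (f j)"
proof -
  obtain \<iota> \<pi> where *: "\<forall>j<length Ms. \<iota> j \<in> Hom P (Ms ! j) S \<and> \<pi> j \<in> Hom P S (Ms ! j)"
      "\<forall>j<length Ms. \<forall>k<length Ms.
        mor_eq P (Ms ! j) (comp_mor (\<pi> k) (\<iota> j)) (if j = k then id_mor else zero_mor)"
    using assms(1) unfolding direct_sum_def by blast
  define g where "g = (\<lambda>x u. \<Sum>j<length Ms. comp_mor (f j) (\<pi> j) x u)"
  have "g \<in> Hom P S M"
    unfolding g_def by (rule Hom_sum[OF Hom_comp[OF _ assms(5)] assms(2)]) (use * in auto)
  moreover have "mor_eq P (Ms ! i) (comp_mor g (\<iota> i)) (f i)" if i: "i < length Ms" for i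
  proof (rule mor_eqI)
    fix x v assume x: "x \<in> P" and v: "v \<in> sp (Ms ! i) x"
    have "comp_mor g (\<iota> i) x v = (\<Sum>j<length Ms. if j = i then f i x v else 0)"
      unfolding g_def comp_mor_apply
    proof (rule sum.cong[OF refl])
      fix j assume "j \<in> {..<length Ms}"
      then have j: "j < length Ms" by simp
      have "\<pi> j x (\<iota> i x v) = (if i = j then v else 0)"
        using mor_eqD[OF *(2)[rule_format, OF i j] x v] by (simp split: if_splits)
      moreover have "f j x 0 = 0"
        by (rule Hom_vanish[OF assms(5)[OF j] _ x]) (use assms(4) j in auto)
      ultimately show "f j x (\<pi> j x (\<iota> i x v)) = (if j = i then f i x v else 0)" by auto
    qed
    then show "comp_mor g (\<iota> i) x v = f i x v" using i by simp
  qed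
  ultimately show ?thesis using that[of g \<iota>] * by blast
qed

section \<open>Principal representations are indecomposable and projective\<close>

lemma principal_ind:
  assumes "principal x \<in> C" "C \<subseteq> Rep P" "x \<in> P"
  shows "principal x \<in> ind P C"
  unfolding ind_def
proof (intro CollectI conjI ballI impI)
  have e: "e0 \<in> sp (principal x) x" by (rule e0_principal[OF order_refl])
  show "\<not> is_zero P (principal x)"
    unfolding is_zero_def using e e0_nonzero assms(3) by auto
  fix A B assume AB: "A \<in> C" "B \<in> C" and s: "direct_sum P [A, B] (principal x)"
  have R: "A \<in> Rep P" "B \<in> Rep P" using AB assms(2) by auto
  obtain i p j q where h: "i \<in> Hom P A (principal x)" "p \<in> Hom P (principal x) A"
      "j \<in> Hom P B (principal x)" "q \<in> Hom P (principal x) B"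
    and pi: "mor_eq P A (comp_mor p i) id_mor" "mor_eq P B (comp_mor q j) id_mor"
    and qi: "mor_eq P A (comp_mor q i) zero_mor"
    by (rule direct_sum_pair[OF s])
  \<comment> \<open>The projection to a nonzero summand cannot kill \<open>e0\<close>, which
    generates \<open>principal x\<close>; the inclusion of the summand is injective, so it does not
    kill the image of \<open>e0\<close> either.\<close>
  have key: "p' x e0 \<noteq> 0 \<and> i' x (p' x e0) \<noteq> 0"
    if nz: "\<not> is_zero P A'" and A': "A' \<in> Rep P" and i': "i' \<in> Hom P A' (principal x)"
      and p': "p' \<in> Hom P (principal x) A'" and pi': "mor_eq P A' (comp_mor p' i') id_mor" for A' i' p'
  proof -
    obtain y a where y: "y \<in> P" "a \<in> sp A' y" "a \<noteq> 0"
      using nz subspace_0[OF Rep_subspace[OF A']] unfolding is_zero_def by fastforce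
    have pa: "p' y (i' y a) = a" using mor_eqD[OF pi' y(1,2)] by simp
    have "p' x e0 \<noteq> 0"
    proof
      assume p0: "p' x e0 = 0"
      from Hom_mem[OF i' y(1,2)] have "p' y (i' y a) = 0"
      proof (cases rule: principal_cases)
        case (1 c)
        have "mp A' x y 0 = 0"
          by (rule lin_on_zero[OF Rep_lin[OF A' assms(3) y(1) 1(1)] Rep_subspace[OF A' assms(3)]])
        then show ?thesis
          using principal_hom_val[OF p' assms(3) y(1) 1(1), of c] 1(2) p0 by simp
      next
        case 2
        then show ?thesis using Hom_vanish[OF p' principal_Rep y(1)] by simp
      qed
      then show False using pa y(3) by simp
    qed
    moreover have "p' x (i' x (p' x e0)) = p' x e0"
      using mor_eqD[OF pi' assms(3) Hom_mem[OF p' assms(3) e]] by simp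
    ultimately show ?thesis using Hom_vanish[OF p' principal_Rep assms(3)] by metis
  qed
  show "is_zero P A \<or> is_zero P B"
  proof (rule ccontr)
    assume "\<not> (is_zero P A \<or> is_zero P B)"
    then have "i x (p x e0) \<noteq> 0" "q x e0 \<noteq> 0" "p x e0 \<noteq> 0"
      using key[OF _ R(1) h(1,2) pi(1)] key[OF _ R(2) h(3,4) pi(2)] by auto
    \<comment> \<open>The space at \<open>x\<close> is a line, so \<open>i x (p x e0)\<close> is a
      nonzero multiple of \<open>e0\<close>. It is killed by \<open>q\<close>, although
      \<open>e0\<close> is not.\<close>
    moreover obtain c where c: "i x (p x e0) = c *s e0"
      using Hom_mem[OF h(1) assms(3) Hom_mem[OF h(2) assms(3) e]] unfolding principal_sp span_singleton by auto
    moreover have "q x (i x (p x e0)) = 0"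
      using mor_eqD[OF qi assms(3) Hom_mem[OF h(2) assms(3) e]] by simp
    moreover have "q x (c *s e0) = c *s q x e0"
      by (rule lin_on_scale[OF Hom_lin[OF h(4) assms(3)] e])
    ultimately show False by auto
  qed
qed (rule assms(1))

lemma principal_ind_proj:
  assumes "floor_cofinal P" "x \<in> P"
  shows "principal x \<in> ind P (fp_rep P) \<inter> proj P (fp_rep P)"
proof
  note fp = principal_fp_rep[OF assms]
  show "principal x \<in> ind P (fp_rep P)" by (rule principal_ind[OF fp fp_rep_Rep assms(2)])
  have "retract_of P (principal ` {x}) (principal x)"
    by (rule retract_ofI[OF _ Hom_id Hom_id]) (simp_all add: mor_eq_def)
  then show "principal x \<in> proj P (fp_rep P)"
    by (rule proj_principals[OF _ _ fp fp_rep_Rep fp_rep_epi_surj[OF assms(1)]]) (use assms(2) in simp)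
qed

section \<open>Precovers from finite families\<close>

lemma precovered_precover:
  assumes "floor_cofinal P" "X \<subseteq> fp_rep P" "\<And>x. x \<in> P \<Longrightarrow> principal x \<in> X"
    and "M \<in> fp_rep P" "precovered P X M"
  obtains U g where "precover P (fp_rep P) X U g M"
proof -
  obtain G where G: "finite G" "G \<subseteq> into P X M" "\<And>U h. U \<in> X \<Longrightarrow> h \<in> Hom P U M \<Longrightarrow> h \<in> gen P G U"
    using assms(5) unfolding precovered_def by blast
  obtain gs where gs: "set gs = G" using finite_list[OF G(1)] by blast
  let ?Ms = "map fst gs"
  have gj: "fst (gs ! j) \<in> X \<and> snd (gs ! j) \<in> Hom P (fst (gs ! j)) M" if "j < length gs" for j
    using nth_mem[OF that] gs G(2) unfolding into_def by auto
  have MsX: "set ?Ms \<subseteq> X" using gs G(2) unfolding into_def by auto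
  then have Msfp: "set ?Ms \<subseteq> fp_rep P" using assms(2) by blast
  obtain U where U: "U \<in> fp_rep P" "direct_sum P ?Ms U"
    by (rule fp_rep_direct_sum_exists[OF assms(1) Msfp])
  have UR: "U \<in> Rep P" and MR: "M \<in> Rep P" using U(1) assms(4) fp_rep_Rep by blast+
  obtain \<iota> g where g: "g \<in> Hom P U M"
      and \<iota>: "\<And>j. j < length ?Ms \<Longrightarrow> \<iota> j \<in> Hom P (?Ms ! j) U"
      and g\<iota>: "\<And>j. j < length ?Ms \<Longrightarrow> mor_eq P (?Ms ! j) (comp_mor g (\<iota> j)) (snd (gs ! j))"
    by (rule direct_sum_hom[OF U(2) MR UR subset_trans[OF Msfp fp_rep_Rep], of "\<lambda>j. snd (gs ! j)"])
      (use gj in auto)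
  have surjX: "Hom_surj P V U g M" if V: "V \<in> X" for V
    unfolding Hom_surj_def
  proof
    fix h assume h: "h \<in> Hom P V M"
    show "\<exists>k\<in>Hom P V U. mor_eq P V (comp_mor g k) h"
    proof (rule gen_lift[OF G(3)[OF V h] g UR])
      fix A b assume "(A, b) \<in> G"
      then obtain j where j: "j < length gs" "gs ! j = (A, b)"
        using gs by (auto simp: in_set_conv_nth)
      then show "\<exists>k\<in>Hom P A U. mor_eq P A (comp_mor g k) b"
        using \<iota>[of j] g\<iota>[of j] by (intro bexI[of _ "\<iota> j"]) simp_all
    qed
  qed
  \<comment> \<open>The principal representations are members of \<open>X\<close>, so lifting from
    \<open>X\<close> already gives pointwise surjectivity.\<close>
  have surj: "surj_mor P U g M"
    by (rule surj_mor_principal[OF g MR surjX[OF assms(3)]])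
  let ?K = "kernel_rep U g"
  have K: "?K \<in> fp_rep P" by (rule fp_rep_kernel[OF assms(1) U(1) assms(4) g])
  have ker: "is_kernel P (fp_rep P) ?K id_mor U g M"
    by (rule kernel_rep_is_kernel[OF U(1) assms(4) g K])
  have "is_cokernel P (fp_rep P) ?K id_mor U g M"
    by (rule is_cokernelI[OF K U(1) assms(4) fp_rep_Rep kernel_rep_incl g surj]) auto
  then have "admissible P (fp_rep P) X U g M"
    unfolding admissible_def rel_exact_def short_exact_def
    using ker surjX surj_mor_epi[OF U(1) assms(4) g surj] by blast
  moreover have "U \<in> add P (fp_rep P) X"
    by (rule add.sum[OF _ U]) (use MsX Msfp add.base in blast)
  ultimately have "precover P (fp_rep P) X U g M" unfolding precover_def by blast
  then show ?thesis by (rule that)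
qed

lemma add_rel_proj:
  assumes "C \<subseteq> Rep P"
  shows "add P C X \<subseteq> rel_proj P C X"
proof
  fix U assume U: "U \<in> add P C X"
  show "U \<in> rel_proj P C X"
    unfolding rel_proj_def
  proof (intro CollectI conjI allI impI add_subset[OF U])
    fix M g N assume adm: "admissible P C X M g N"
    then have "M \<in> C" "g \<in> Hom P M N" "\<And>A. A \<in> X \<Longrightarrow> Hom_surj P A M g N"
      unfolding admissible_def epi_def rel_exact_def by auto
    then show "Hom_surj P U M g N"
      using assms by (intro Hom_surj_retract[OF add_retract_of[OF U assms] add_Rep[OF U assms]]) auto
  qed
qed

lemma enough_rel_proj_iff_precovered:
  assumes "floor_cofinal P" "X \<subseteq> fp_rep P" "\<And>x. x \<in> P \<Longrightarrow> principal x \<in> X"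
  shows "rel_proj P (fp_rep P) X = add P (fp_rep P) X \<and> enough_rel_proj P (fp_rep P) X \<longleftrightarrow>
    (\<forall>M\<in>fp_rep P. precovered P X M)"
proof (intro iffI ballI)
  fix M
  assume "rel_proj P (fp_rep P) X = add P (fp_rep P) X \<and> enough_rel_proj P (fp_rep P) X"
    and M: "M \<in> fp_rep P"
  then obtain U g where U: "U \<in> add P (fp_rep P) X" and adm: "admissible P (fp_rep P) X U g M"
    unfolding enough_rel_proj_def precover_def by blast
  have UR: "U \<in> Rep P" and MR: "M \<in> Rep P"
    using add_Rep[OF U fp_rep_Rep] M fp_rep_Rep by blast+
  have g: "g \<in> Hom P U M" and surjX: "\<And>V. V \<in> X \<Longrightarrow> Hom_surj P V U g M"
    using adm unfolding admissible_def epi_def rel_exact_def by auto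
  show "precovered P X M"
  proof (rule precovered_add[OF fp_rep_Rep MR, of "{(U, g)}"])
    show "{(U, g)} \<subseteq> into P (add P (fp_rep P) X) M" using U g unfolding into_def by simp
    fix V h assume V: "V \<in> X" and h: "h \<in> Hom P V M"
    obtain k where k: "k \<in> Hom P V U" "mor_eq P V (comp_mor g k) h"
      using surjX[OF V] h unfolding Hom_surj_def by blast
    show "h \<in> gen P {(U, g)} V"
      by (rule gen.eq[OF gen_single[OF _ k(1)] k(2)]) simp
  qed simp
next
  assume pre: "\<forall>M\<in>fp_rep P. precovered P X M"
  have cover: "\<exists>U g. precover P (fp_rep P) X U g M" if M: "M \<in> fp_rep P" for M
    by (rule precovered_precover[OF assms M pre[rule_format, OF M]]) blast+
  have "rel_proj P (fp_rep P) X \<subseteq> add P (fp_rep P) X"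
  proof
    fix U assume U: "U \<in> rel_proj P (fp_rep P) X"
    then have Ufp: "U \<in> fp_rep P" unfolding rel_proj_def by blast
    obtain V g where V: "V \<in> add P (fp_rep P) X" and adm: "admissible P (fp_rep P) X V g U"
      using cover[OF Ufp] unfolding precover_def by blast
    have Vfp: "V \<in> fp_rep P" using add_subset[OF V] .
    have g: "g \<in> Hom P V U" using adm unfolding admissible_def epi_def by blast
    have "Hom_surj P U V g U" using U adm unfolding rel_proj_def by blast
    then obtain s where s: "s \<in> Hom P U V" "mor_eq P U (comp_mor g s) id_mor"
      using Hom_id[of P U] unfolding Hom_surj_def by blast
    \<comment> \<open>The complement of \<open>U\<close> is the kernel of \<open>g\<close>, which
      has to be finitely presentable for the splitting to take place in
      \<open>fp_rep P\<close>.\<close>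
    have "direct_summand P (fp_rep P) U V"
      by (rule retract_direct_summand[OF fp_rep_Rep Ufp Vfp s(1) g s(2) fp_rep_kernel[OF assms(1) Vfp Ufp g]])
    then show "U \<in> add P (fp_rep P) X" by (rule add.summand[OF V])
  qed
  then have "rel_proj P (fp_rep P) X = add P (fp_rep P) X"
    using add_rel_proj[OF fp_rep_Rep] by blast
  then show "rel_proj P (fp_rep P) X = add P (fp_rep P) X \<and> enough_rel_proj P (fp_rep P) X"
    unfolding enough_rel_proj_def using cover by auto
qed


subsection \<open>Transfer between the grid and its subgrids\<close>

text \<open>The class conditions enter only as inclusions into the two \<open>add\<close> closures.
  As \<open>con\<close> speaks of every contraction, it applies to the one constructed
  explicitly.\<close>

lemma precovered_from_subgrid:
  fixes M :: "(nat \<Rightarrow> 't::linorder, 'b) prep"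
  assumes P: "P = grid_poset n T" and Q: "Q \<in> subgrids n T"
    and ext: "\<And>Y. Y \<in> Y0 \<Longrightarrow> Y \<in> fp_rep Q \<and> extension P Q Y \<in> add P (fp_rep P) X"
    and con: "\<And>A N. A \<in> X \<inter> supp_rep P Q \<Longrightarrow> N \<in> fp_rep Q \<Longrightarrow> is_contraction P Q A N \<Longrightarrow> N \<in> add Q (fp_rep Q) Y0"
    and X: "X \<subseteq> fp_rep P"
    and orth: "\<And>N A f. N \<in> fp_rep Q \<Longrightarrow> A \<in> X - supp_rep P Q \<Longrightarrow> f \<in> Hom P A (extension P Q N) \<Longrightarrow>
      mor_eq P A f zero_mor"
    and M: "M \<in> Rep P" "tame P Q M" and pre: "\<And>N. N \<in> fp_rep Q \<Longrightarrow> precovered Q Y0 N"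
  shows "precovered P X M"
proof -
  have flQ: "has_floors P Q" and finQ: "finite Q"
    using subgrid_has_floors[OF Q] subgrid_finite[OF Q] unfolding P by auto
  let ?E = "extension P Q"
  obtain a b where MQ: "M \<in> fp_rep Q" and a: "a \<in> Hom P M (?E M)" and b: "b \<in> Hom P (?E M) M"
      and ba: "mor_eq P M (comp_mor b a) id_mor"
    by (rule tame_extension_iso[OF M(2,1) flQ finQ])
  have MRQ: "M \<in> Rep Q" using MQ fp_rep_Rep by blast
  have EM: "?E M \<in> Rep P" by (rule extension_Rep[OF MRQ flQ])
  obtain G where G: "finite G" "G \<subseteq> into Q Y0 M" "\<And>U h. U \<in> Y0 \<Longrightarrow> h \<in> Hom Q U M \<Longrightarrow> h \<in> gen Q G U"
    using pre[OF MQ] unfolding precovered_def by blast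
  have GY: "A \<in> Y0" "g \<in> Hom Q A M" "A \<in> Rep Q" if "(A, g) \<in> G" for A g
    using that G(2) ext fp_rep_Rep unfolding into_def by blast+
  \<comment> \<open>\<open>F\<close> extends the family over \<open>Q\<close> to a family into
    \<open>?E M\<close>; \<open>F'\<close> carries it on to \<open>M\<close> along
    \<open>b\<close>.\<close>
  define F where "F = (\<lambda>(A, g). (?E A, ext_mor P Q g)) ` G"
  define F' where "F' = (\<lambda>(A, g). (A, comp_mor b g)) ` F"
  have FE: "F \<subseteq> into P UNIV (?E M)"
    unfolding F_def into_def using ext_mor_Hom[OF GY(2) GY(3) MRQ flQ] by auto
  show ?thesis
  proof (rule precovered_add[OF fp_rep_Rep M(1), of F'])
    show "finite F'" unfolding F'_def F_def using G(1) by simp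
    show "F' \<subseteq> into P (add P (fp_rep P) X) M"
    proof
      fix p assume "p \<in> F'"
      then obtain A g where p: "p = (?E A, comp_mor b (ext_mor P Q g))" "(A, g) \<in> G"
        unfolding F'_def F_def by auto
      have "comp_mor b (ext_mor P Q g) \<in> Hom P (?E A) M"
        by (rule Hom_comp[OF ext_mor_Hom[OF GY(2)[OF p(2)] GY(3)[OF p(2)] MRQ flQ] b])
      then show "p \<in> into P (add P (fp_rep P) X) M"
        using ext[OF GY(1)[OF p(2)]] p(1) unfolding into_def by simp
    qed
    fix U h assume U: "U \<in> X" and h: "h \<in> Hom P U M"
    have UR: "U \<in> Rep P" using U X fp_rep_Rep by blast
    have ah: "comp_mor a h \<in> Hom P U (?E M)" by (rule Hom_comp[OF h a])
    have "comp_mor a h \<in> gen P F U"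
    proof (cases "U \<in> supp_rep P Q")
      case False
      then show ?thesis
        using mor_eq_sym[OF orth[OF MQ _ ah]] U by (intro gen.eq[OF gen.zero]) blast
    next
      case True
      obtain N0 \<eta> where N0: "N0 \<in> fp_rep Q" "is_contraction P Q U N0" and \<eta>: "\<eta> \<in> Hom P U (?E N0)"
        and uni: "\<And>N f. N \<in> fp_rep Q \<Longrightarrow> f \<in> Hom P U (?E N) \<Longrightarrow>
          \<exists>f'\<in>Hom Q N0 N. mor_eq P U (comp_mor (ext_mor P Q f') \<eta>) f"
        by (rule contraction_exists[OF P Q True]) blast
      have N0a: "N0 \<in> add Q (fp_rep Q) Y0" using con[OF _ N0] U True by blast
      have N0R: "N0 \<in> Rep Q" using N0(1) fp_rep_Rep by blast
      obtain f' where f': "f' \<in> Hom Q N0 M" "mor_eq P U (comp_mor (ext_mor P Q f') \<eta>) (comp_mor a h)"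
        using uni[OF MQ ah] by blast
      \<comment> \<open>The contraction \<open>N0\<close> is only a retract of a sum of members of
        \<open>Y0\<close>; this is enough for the family \<open>G\<close> to approximate
        \<open>f'\<close>.\<close>
      have "f' \<in> gen Q G N0"
        by (rule retract_of_gen_trans[OF add_retract_of[OF N0a fp_rep_Rep] f'(1) N0R G(3)])
      then have "ext_mor P Q f' \<in> gen P F (?E N0)"
        unfolding F_def by (rule ext_mor_gen[OF _ N0R flQ GY(3)])
      then show ?thesis
        by (rule gen.eq[OF gen_comp[OF _ \<eta>] f'(2)])
    qed
    then have "comp_mor b (comp_mor a h) \<in> gen P F' U"
      unfolding F'_def by (rule gen_left[OF _ FE EM UR b])
    then show "h \<in> gen P F' U"
      by (rule gen.eq) (use mor_eqD[OF ba] Hom_mem[OF h] in \<open>simp add: mor_eq_def\<close>)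
  qed
qed

lemma precovered_on_subgrid:
  fixes N :: "(nat \<Rightarrow> 't::linorder, 'b) prep"
  assumes P: "P = grid_poset n T" and Q: "Q \<in> subgrids n T"
    and ext: "\<And>Y. Y \<in> Y0 \<Longrightarrow> Y \<in> fp_rep Q \<and> extension P Q Y \<in> add P (fp_rep P) X"
    and con: "\<And>A N. A \<in> X \<inter> supp_rep P Q \<Longrightarrow> N \<in> fp_rep Q \<Longrightarrow> is_contraction P Q A N \<Longrightarrow> N \<in> add Q (fp_rep Q) Y0"
    and X: "X \<subseteq> fp_rep P"
    and orth: "\<And>N A f. N \<in> fp_rep Q \<Longrightarrow> A \<in> X - supp_rep P Q \<Longrightarrow> f \<in> Hom P A (extension P Q N) \<Longrightarrow>
      mor_eq P A f zero_mor"
    and N: "N \<in> fp_rep Q" and pre: "precovered P X (extension P Q N)"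
  shows "precovered Q Y0 N"
proof -
  have flQ: "has_floors P Q" and finQ: "finite Q" and QP: "Q \<subseteq> P"
    using subgrid_has_floors[OF Q] subgrid_finite[OF Q] subgrid_subset[OF Q] unfolding P by auto
  let ?E = "extension P Q"
  have NR: "N \<in> Rep Q" using N fp_rep_Rep by blast
  have Qu: "y \<in> upper P Q" "floor_in Q y = y" if "y \<in> Q" for y
    using upperI[of y P y Q] floor_in_self[OF that] that QP by auto
  have Esp: "sp (?E A) y = sp A y" if "y \<in> Q" for A :: "(nat \<Rightarrow> 't, 'b) prep" and y
    using extension_sp[OF Qu(1)[OF that], of A] Qu(2)[OF that] by simp
  have Emp: "mp (?E A) y y' v = mp A y y' v" if "y \<in> Q" "y' \<in> Q" "y \<le> y'"
    for A :: "(nat \<Rightarrow> 't, 'b) prep" and y y' v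
    using extension_mp[OF Qu(1)[OF that(1)] subsetD[OF QP that(2)] that(3), of A v] Qu(2) that by simp
  \<comment> \<open>On \<open>Q\<close> extensions agree with the original representations, so a
    morphism between extensions becomes one over \<open>Q\<close> by forgetting the other
    points.\<close>
  have restrict: "f \<in> Hom Q A B" if f: "f \<in> Hom P (?E A) (?E B)" for f A B
  proof (rule HomI)
    fix y assume y: "y \<in> Q"
    show "lin_on (sp A y) (sp B y) (f y)"
      using Hom_lin[OF f subsetD[OF QP y]] unfolding Esp[OF y] .
    fix y' v assume y': "y' \<in> Q" "y \<le> y'" and v: "v \<in> sp A y"
    show "f y' (mp A y y' v) = mp B y y' (f y v)"
      using Hom_nat[OF f subsetD[OF QP y] subsetD[OF QP y'(1)] y'(2), of v] v Emp[OF y y'] Esp[OF y] by simp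
  qed
  obtain G where G: "finite G" "G \<subseteq> into P X (?E N)"
      "\<And>U h. U \<in> X \<Longrightarrow> h \<in> Hom P U (?E N) \<Longrightarrow> h \<in> gen P G U"
    using pre unfolding precovered_def by blast
  have GX: "A \<in> X" "g \<in> Hom P A (?E N)" if "(A, g) \<in> G" for A g
    using that G(2) unfolding into_def by auto
  \<comment> \<open>Members of \<open>G\<close> with other sources are zero by orthogonality, so
    they contribute nothing to the sums.\<close>
  let ?G = "{p \<in> G. fst p \<in> supp_rep P Q}"
  define S where "S p B \<eta> k \<longleftrightarrow> B \<in> add Q (fp_rep Q) Y0 \<and> \<eta> \<in> Hom P (fst p) (?E B) \<and>
      k \<in> Hom Q B N \<and> mor_eq P (fst p) (comp_mor (ext_mor P Q k) \<eta>) (snd p)" for p B \<eta> k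
  have ex: "\<exists>B \<eta> k. S p B \<eta> k" if p: "p \<in> ?G" for p
  proof -
    obtain A g where Ag: "p = (A, g)" by (cases p)
    then have A: "A \<in> X" "g \<in> Hom P A (?E N)" "A \<in> supp_rep P Q" using p GX by auto
    obtain N0 \<eta> where N0: "N0 \<in> fp_rep Q" "is_contraction P Q A N0" and \<eta>: "\<eta> \<in> Hom P A (?E N0)"
      and uni: "\<And>N f. N \<in> fp_rep Q \<Longrightarrow> f \<in> Hom P A (?E N) \<Longrightarrow>
        \<exists>f'\<in>Hom Q N0 N. mor_eq P A (comp_mor (ext_mor P Q f') \<eta>) f"
      by (rule contraction_exists[OF P Q A(3)]) blast
    have "N0 \<in> add Q (fp_rep Q) Y0" using con[OF _ N0] A by blast
    then show ?thesis using \<eta> uni[OF N A(2)] Ag unfolding S_def by auto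
  qed
  \<comment> \<open>The three witnesses for \<open>p\<close> are packed into a triple so that one
    application of choice selects them together.\<close>
  have "\<forall>p\<in>?G. \<exists>s. S p (fst s) (fst (snd s)) (snd (snd s))"
  proof
    fix p assume "p \<in> ?G"
    from ex[OF this] obtain B \<eta> k where "S p B \<eta> k" by (elim exE)
    then show "\<exists>s. S p (fst s) (fst (snd s)) (snd (snd s))"
      by (intro exI[of _ "(B, \<eta>, k)"]) simp
  qed
  from bchoice[OF this] obtain s where s: "\<forall>p\<in>?G. S p (fst (s p)) (fst (snd (s p))) (snd (snd (s p)))" ..
  define B \<eta> k where "B p = fst (s p)" and "\<eta> p = fst (snd (s p))" and "k p = snd (snd (s p))" for p
  have B: "B p \<in> add Q (fp_rep Q) Y0 \<and> \<eta> p \<in> Hom P (fst p) (?E (B p)) \<and>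
      k p \<in> Hom Q (B p) N \<and> mor_eq P (fst p) (comp_mor (ext_mor P Q (k p)) (\<eta> p)) (snd p)"
    if p: "p \<in> ?G" for p
    using bspec[OF s p] unfolding S_def B_def \<eta>_def k_def .
  define F where "F = (\<lambda>p. (B p, k p)) ` ?G"
  show ?thesis
  proof (rule precovered_add[OF fp_rep_Rep NR, of F])
    show "finite F" unfolding F_def using G(1) by simp
    show "F \<subseteq> into Q (add Q (fp_rep Q) Y0) N" unfolding F_def into_def using B by auto
    fix Y h assume Y: "Y \<in> Y0" and h: "h \<in> Hom Q Y N"
    have YR: "Y \<in> Rep Q" and EY: "?E Y \<in> add P (fp_rep P) X"
      using ext[OF Y] fp_rep_Rep by blast+
    have "ext_mor P Q h \<in> Hom P (?E Y) (?E N)" by (rule ext_mor_Hom[OF h YR NR flQ])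
    then have "ext_mor P Q h \<in> gen P G (?E Y)"
      by (rule retract_of_gen_trans[OF add_retract_of[OF EY fp_rep_Rep] _ add_Rep[OF EY fp_rep_Rep] G(3)])
    \<comment> \<open>The same function is now read as a morphism over \<open>Q\<close>. In the
      induction each supported generator over \<open>P\<close> is replaced by its factor through the
      contraction of its source.\<close>
    moreover have "f \<in> gen Q F Y" if "f \<in> gen P G (?E Y)" for f
      using that
    proof induction
      case zero
      show ?case by (rule gen.zero)
    next
      case (add f A g c)
      show ?case
      proof (cases "A \<in> supp_rep P Q")
        case True
        let ?p = "(A, g)"
        have p: "?p \<in> ?G" using add.hyps(2) True by simp
        have Bp: "mor_eq P A (comp_mor (ext_mor P Q (k ?p)) (\<eta> ?p)) g"
          using B[OF p] by simp
        have "comp_mor (\<eta> ?p) c \<in> Hom P (?E Y) (?E (B ?p))"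
          by (rule Hom_comp[OF add.hyps(3)]) (use B[OF p] in simp)
        then have "comp_mor (\<eta> ?p) c \<in> Hom Q Y (B ?p)" by (rule restrict)
        moreover have "(B ?p, k ?p) \<in> F" unfolding F_def using p by (rule image_eqI[rotated]) simp
        ultimately have "(\<lambda>x v. f x v + k ?p x (comp_mor (\<eta> ?p) c x v)) \<in> gen Q F Y"
          by (intro gen.add[OF add.IH])
        then show ?thesis
        proof (rule gen.eq, intro mor_eqI)
          fix y v assume y: "y \<in> Q" and v: "v \<in> sp Y y"
          have "c y v \<in> sp A y"
            using Hom_mem[OF add.hyps(3) subsetD[OF QP y]] v unfolding Esp[OF y] .
          then have "comp_mor (ext_mor P Q (k ?p)) (\<eta> ?p) y (c y v) = g y (c y v)"
            by (rule mor_eqD[OF Bp subsetD[OF QP y]])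
          then show "f y v + k ?p y (comp_mor (\<eta> ?p) c y v) = f y v + g y (c y v)"
            using Qu[OF y] by (simp add: ext_mor_def)
        qed
      next
        case False
        have g0: "mor_eq P A g zero_mor"
          by (rule orth[OF N _ GX(2)[OF add.hyps(2)]]) (use False GX(1)[OF add.hyps(2)] in simp)
        show ?thesis
        proof (rule gen.eq[OF add.IH], rule mor_eqI)
          fix y v assume y: "y \<in> Q" and v: "v \<in> sp Y y"
          have "c y v \<in> sp A y"
            using Hom_mem[OF add.hyps(3) subsetD[OF QP y]] v unfolding Esp[OF y] .
          then show "f y v = f y v + g y (c y v)"
            using mor_eqD[OF g0 subsetD[OF QP y]] by simp
        qed
      qed
    next
      case (eq f f')
      show ?case
        by (rule gen.eq[OF eq.IH]) (use mor_eqD[OF eq.hyps(2)] QP Esp in \<open>auto simp: mor_eq_def\<close>)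
    qed
    ultimately have "ext_mor P Q h \<in> gen Q F Y" by blast
    then show "h \<in> gen Q F Y"
      by (rule gen.eq) (use Qu in \<open>simp add: mor_eq_def ext_mor_def\<close>)
  qed
qed

lemma enough_rel_proj_grid_iff:
  fixes T :: "nat \<Rightarrow> 't::linorder set"
  assumes P: "P = grid_poset n T" and H: "grid_covering n T H" and epc: "ext_proj_class n T H X XQ"
  shows "(rel_proj P (fp_rep P) X = add P (fp_rep P) X \<and> enough_rel_proj P (fp_rep P) X) \<longleftrightarrow>
    (\<forall>Q\<in>H. rel_proj Q (fp_rep Q) (XQ Q) = add Q (fp_rep Q) (XQ Q) \<and> enough_rel_proj Q (fp_rep Q) (XQ Q))"
proof -
  have H': "Q \<in> subgrids n T" if "Q \<in> H" for Q
    using H that unfolding grid_covering_def by blast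
  note e = epc[unfolded ext_proj_class_def Let_def P[symmetric]]
  have X: "X \<subseteq> fp_rep P" and XQ: "\<And>Q. Q \<in> H \<Longrightarrow> XQ Q \<subseteq> fp_rep Q"
    using e unfolding ind_def by blast+
  have pX: "ind P (fp_rep P) \<inter> proj P (fp_rep P) \<subseteq> X"
    and pXQ: "\<And>Q. Q \<in> H \<Longrightarrow> ind Q (fp_rep Q) \<inter> proj Q (fp_rep Q) \<subseteq> XQ Q"
    using e by blast+
  have addX: "add P (fp_rep P) X = add P (fp_rep P) (\<Union>Q\<in>H. {extension P Q Y | Y. Y \<in> XQ Q})"
    and addXQ: "\<And>Q. Q \<in> H \<Longrightarrow> add Q (fp_rep Q) (XQ Q) =
        add Q (fp_rep Q) {N. \<exists>M \<in> X \<inter> supp_rep P Q. is_contraction P Q M N}"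
    using e by blast+
  have orth: "\<And>Q N A f. Q \<in> H \<Longrightarrow> N \<in> fp_rep Q \<Longrightarrow> A \<in> X - supp_rep P Q \<Longrightarrow> f \<in> Hom P A (extension P Q N) \<Longrightarrow>
      mor_eq P A f zero_mor"
    and cover: "\<And>M. M \<in> fp_rep P \<Longrightarrow> \<exists>Q\<in>H. pres_grid n T M \<subseteq> Q"
    using e by blast+
  have cofP: "floor_cofinal P" unfolding P by (rule grid_poset_floor_cofinal)
  have princ: "principal x \<in> X" if "x \<in> P" for x
    using principal_ind_proj[OF cofP that] pX by blast
  have flQ: "has_floors P Q" "finite Q" if "Q \<in> H" for Q
    using subgrid_has_floors[OF H'[OF that]] subgrid_finite[OF H'[OF that]] unfolding P by auto
  have princQ: "principal x \<in> XQ Q" if "Q \<in> H" "x \<in> Q" for Q x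
    using principal_ind_proj[OF finite_floor_cofinal[OF flQ(2)[OF that(1)]] that(2)] pXQ[OF that(1)] by blast
  have ext: "Y \<in> fp_rep Q \<and> extension P Q Y \<in> add P (fp_rep P) X" if "Q \<in> H" "Y \<in> XQ Q" for Q Y
  proof
    show Y: "Y \<in> fp_rep Q" using XQ that by blast
    show "extension P Q Y \<in> add P (fp_rep P) X"
      unfolding addX using that extension_fp_rep[OF Y flQ[OF that(1)]] by (intro add.base) blast+
  qed
  have con: "N \<in> add Q (fp_rep Q) (XQ Q)"
    if "Q \<in> H" "A \<in> X \<inter> supp_rep P Q" "N \<in> fp_rep Q" "is_contraction P Q A N" for Q A N
    unfolding addXQ[OF that(1)] using that by (intro add.base) blast+
  have "(\<forall>M\<in>fp_rep P. precovered P X M) \<longleftrightarrow> (\<forall>Q\<in>H. \<forall>N\<in>fp_rep Q. precovered Q (XQ Q) N)"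
  proof (intro iffI ballI)
    fix Q N assume pre: "\<forall>M\<in>fp_rep P. precovered P X M" and Q: "Q \<in> H" and N: "N \<in> fp_rep Q"
    show "precovered Q (XQ Q) N"
      by (rule precovered_on_subgrid[OF P H'[OF Q] ext[OF Q] con[OF Q] X orth[OF Q] N
            pre[rule_format, OF extension_fp_rep[OF N flQ[OF Q]]]])
  next
    fix M assume pre: "\<forall>Q\<in>H. \<forall>N\<in>fp_rep Q. precovered Q (XQ Q) N" and M: "M \<in> fp_rep P"
    obtain Q where Q: "Q \<in> H" "pres_grid n T M \<subseteq> Q" using cover[OF M] by blast
    \<comment> \<open>The last condition on the classes supplies a \<open>Q\<close> around all
      points of minimal presentations, and this makes \<open>M\<close> tame over
      \<open>Q\<close>.\<close>
    have "pres_points P M \<subseteq> Q"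
      using pres_points_subset_pres_grid[OF M[unfolded P]] Q(2) unfolding P by (rule subset_trans)
    then have tQ: "tame P Q M" by (rule pres_points_tame(2)[OF cofP M flQ(1)[OF Q(1)]])
    show "precovered P X M"
      by (rule precovered_from_subgrid[OF P H'[OF Q(1)] ext[OF Q(1)] con[OF Q(1)] X orth[OF Q(1)]
            subsetD[OF fp_rep_Rep M] tQ pre[rule_format, OF Q(1)]])
  qed
  moreover note enough_rel_proj_iff_precovered[OF cofP X princ]
  moreover have "rel_proj Q (fp_rep Q) (XQ Q) = add Q (fp_rep Q) (XQ Q) \<and> enough_rel_proj Q (fp_rep Q) (XQ Q) \<longleftrightarrow>
      (\<forall>N\<in>fp_rep Q. precovered Q (XQ Q) N)" if "Q \<in> H" for Q
    by (rule enough_rel_proj_iff_precovered[OF finite_floor_cofinal[OF flQ(2)[OF that]] XQ[OF that] princQ[OF that]])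
  ultimately show ?thesis by simp
qed

end

theorem theorem7p22:
  fixes scale :: "'k::field \<Rightarrow> 'v::ab_group_add \<Rightarrow> 'v"
    and n :: nat
    and T :: "nat \<Rightarrow> 't::linorder set"
    and P :: "(nat \<Rightarrow> 't) set"
    and H :: "(nat \<Rightarrow> 't) set set"
    and X :: "(nat \<Rightarrow> 't, 'v) prep set"
    and XQ :: "(nat \<Rightarrow> 't) set \<Rightarrow> (nat \<Rightarrow> 't, 'v) prep set"
  assumes "vec_universe scale"
    and "\<forall>i<n. \<exists>a\<in>T i. \<exists>b\<in>T i. a \<noteq> b"
    and "P = grid_poset n T"
    and "grid_covering n T H"
    and "vec_universe.ext_proj_class scale n T H X XQ"
  shows
    "(vec_universe.rel_proj scale P (vec_universe.fp_rep scale P) X =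
        vec_universe.add scale P (vec_universe.fp_rep scale P) X \<and>
      vec_universe.enough_rel_proj scale P (vec_universe.fp_rep scale P) X)
     \<longleftrightarrow>
     (\<forall>Q\<in>H.
        vec_universe.rel_proj scale Q (vec_universe.fp_rep scale Q) (XQ Q) =
          vec_universe.add scale Q (vec_universe.fp_rep scale Q) (XQ Q) \<and>
        vec_universe.enough_rel_proj scale Q (vec_universe.fp_rep scale Q) (XQ Q))"
  by (rule vec_universe.enough_rel_proj_grid_iff[OF assms(1,3-5)])

end
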